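(* Let $p$ be prime. Let $u$ be a fixed point of a profinite substitution $\theta=\varprojlim\theta_\alpha$, with each $\theta_\alpha$ length-$p$ and primitive. For each $\alpha$ let $u_\alpha=\psi_{\alpha,\infty}(u)$, which is a fixed point of $\theta_\alpha$, so that $(X_u,\mathcal B,\mu,\sigma)=\varprojlim(X_{u_\alpha},\mathcal B_\alpha,\mu_\alpha,\sigma)$, where $\mathcal B,\mathcal B_\alpha$ are the Borel $\sigma$-algebras and $\mu,\mu_\alpha$ the unique $\sigma$-invariant Borel probability measures on $X_u$, $X_{u_\alpha}$. Then the maximal equicontinuous factor of $(X_u,\sigma)$ is an odometer, and every measurable eigenvalue of $(X_u,\mathcal B,\mu,\sigma)$ is a continuous eigenvalue.
   Context: $\Sigma_p=\{0,\dots,p-1\}$. An inverse family of finite automata is a sequence $(\mathcal M_\alpha)_{\alpha\ge0}=(\mathcal S_\alpha,\Sigma_p,\delta_\alpha,\overline s_\alpha,\mathbb Z/(p^\alpha\mathbb Z),\tau_\alpha)_{\alpha\ge0}$ where $\mathcal S_\alpha$ is a finite set of states, $\overline s_\alpha\in\mathcal S_\alpha$ the initial state, $\delta_\alpha:\mathcal S_\alpha\times\Sigma_p\to\mathcal S_\alpha$ the transition function, $\tau_\alpha:\mathcal S_\alpha\to\mathbb Z/(p^\alpha\mathbb Z)$ the output function, together with maps $\psi_{\alpha,\beta}:\mathcal S_\beta\to\mathcal S_\alpha$ ($0\le\alpha\le\beta$) satisfying $\psi_{\alpha,\beta}(\overline s_\beta)=\overline s_\alpha$, $\psi_{\alpha,\beta}(\delta_\beta(s,i))=\delta_\alpha(\psi_{\alpha,\beta}(s),i)$,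 $\tau_\beta(s)\bmod p^\alpha=\tau_\alpha(\psi_{\alpha,\beta}(s))$ and $\psi_{\alpha,\gamma}=\psi_{\alpha,\beta}\circ\psi_{\beta,\gamma}$ for $\alpha\le\beta\le\gamma$. The automaton $\mathcal M_\alpha$ (with $\delta_\alpha(\overline s_\alpha,0)=\overline s_\alpha$) defines the length-$p$ substitution $\theta_\alpha$ on $\mathcal S_\alpha$, $\theta_\alpha(s)=\delta_\alpha(s,0)\delta_\alpha(s,1)\cdots\delta_\alpha(s,p-1)$. Let $\mathcal S=\varprojlim\mathcal S_\alpha=\{(s_\alpha)_\alpha\in\prod_\alpha\mathcal S_\alpha:\psi_{\alpha,\beta}(s_\beta)=s_\alpha\text{ for all }\alpha\le\beta\}$ with the inverse limit topology (each $\mathcal S_\alpha$ discrete), and $\psi_{\alpha,\infty}:\mathcal S\to\mathcal S_\alpha$, $s\mapsto s_\alpha$ (applied termwise to sequences). The profinite substitution $\theta=\varprojlim\theta_\alpha$ is the length-$p$ substitution $\theta:\mathcal S\to\mathcal S^p$ whose $i$-th letter is $\theta(s)_i=\varprojlim\theta_\alpha(s_\alpha)_i$, i.e. $(\theta(s)_i)_\alpha=\delta_\alpha(s_\alpha,i)$, for $0\le i\le p-1$. It extends to $\mathcal S^{\mathbb N}$ by concatenation, and a fixed point is $u\in\mathcal S^{\mathbb N}$ with $\theta(u)=u$. Sequence spaces have the product topology, $\sigma$ is the shift $(x(n))_{n\geq 0}\mapsto(x(n+1))_{n\geq 0}$, and $X_x$ is the closure of $\{\sigma^n(x):n\in\mathbb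 N\}$. A substitution $\theta$ on a finite alphabet $\mathcal A$ is primitive if there is $k\in\mathbb N$ such that for all $a,a'\in\mathcal A$ the word $\theta^k(a)$ contains $a'$. Under the hypotheses of the statement, $(X_u,\sigma)$ and each $(X_{u_\alpha},\sigma)$ are minimal and uniquely ergodic. A measurable eigenvalue is $\lambda\in\mathbb C$ for which there is a nonzero $f\in L^2(X_u,\mathcal B,\mu)$ with $f\circ\sigma=\lambda f$ $\mu$-a.e.; it is a continuous eigenvalue if there is a nonzero continuous $f:X_u\to\mathbb C$ with $f\circ\sigma=\lambda f$. The maximal equicontinuous factor is the largest equicontinuous topological factor of $(X_u,\sigma)$, a rotation on a compact abelian group. An odometer is a system topologically conjugate to $(\varprojlim_n\mathbb Z/(s_n\mathbb Z),+1)$ for some sequence of positive integers with $s_n\mid s_{n+1}$ for all $n$; the degenerate case of a finite cyclic group ($s_n$ bounded) is included. *)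

theory Defs
  imports "HOL-Analysis.Analysis" "HOL-Probability.Probability"
    "HOL-Computational_Algebra.Primes"
begin

section \<open>Sequence spaces, inverse limits and orbit closures\<close>

text \<open>Spaces are abstract topologies. A bonding map \<open>\<psi> \<alpha> \<beta>\<close> goes from level
  \<open>\<beta>\<close> down to level \<open>\<alpha>\<close>, and is only relevant for \<open>\<alpha> \<le> \<beta>\<close>.\<close>

definition inverse_limit ::
    "(nat \<Rightarrow> 'a topology) \<Rightarrow> (nat \<Rightarrow> nat \<Rightarrow> 'a \<Rightarrow> 'a) \<Rightarrow> (nat \<Rightarrow> 'a) topology" where
  "inverse_limit X \<psi> =
     subtopology (product_topology X UNIV) {s. \<forall>\<alpha> \<beta>. \<alpha> \<le> \<beta> \<longrightarrow> \<psi> \<alpha> \<beta> (s \<beta>) = s \<alpha>}"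

definition seq_space :: "'a topology \<Rightarrow> (nat \<Rightarrow> 'a) topology" where
  "seq_space A = product_topology (\<lambda>_. A) UNIV"

definition shift :: "(nat \<Rightarrow> 'a) \<Rightarrow> (nat \<Rightarrow> 'a)" where
  "shift x = (\<lambda>n. x (Suc n))"

text \<open>The subshift \<open>X\<^sub>x\<close>, where \<open>A\<close> is the (topological) alphabet.\<close>

definition subshift :: "'a topology \<Rightarrow> (nat \<Rightarrow> 'a) \<Rightarrow> (nat \<Rightarrow> 'a) topology" where
  "subshift A x =
     subtopology (seq_space A) (seq_space A closure_of {(shift ^^ n) x | n. True})"


section \<open>Substitutions\<close>

type_synonym 'a subst = "'a \<Rightarrow> 'a list"

definition subst_word :: "'a subst \<Rightarrow> 'a list \<Rightarrow> 'a list" where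
  "subst_word \<theta> w = concat (map \<theta> w)"

definition primitive_subst :: "'a set \<Rightarrow> 'a subst \<Rightarrow> bool" where
  "primitive_subst A \<theta> \<longleftrightarrow>
     (\<exists>k. \<forall>a\<in>A. \<forall>a'\<in>A. a' \<in> set ((subst_word \<theta> ^^ k) [a]))"

text \<open>The extension by concatenation of a substitution of constant length \<open>p\<close> to sequences:
  the \<open>n\<close>-th letter of \<open>\<theta>(x\<^sub>0) \<theta>(x\<^sub>1) \<theta>(x\<^sub>2) \<dots>\<close> is the letter \<open>n mod p\<close> of the block
  with index \<open>n div p\<close>.\<close>

definition subst_seq :: "nat \<Rightarrow> 'a subst \<Rightarrow> (nat \<Rightarrow> 'a) \<Rightarrow> (nat \<Rightarrow> 'a)" where
  "subst_seq p \<theta> x = (\<lambda>n. \<theta> (x (n div p)) ! (n mod p))"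

definition automaton_subst :: "nat \<Rightarrow> ('s \<Rightarrow> nat \<Rightarrow> 's) \<Rightarrow> 's subst" where
  "automaton_subst p \<delta> s = map (\<delta> s) [0..<p]"

text \<open>The profinite substitution: \<open>\<theta>(s)\<^sub>i\<close> is the point of the inverse limit whose
  \<open>\<alpha>\<close>-component is \<open>\<theta>\<^sub>\<alpha>(s\<^sub>\<alpha>)\<^sub>i\<close>.\<close>

definition profinite_subst :: "nat \<Rightarrow> (nat \<Rightarrow> 's subst) \<Rightarrow> (nat \<Rightarrow> 's) subst" where
  "profinite_subst p \<theta> s = map (\<lambda>i \<alpha>. \<theta> \<alpha> (s \<alpha>) ! i) [0..<p]"


section \<open>Inverse families of automata\<close>

text \<open>All state sets live in one type; this is no restriction, since they are finite.
  The digit alphabet is \<open>{0..<p}\<close>, and \<open>\<int>/p\<^sup>\<alpha>\<int>\<close> is represented by the residues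
  \<open>{0..<p^\<alpha>}\<close>.\<close>

locale inverse_family =
  fixes p :: nat
    and S :: "nat \<Rightarrow> 's set"
    and \<delta> :: "nat \<Rightarrow> 's \<Rightarrow> nat \<Rightarrow> 's"
    and init :: "nat \<Rightarrow> 's"
    and \<tau> :: "nat \<Rightarrow> 's \<Rightarrow> nat"
    and \<psi> :: "nat \<Rightarrow> nat \<Rightarrow> 's \<Rightarrow> 's"
  assumes finite_states: "\<And>\<alpha>. finite (S \<alpha>)"
    and init_state: "\<And>\<alpha>. init \<alpha> \<in> S \<alpha>"
    and transition: "\<And>\<alpha> s i. s \<in> S \<alpha> \<Longrightarrow> i < p \<Longrightarrow> \<delta> \<alpha> s i \<in> S \<alpha>"
    and output_residue: "\<And>\<alpha> s. s \<in> S \<alpha> \<Longrightarrow> \<tau> \<alpha> s \<in> {0..<p ^ \<alpha>}"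
    and bond_state: "\<And>\<alpha> \<beta> s. \<alpha> \<le> \<beta> \<Longrightarrow> s \<in> S \<beta> \<Longrightarrow> \<psi> \<alpha> \<beta> s \<in> S \<alpha>"
    and bond_init: "\<And>\<alpha> \<beta>. \<alpha> \<le> \<beta> \<Longrightarrow> \<psi> \<alpha> \<beta> (init \<beta>) = init \<alpha>"
    and bond_transition: "\<And>\<alpha> \<beta> s i. \<alpha> \<le> \<beta> \<Longrightarrow> s \<in> S \<beta> \<Longrightarrow> i < p \<Longrightarrow>
           \<psi> \<alpha> \<beta> (\<delta> \<beta> s i) = \<delta> \<alpha> (\<psi> \<alpha> \<beta> s) i"
    and bond_output: "\<And>\<alpha> \<beta> s. \<alpha> \<le> \<beta> \<Longrightarrow> s \<in> S \<beta> \<Longrightarrow>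
           \<tau> \<beta> s mod p ^ \<alpha> = \<tau> \<alpha> (\<psi> \<alpha> \<beta> s)"
    and bond_comp: "\<And>\<alpha> \<beta> \<gamma> s. \<alpha> \<le> \<beta> \<Longrightarrow> \<beta> \<le> \<gamma> \<Longrightarrow> s \<in> S \<gamma> \<Longrightarrow>
           \<psi> \<alpha> \<gamma> s = \<psi> \<alpha> \<beta> (\<psi> \<beta> \<gamma> s)"

definition state_limit ::
    "(nat \<Rightarrow> 's set) \<Rightarrow> (nat \<Rightarrow> nat \<Rightarrow> 's \<Rightarrow> 's) \<Rightarrow> (nat \<Rightarrow> 's) topology" where
  "state_limit S \<psi> = inverse_limit (\<lambda>\<alpha>. discrete_topology (S \<alpha>)) \<psi>"

text \<open>The projection \<open>\<psi>\<^bsub>\<alpha>,\<infinity>\<^esub>\<close>, applied termwise to a sequence over the inverse limit.\<close>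

definition level :: "nat \<Rightarrow> (nat \<Rightarrow> nat \<Rightarrow> 's) \<Rightarrow> (nat \<Rightarrow> 's)" where
  "level \<alpha> x = (\<lambda>n. x n \<alpha>)"


section \<open>Invariant measures and eigenvalues\<close>

definition borel_of :: "'a topology \<Rightarrow> 'a measure" where
  "borel_of X = sigma (topspace X) {U. openin X U}"

definition invariant_borel_prob :: "'a topology \<Rightarrow> ('a \<Rightarrow> 'a) \<Rightarrow> 'a measure \<Rightarrow> bool" where
  "invariant_borel_prob X T \<mu> \<longleftrightarrow>
     prob_space \<mu> \<and> sets \<mu> = sets (borel_of X) \<and> T \<in> measurable \<mu> \<mu> \<and> distr \<mu> \<mu> T = \<mu>"

definition measurable_eigenvalue :: "'a measure \<Rightarrow> ('a \<Rightarrow> 'a) \<Rightarrow> complex \<Rightarrow> bool" where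
  "measurable_eigenvalue \<mu> T c \<longleftrightarrow>
     (\<exists>f :: 'a \<Rightarrow> complex.
        f \<in> borel_measurable \<mu> \<and> integrable \<mu> (\<lambda>x. (cmod (f x))\<^sup>2) \<and>
        \<not> (AE x in \<mu>. f x = 0) \<and> (AE x in \<mu>. f (T x) = c * f x))"

definition continuous_eigenvalue :: "'a topology \<Rightarrow> ('a \<Rightarrow> 'a) \<Rightarrow> complex \<Rightarrow> bool" where
  "continuous_eigenvalue X T c \<longleftrightarrow>
     (\<exists>f :: 'a \<Rightarrow> complex.
        continuous_map X euclidean f \<and> (\<exists>x\<in>topspace X. f x \<noteq> 0) \<and>
        (\<forall>x\<in>topspace X. f (T x) = c * f x))"


section \<open>Factors, equicontinuity and odometers\<close>

definition factor_map ::
    "'a topology \<Rightarrow> ('a \<Rightarrow> 'a) \<Rightarrow> 'b topology \<Rightarrow> ('b \<Rightarrow> 'b) \<Rightarrow> ('a \<Rightarrow> 'b) \<Rightarrow> bool" where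
  "factor_map X T Y R \<pi> \<longleftrightarrow>
     continuous_map X Y \<pi> \<and> \<pi> ` topspace X = topspace Y \<and>
     (\<forall>x\<in>topspace X. \<pi> (T x) = R (\<pi> x))"

definition conjugate ::
    "'a topology \<Rightarrow> ('a \<Rightarrow> 'a) \<Rightarrow> 'b topology \<Rightarrow> ('b \<Rightarrow> 'b) \<Rightarrow> bool" where
  "conjugate X T Y R \<longleftrightarrow>
     (\<exists>h. homeomorphic_map X Y h \<and> (\<forall>x\<in>topspace X. h (T x) = R (h x)))"

text \<open>The condition does not depend on the choice of the compatible metric \<open>d\<close>, as the space
  is compact. Metrizability is no restriction on the factors of a compact metrizable system:
  Hausdorff continuous images of compact metrizable spaces are metrizable.\<close>

definition equicontinuous_system :: "'a topology \<Rightarrow> ('a \<Rightarrow> 'a) \<Rightarrow> bool" where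
  "equicontinuous_system X T \<longleftrightarrow>
     compact_space X \<and> continuous_map X X T \<and>
     (\<exists>d. Metric_space (topspace X) d \<and> Metric_space.mtopology (topspace X) d = X \<and>
        (\<forall>\<epsilon>>0. \<exists>\<eta>>0. \<forall>x\<in>topspace X. \<forall>y\<in>topspace X. d x y < \<eta> \<longrightarrow>
           (\<forall>n. d ((T ^^ n) x) ((T ^^ n) y) < \<epsilon>)))"

text \<open>\<open>(Y, R)\<close>, with factor map \<open>\<pi>\<close>, is the largest equicontinuous factor of \<open>(X, T)\<close>: every
  equicontinuous factor of \<open>(X, T)\<close> is a factor of \<open>(Y, R)\<close>, compatibly with the maps from
  \<open>X\<close>. A definition cannot quantify over types, so the competing factors range over spaces
  whose points are sets of points of \<open>X\<close>. Lemma \<open>maximal_equicontinuous_factorD\<close> below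
  shows that this entails the property for factors of any type, since every factor
  can be realised on the fibres of its factor map.\<close>

definition maximal_equicontinuous_factor ::
    "'a topology \<Rightarrow> ('a \<Rightarrow> 'a) \<Rightarrow> 'b topology \<Rightarrow> ('b \<Rightarrow> 'b) \<Rightarrow> ('a \<Rightarrow> 'b) \<Rightarrow> bool" where
  "maximal_equicontinuous_factor X T Y R \<pi> \<longleftrightarrow>
     equicontinuous_system Y R \<and> factor_map X T Y R \<pi> \<and>
     (\<forall>(Z :: 'a set topology) Q \<rho>.
        equicontinuous_system Z Q \<and> factor_map X T Z Q \<rho> \<longrightarrow>
        (\<exists>\<phi>. factor_map Y R Z Q \<phi> \<and> (\<forall>x\<in>topspace X. \<rho> x = \<phi> (\<pi> x))))"

text \<open>The system \<open>(lim \<int>/s\<^sub>n\<int>, +1)\<close>, with residues \<open>{0..<s n}\<close> and the reduction maps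
  as bonding maps.\<close>

definition odometer_space :: "(nat \<Rightarrow> nat) \<Rightarrow> (nat \<Rightarrow> nat) topology" where
  "odometer_space s =
     inverse_limit (\<lambda>n. discrete_topology {0..<s n}) (\<lambda>m n x. x mod s m)"

definition odometer_map :: "(nat \<Rightarrow> nat) \<Rightarrow> (nat \<Rightarrow> nat) \<Rightarrow> (nat \<Rightarrow> nat)" where
  "odometer_map s x = (\<lambda>n. (x n + 1) mod s n)"

definition is_odometer :: "'a topology \<Rightarrow> ('a \<Rightarrow> 'a) \<Rightarrow> bool" where
  "is_odometer Y R \<longleftrightarrow>
     (\<exists>s. (\<forall>n. 0 < s n \<and> s n dvd s (Suc n)) \<and> conjugate Y R (odometer_space s) (odometer_map s))"


section \<open>The universal property holds for factors of every type\<close>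

lemma equicontinuous_system_transfer:
  fixes Z :: "'b topology" and e :: "'b \<Rightarrow> 'c"
  assumes eq: "equicontinuous_system Z Q" and inj: "inj_on e (topspace Z)"
  obtains Z' Q' g where "equicontinuous_system Z' Q'" "factor_map Z Q Z' Q' e"
    "factor_map Z' Q' Z Q g" "\<And>z. z \<in> topspace Z \<Longrightarrow> g (e z) = z"
proof -
  define g where "g = inv_into (topspace Z) e"
  define Z' where "Z' = pullback_topology (e ` topspace Z) g Z"
  define Q' where "Q' = e \<circ> Q \<circ> g"
  have ge: "g (e z) = z" if "z \<in> topspace Z" for z
    using that inj by (simp add: g_def)
  obtain d where comp: "compact_space Z" and cQ: "continuous_map Z Z Q"
    and d: "Metric_space (topspace Z) d" "Metric_space.mtopology (topspace Z) d = Z"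
    and ec: "\<forall>\<epsilon>>0. \<exists>\<eta>>0. \<forall>x\<in>topspace Z. \<forall>y\<in>topspace Z. d x y < \<eta> \<longrightarrow>
           (\<forall>n. d ((Q ^^ n) x) ((Q ^^ n) y) < \<epsilon>)"
    using eq unfolding equicontinuous_system_def by blast
  have tZ': "topspace Z' = e ` topspace Z"
    using ge by (auto simp: Z'_def topspace_pullback_topology)
  have opZ': "openin Z' U \<longleftrightarrow> (\<exists>V. openin Z V \<and> U = e ` V)" for U
  proof -
    have "g -` V \<inter> e ` topspace Z = e ` V" if "openin Z V" for V
      using openin_subset[OF that] ge by (auto simp: image_iff)
    then show ?thesis
      unfolding Z'_def openin_pullback_topology by metis
  qed
  have ce: "continuous_map Z Z' e"
    unfolding continuous_map_def
  proof (intro conjI allI impI)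
    show "e \<in> topspace Z \<rightarrow> topspace Z'" by (auto simp: tZ')
    fix U assume "openin Z' U"
    then obtain V where V: "openin Z V" "U = e ` V" using opZ' by blast
    have "{x \<in> topspace Z. e x \<in> U} = V"
      using openin_subset[OF V(1)] inj V(2) by (auto simp: inj_on_def)
    then show "openin Z {x \<in> topspace Z. e x \<in> U}" using V by simp
  qed
  have cg: "continuous_map Z' Z g"
    unfolding continuous_map_def
  proof (intro conjI allI impI)
    show "g \<in> topspace Z' \<rightarrow> topspace Z" using ge by (auto simp: tZ')
    fix V assume V: "openin Z V"
    have "{x \<in> topspace Z'. g x \<in> V} = e ` V"
      using openin_subset[OF V] ge by (auto simp: tZ' image_iff) 
    then show "openin Z' {x \<in> topspace Z'. g x \<in> V}" using V opZ' by blast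
  qed
  have Qin: "Q z \<in> topspace Z" if "z \<in> topspace Z" for z
    using cQ that by (auto simp: continuous_map_def)
  have Qn: "(Q ^^ n) z \<in> topspace Z" if "z \<in> topspace Z" for n z
    using that by (induction n) (auto simp: Qin)
  have Q'n: "g ((Q' ^^ n) (e z)) = (Q ^^ n) z \<and> (Q' ^^ n) (e z) = e ((Q ^^ n) z)"
    if "z \<in> topspace Z" for n z
    using that by (induction n) (auto simp: ge Q'_def Qin Qn)
  define d' where "d' = (\<lambda>a b. d (g a) (g b))"
  interpret M: Metric_space "topspace Z" d by (rule d(1))
  interpret M': Metric_space "topspace Z'" d'
    by unfold_locales
      (auto simp: d'_def tZ' ge M.commute M.triangle inj_on_eq_iff[OF inj])
  have ball: "M'.mball (e z) r = e ` M.mball z r" if "z \<in> topspace Z" for z r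
    using that unfolding M'.mball_def M.mball_def by (auto simp: d'_def tZ' ge)
  have top': "M'.mtopology = Z'"
  proof (rule topology_eq[THEN iffD2], intro allI)
    fix U
    have "openin M'.mtopology U \<longleftrightarrow>
        U \<subseteq> e ` topspace Z \<and> (\<forall>x\<in>U. \<exists>r>0. M'.mball x r \<subseteq> U)"
      unfolding M'.openin_mtopology by (simp add: tZ' Ball_def)
    also have "\<dots> \<longleftrightarrow> (\<exists>V. V \<subseteq> topspace Z \<and> U = e ` V \<and> (\<forall>z\<in>V. \<exists>r>0. M.mball z r \<subseteq> V))"
      (is "?L \<longleftrightarrow> ?R")
    proof
      assume L: ?L
      define V where "V = {z \<in> topspace Z. e z \<in> U}"
      have "U = e ` V" using L by (auto simp: V_def)
      moreover have "\<exists>r>0. M.mball z r \<subseteq> V" if z: "z \<in> V" for z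
      proof -
        have z1: "z \<in> topspace Z" "e z \<in> U" using z by (auto simp: V_def)
        then obtain r where r: "r > 0" "M'.mball (e z) r \<subseteq> U" using L by blast
        then have "M.mball z r \<subseteq> V"
          using ball[OF z1(1)] by (auto simp: V_def M.mball_def)
        then show ?thesis using r by blast
      qed
      ultimately show ?R by (intro exI[of _ V]) (auto simp: V_def)
    next
      assume ?R
      then obtain V where V: "V \<subseteq> topspace Z" "U = e ` V" "\<forall>z\<in>V. \<exists>r>0. M.mball z r \<subseteq> V"
        by blast
      have "\<exists>r>0. M'.mball x r \<subseteq> U" if "x \<in> U" for x
      proof -
        obtain z where z: "z \<in> V" "x = e z" using \<open>x \<in> U\<close> V by blast
        obtain r where "r > 0" "M.mball z r \<subseteq> V" using V z by blast
        then show ?thesis using ball[of z r] z V by (intro exI[of _ r]) auto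
      qed
      then show ?L using V by auto
    qed
    also have "\<dots> \<longleftrightarrow> (\<exists>V. openin Z V \<and> U = e ` V)"
      by (subst (2) d(2)[symmetric]) (auto simp: M.openin_mtopology)
    finally show "openin M'.mtopology U \<longleftrightarrow> openin Z' U" using opZ' by simp
  qed
  have cQ': "continuous_map Z' Z' Q'"
    unfolding Q'_def
    by (rule continuous_map_compose[OF cg continuous_map_compose[OF cQ ce]])
  have comp': "compact_space Z'"
    using image_compactin[OF _ ce, of "topspace Z"] comp tZ' by (simp add: compact_space_def)
  have "equicontinuous_system Z' Q'"
    unfolding equicontinuous_system_def
  proof (intro conjI exI[of _ d'] comp' cQ' M'.Metric_space_axioms top' allI impI)
    fix \<epsilon> :: real assume "\<epsilon> > 0"
    then obtain \<eta> where "\<eta> > 0" and \<eta>: "\<forall>x\<in>topspace Z. \<forall>y\<in>topspace Z. d x y < \<eta> \<longrightarrow>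
           (\<forall>n. d ((Q ^^ n) x) ((Q ^^ n) y) < \<epsilon>)"
      using ec by blast
    then show "\<exists>\<eta>>0. \<forall>x\<in>topspace Z'. \<forall>y\<in>topspace Z'. d' x y < \<eta> \<longrightarrow>
           (\<forall>n. d' ((Q' ^^ n) x) ((Q' ^^ n) y) < \<epsilon>)"
      by (intro exI[of _ \<eta>]) (auto simp: tZ' d'_def ge Q'n Qn)
  qed
  moreover have "factor_map Z Q Z' Q' e"
    unfolding factor_map_def using ce tZ' ge by (auto simp: Q'_def)
  moreover have "factor_map Z' Q' Z Q g"
    unfolding factor_map_def using cg tZ' ge Qin by (auto simp: Q'_def image_image)
  ultimately show thesis using that ge by blast
qed

lemma factor_map_compose:
  assumes "factor_map X T Y R f" "factor_map Y R Z Q g"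
  shows "factor_map X T Z Q (g \<circ> f)"
  using assms unfolding factor_map_def
  by (auto intro: continuous_map_compose simp flip: image_image)

lemma maximal_equicontinuous_factorD:
  fixes X :: "'a topology" and Z :: "'c topology"
  assumes mef: "maximal_equicontinuous_factor X T Y R \<pi>"
    and eq: "equicontinuous_system Z Q" and fac: "factor_map X T Z Q \<rho>"
  shows "\<exists>\<phi>. factor_map Y R Z Q \<phi> \<and> (\<forall>x\<in>topspace X. \<rho> x = \<phi> (\<pi> x))"
proof -
  define e where "e z = {x \<in> topspace X. \<rho> x = z}" for z
  have im: "\<rho> ` topspace X = topspace Z" using fac by (simp add: factor_map_def)
  have "inj_on e (topspace Z)"
    unfolding inj_on_def im[symmetric] e_def by blast
  then obtain Z' Q' g where Z': "equicontinuous_system Z' Q'" "factor_map Z Q Z' Q' e"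
    "factor_map Z' Q' Z Q g" and g: "\<And>z. z \<in> topspace Z \<Longrightarrow> g (e z) = z"
    using equicontinuous_system_transfer[OF eq] by metis
  have "factor_map X T Z' Q' (e \<circ> \<rho>)" using factor_map_compose[OF fac Z'(2)] .
  with mef Z'(1) obtain \<phi> where \<phi>: "factor_map Y R Z' Q' \<phi>"
      "\<forall>x\<in>topspace X. (e \<circ> \<rho>) x = \<phi> (\<pi> x)"
    unfolding maximal_equicontinuous_factor_def by blast
  have "\<rho> x = (g \<circ> \<phi>) (\<pi> x)" if "x \<in> topspace X" for x
  proof -
    have "\<phi> (\<pi> x) = e (\<rho> x)" using \<phi>(2) that by simp
    moreover have "\<rho> x \<in> topspace Z" using im that by blast
    ultimately show ?thesis using g[of "\<rho> x"] by simp
  qed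
  then show ?thesis using factor_map_compose[OF \<phi>(1) Z'(3)] by blast
qed

end

theory Submission
  imports Defs "HOL-Number_Theory.Cong" "HOL-Complex_Analysis.Great_Picard"
begin

text \<open>Everything is reduced to the levels \<open>u\<^sub>\<alpha>\<close>. If a sequence that depends only on a window
  of \<open>u\<^sub>\<alpha>\<close> has averages \<open>(1/N) \<Sum>\<^sub>x \<lambda>\<^sup>x h(n + x)\<close> that do not tend to zero uniformly in \<open>n\<close>,
  then the block structure of \<open>u\<^sub>\<alpha>\<close> forces \<open>\<lambda>\<^bsup>p^k r\<^esup> \<rightarrow> 1\<close> for all return
  times \<open>r\<close>, hence \<open>\<lambda>\<close> is a root of unity. Its order \<open>q\<close> is such that windows of \<open>u\<^sub>\<alpha>\<close>
  determine the position modulo \<open>q\<close>: the part of \<open>q\<close> prime to \<open>p\<close> is determined by single letters,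
  and if windows did not determine the position modulo \<open>p\<^sup>k\<close>, then \<open>u\<^sub>\<alpha>\<close> would be periodic, in
  which case \<open>\<lambda>\<close> has order dividing the minimal period. Thus \<open>\<lambda>\<close> is a continuous eigenvalue. For a measurable eigenfunction \<open>f\<close> one takes for \<open>h\<close>
  the indicator of a cylinder on which \<open>f\<close> has nonzero integral, which replaces
  conditional expectations. An equicontinuous factor yields almost periodic sequences, whose
  frequencies are found by finite Fourier analysis and have the same orders; hence
  these sequences are uniform limits of periodic ones, and the factor is a factor of the odometer
  of all moduli that windows of the levels determine.\<close>

section \<open>Fixed points of substitutions of prime length\<close>

text \<open>A square-integrable eigenfunction is defined on the whole limit and only almost
  everywhere, while the block structure is visible only along single sequences over finite
  alphabets. The link between the two is a lower bound \<open>c * real N\<close> for twisted sums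
  \<open>\<Sum>m<N. l ^ m * h (n + m)\<close>, valid for every \<open>N\<close> at some
  \<open>n\<close>. It comes from an integral identity for measurable eigenvalues and from Parseval
  and compactness of the circle for equicontinuous factors; after an approximation it concerns one
  level only. The convergence of \<open>l ^ (p ^ k * r)\<close> to 1 is a convexity effect: numbers
  in a disc whose average is nearly extremal are nearly equal. The limit is attained because the
  p-th power map is expanding near 1. Sequences are one-sided, so a position has to be read from the
  window to its right. Asking only for the position modulo \<open>q\<close> covers both the part
  prime to p, usually called the height, and recognizability, which concerns powers of p, and it is
  exactly what makes \<open>n \<mapsto> l ^ n\<close> extend continuously when
  \<open>l ^ q = 1\<close>.\<close>

definition same_window :: "(nat \<Rightarrow> 'a) \<Rightarrow> nat \<Rightarrow> nat \<Rightarrow> nat \<Rightarrow> bool" where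
  "same_window w W n m \<longleftrightarrow> (\<forall>i<W. w (n + i) = w (m + i))"

definition periodic_seq :: "(nat \<Rightarrow> 'a) \<Rightarrow> bool" where
  "periodic_seq w \<longleftrightarrow> (\<exists>m>0. \<forall>n. w (n + m) = w n)"

text \<open>Over a finite alphabet this is the combinatorial form of the rotation on the integers
  modulo \<open>q\<close> being a topological factor of the orbit closure of
  \<open>w\<close>.\<close>

definition determines_mod :: "(nat \<Rightarrow> 'a) \<Rightarrow> nat \<Rightarrow> bool" where
  "determines_mod w q \<longleftrightarrow> (\<exists>W. \<forall>n m. same_window w W n m \<longrightarrow> [n = m] (mod q))"

lemma same_window_mono: "same_window w W n m \<Longrightarrow> V \<le> W \<Longrightarrow> same_window w V n m"
  by (auto simp: same_window_def)

lemma same_window_sym: "same_window w W n m \<Longrightarrow> same_window w W m n"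
  by (auto simp: same_window_def)

lemma same_window_trans:
  "same_window w W n m \<Longrightarrow> same_window w W m l \<Longrightarrow> same_window w W n l"
  by (auto simp: same_window_def)

lemma determines_mod_one: "determines_mod w 1"
  by (auto simp: determines_mod_def)

lemma determines_mod_coprime_mult:
  assumes "determines_mod w a" "determines_mod w b" "coprime a b"
  shows "determines_mod w (a * b)"
proof -
  obtain A B where "\<forall>n m. same_window w A n m \<longrightarrow> [n = m] (mod a)"
      "\<forall>n m. same_window w B n m \<longrightarrow> [n = m] (mod b)"
    using assms(1,2) by (auto simp: determines_mod_def)
  then have "same_window w (max A B) n m \<longrightarrow> [n = m] (mod a * b)" for n m
    using coprime_cong_mult_nat[OF _ _ assms(3)] same_window_mono[of w "max A B" n m A]
      same_window_mono[of w "max A B" n m B] by auto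
  then show ?thesis unfolding determines_mod_def by blast
qed

text \<open>The substitution is recorded only by its effect on \<open>w\<close>, so that all
  arguments can speak of positions instead of words.\<close>

locale subst_fixed_point =
  fixes p :: nat and w :: "nat \<Rightarrow> 'a"
  assumes prime_p: "prime p"
    and finite_range: "finite (range w)"
    and block: "w n = w m \<Longrightarrow> i < p \<Longrightarrow> w (p * n + i) = w (p * m + i)"
    and primitive: "\<exists>k. \<forall>n m. \<exists>i<p ^ k. w (p ^ k * n + i) = w m"
begin

section \<open>Recurrence of prefixes and periodicity\<close>

lemma p_gt1: "p > 1" and p_pos: "p > 0"
  using prime_p prime_gt_1_nat by (auto simp: prime_gt_0_nat)

lemma block_power: "w n = w m \<Longrightarrow> i < p ^ k \<Longrightarrow> w (p ^ k * n + i) = w (p ^ k * m + i)"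
proof (induction k arbitrary: i)
  case (Suc k)
  have "i div p < p ^ k" using Suc.prems(2) by (simp add: less_mult_imp_div_less mult.commute)
  then have "w (p ^ k * n + i div p) = w (p ^ k * m + i div p)" using Suc by blast
  then have "w (p * (p ^ k * n + i div p) + i mod p) = w (p * (p ^ k * m + i div p) + i mod p)"
    by (rule block) (simp add: p_pos)
  moreover have "p * (p ^ k * x + i div p) + i mod p = p ^ Suc k * x + i" for x
    by (simp only: power_Suc distrib_left mult.assoc add.assoc mult_div_mod_eq)
  ultimately show ?case by (simp only:)
qed simp

text \<open>By primitivity the letter \<open>w 0\<close> occurs in every aligned block of length
  \<open>p ^ k\<close>. Its image under the e-th power of the substitution is a copy of the prefix
  of length \<open>p ^ e\<close>, placed at a multiple of \<open>p ^ e\<close>. The first aligned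
  block of length \<open>q\<close> that starts after \<open>n\<close> contains such a copy, whence
  the gap \<open>2 * q\<close>.\<close>

lemma prefix_recurrence:
  "\<exists>G>0. \<forall>n. \<exists>t<G. p ^ j dvd n + t \<and> same_window w L (n + t) 0"
proof -
  obtain k where k: "\<And>n m. \<exists>i<p ^ k. w (p ^ k * n + i) = w m" using primitive by blast
  define e where "e = max j L"
  have L: "L \<le> p ^ e"
    using power_gt_expt[of p e] p_gt1 by (simp add: e_def)
  define q where "q = p ^ (e + k)"
  have q: "q > 0" using p_pos by (simp add: q_def)
  have "\<exists>t<2 * q. p ^ j dvd n + t \<and> same_window w L (n + t) 0" for n
  proof -
    define c where "c = n div q + 1"
    obtain i where i: "i < p ^ k" "w (p ^ k * c + i) = w 0" using k by blast
    define b where "b = p ^ e * (p ^ k * c + i)"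
    have b: "b = q * c + p ^ e * i" by (simp add: b_def q_def power_add algebra_simps)
    have "p ^ e * i < q" using i p_pos by (simp add: q_def power_add)
    moreover have "q * c = n - n mod q + q"
      by (simp add: c_def minus_mod_eq_mult_div)
    moreover have "n mod q < q" "n mod q \<le> n" using q by auto
    ultimately have "n \<le> b" "b < n + 2 * q" using b by linarith+
    moreover have "p ^ j dvd b" unfolding b_def by (simp add: e_def le_imp_power_dvd)
    moreover have "w (b + l) = w l" if "l < L" for l
      using block_power[OF i(2), of l e] that L by (simp add: b_def)
    ultimately show ?thesis
      by (intro exI[of _ "b - n"]) (auto simp: same_window_def)
  qed
  then show ?thesis using q by (intro exI[of _ "2 * q"]) auto
qed

text \<open>Every prefix recurs inside the periodic tail, so the relation holds from the
  start.\<close>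

lemma eventually_periodic_imp_periodic:
  assumes "m > 0" "\<And>i. w (P + i + m) = w (P + i)"
  shows "periodic_seq w"
proof -
  have "w (n + m) = w n" for n
  proof -
    obtain t where "same_window w (n + m + 1) (P + t) 0"
      using prefix_recurrence[of 0 "n + m + 1"] by blast
    then have "w (P + t + n) = w n" "w (P + t + (n + m)) = w (n + m)"
      by (auto simp: same_window_def)
    then show ?thesis using assms(2)[of "t + n"] by (simp add: add.assoc)
  qed
  then show ?thesis using assms(1) unfolding periodic_seq_def by blast
qed

text \<open>A word of length \<open>p ^ j\<close> at a multiple of \<open>p ^ j\<close> is
  determined by one letter, so for each \<open>j\<close> two of the positions
  \<open>p ^ k * n\<close> with \<open>n \<le> c\<close> carry the same word. There are finitely
  many pairs of such positions, so one pair serves all \<open>j\<close>; the two tails of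
  \<open>w\<close> then coincide.\<close>

lemma periodic_if_few_words:
  assumes "\<And>j n. \<exists>b. same_window w (p ^ j) (p ^ k * n) (p ^ j * b)"
  shows "periodic_seq w"
proof -
  obtain b where b: "\<And>j n. same_window w (p ^ j) (p ^ k * n) (p ^ j * b j n)"
    using assms by metis
  define c where "c = card (range w)"
  have pair: "\<exists>n n'. n < n' \<and> n' \<le> c \<and> same_window w (p ^ j) (p ^ k * n) (p ^ k * n')" for j
  proof -
    have "card ((\<lambda>n. w (b j n)) ` {..c}) \<le> c"
      unfolding c_def using finite_range by (intro card_mono) auto
    then have "\<not> inj_on (\<lambda>n. w (b j n)) {..c}" by (intro pigeonhole) auto
    then obtain n n' where n: "n < n'" "n' \<le> c" "w (b j n) = w (b j n')"
      by (auto simp: inj_on_def) (metis linorder_neqE_nat)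
    have "same_window w (p ^ j) (p ^ j * b j n) (p ^ j * b j n')"
      unfolding same_window_def using block_power[OF n(3)] by blast
    then show ?thesis
      using b[of j n] b[of j n'] n same_window_trans same_window_sym by metis
  qed
  have "\<exists>n n'. n < n' \<and> n' \<le> c \<and> (\<forall>j. same_window w (p ^ j) (p ^ k * n) (p ^ k * n'))"
  proof (rule ccontr)
    assume "\<not> ?thesis"
    then obtain J where J: "\<And>n n'. n < n' \<Longrightarrow> n' \<le> c \<Longrightarrow>
        \<not> same_window w (p ^ J n n') (p ^ k * n) (p ^ k * n')" by metis
    define M where "M = Max ((\<lambda>(n, n'). J n n') ` ({..c} \<times> {..c}))"
    obtain n n' where n: "n < n'" "n' \<le> c" "same_window w (p ^ M) (p ^ k * n) (p ^ k * n')"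
      using pair by blast
    have "J n n' \<le> M" unfolding M_def by (rule Max_ge) (use n in force)+
    then have "same_window w (p ^ J n n') (p ^ k * n) (p ^ k * n')"
      using n(3) p_pos by (elim same_window_mono) (simp add: power_increasing)
    then show False using J n by blast
  qed
  then obtain n n' where n: "n < n'" "\<And>j. same_window w (p ^ j) (p ^ k * n) (p ^ k * n')" by blast
  have "w (p ^ k * n + i + p ^ k * (n' - n)) = w (p ^ k * n + i)" for i
  proof -
    have eq: "p ^ k * n + i + p ^ k * (n' - n) = p ^ k * n' + i"
      using n(1) by (simp add: algebra_simps diff_mult_distrib2)
    show ?thesis
      unfolding eq using n(2)[of i] power_gt_expt[of p i] p_gt1 by (simp add: same_window_def)
  qed
  moreover have "p ^ k * (n' - n) > 0" using n(1) p_pos by simp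
  ultimately show ?thesis using eventually_periodic_imp_periodic by blast
qed

text \<open>If windows determine the position modulo \<open>p\<^sup>k\<close> but not modulo \<open>p\<^bsup>k+1\<^esup>\<close>, then every prefix
  recurs at a position in each class \<open>r p\<^sup>k\<close> modulo \<open>p\<^bsup>k+1\<^esup>\<close>; this is where \<open>p\<close> must be prime. So
  every word at a multiple of \<open>p\<^sup>k\<close> also occurs at a multiple of \<open>p\<^bsup>k+1\<^esup>\<close>, and can be desubstituted
  indefinitely.\<close>

lemma determines_mod_prime_power:
  assumes "\<not> periodic_seq w"
  shows "determines_mod w (p ^ k)"
proof (induction k)
  case 0
  then show ?case using determines_mod_one by simp
next
  case (Suc k)
  show ?case
  proof (rule ccontr)
    assume neg: "\<not> determines_mod w (p ^ Suc k)"
    obtain W0 where W0: "\<And>n m. same_window w W0 n m \<Longrightarrow> [n = m] (mod p ^ k)"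
      using Suc by (auto simp: determines_mod_def)
    \<comment> \<open>Long equal windows at \<open>n\<close> and \<open>m\<close> contain the same
      copy of the prefix at a common offset \<open>t\<close>. Choosing \<open>t\<close> so that
      \<open>n + t\<close> is divisible by \<open>p ^ Suc k\<close> forces \<open>m + t\<close> out
      of that class, while it stays divisible by \<open>p ^ k\<close>.\<close>
    have "\<exists>e. same_window w L e 0 \<and> p ^ k dvd e \<and> \<not> p ^ Suc k dvd e" for L
    proof -
      obtain G where G: "\<And>n. \<exists>t<G. p ^ Suc k dvd n + t \<and> same_window w L (n + t) 0"
        using prefix_recurrence by blast
      obtain n m where nm: "same_window w (max W0 (G + L)) n m" "\<not> [n = m] (mod p ^ Suc k)"
        using neg unfolding determines_mod_def by blast
      obtain t where t: "t < G" "p ^ Suc k dvd n + t" "same_window w L (n + t) 0"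
        using G by blast
      have "[n = m] (mod p ^ k)" using W0 same_window_mono[OF nm(1)] by simp
      moreover have "p ^ k dvd n + t" using t(2) by (meson le_SucI le_refl le_imp_power_dvd dvd_trans)
      ultimately have 1: "p ^ k dvd m + t"
        using cong_dvd_iff[of "n + t" "m + t"] by (simp only: cong_add_rcancel_nat)
      have 2: "\<not> p ^ Suc k dvd m + t"
      proof
        assume "p ^ Suc k dvd m + t"
        then have "[m + t = 0] (mod p ^ Suc k)" "[n + t = 0] (mod p ^ Suc k)"
          using t(2) by (simp_all only: cong_0_iff)
        then have "[n + t = m + t] (mod p ^ Suc k)" using cong_sym cong_trans by blast
        then show False using nm(2) by (simp only: cong_add_rcancel_nat)
      qed
      have "same_window w L (m + t) (n + t)"
        unfolding same_window_def
      proof (intro allI impI)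
        fix i assume "i < L"
        then have "w (n + (t + i)) = w (m + (t + i))"
          using nm(1) t(1) by (simp add: same_window_def)
        then show "w (m + t + i) = w (n + t + i)" by (simp add: add.assoc)
      qed
      then show ?thesis using 1 2 t(3) same_window_trans by blast
    qed
    then obtain e where e: "\<And>L. same_window w L (e L) 0" "\<And>L. p ^ k dvd e L"
        "\<And>L. \<not> p ^ Suc k dvd e L" by metis
    \<comment> \<open>Only finitely many residues \<open>d\<close> are available, so one of them
      occurs for arbitrarily long prefixes.\<close>
    have "\<exists>d\<in>{1..<p}. \<forall>L. \<exists>e. same_window w L e 0 \<and> [e = p ^ k * d] (mod p ^ Suc k)"
    proof (rule ccontr)
      assume "\<not> ?thesis"
      then obtain l where l: "\<And>d e. d \<in> {1..<p} \<Longrightarrow> same_window w (l d) e 0 \<Longrightarrow>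
          \<not> [e = p ^ k * d] (mod p ^ Suc k)" by metis
      define M where "M = Max (l ` {1..<p})"
      obtain d where d: "e M = p ^ k * d" using e(2) by blast
      have "\<not> p dvd d"
      proof
        assume "p dvd d"
        then have "p ^ Suc k dvd e M" unfolding d by (simp add: mult.commute mult_dvd_mono)
        then show False using e(3) by blast
      qed
      then have dp: "d mod p \<in> {1..<p}" using p_pos by (auto simp: dvd_eq_mod_eq_0 Suc_le_eq)
      then have "l (d mod p) \<le> M" unfolding M_def by (intro Max_ge) auto
      then have "same_window w (l (d mod p)) (e M) 0" using e(1) same_window_mono by blast
      moreover have "[e M = p ^ k * (d mod p)] (mod p ^ Suc k)"
        unfolding d cong_def power_Suc2 by (simp only: mult_mod_right[symmetric] mod_mod_trivial)
      ultimately show False using l dp by blast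
    qed
    then obtain d where d: "d \<in> {1..<p}"
        "\<And>L. \<exists>e. same_window w L e 0 \<and> [e = p ^ k * d] (mod p ^ Suc k)" by blast
    \<comment> \<open>Positions of prefix copies add: a copy at \<open>e2\<close> of the prefix of
      length \<open>e1 + L\<close> contains, at offset \<open>e1\<close>, a copy of the prefix of
      length \<open>L\<close>.\<close>
    have multiples: "\<exists>e. same_window w L e 0 \<and> [e = p ^ k * (j * d)] (mod p ^ Suc k)" for j L
    proof (induction j arbitrary: L)
      case 0
      show ?case by (intro exI[of _ 0]) (auto simp: same_window_def)
    next
      case (Suc j)
      then obtain e1 where e1: "same_window w L e1 0" "[e1 = p ^ k * (j * d)] (mod p ^ Suc k)"
        by blast
      obtain e2 where e2: "same_window w (e1 + L) e2 0" "[e2 = p ^ k * d] (mod p ^ Suc k)"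
        using d(2) by blast
      have "w (e2 + e1 + i) = w i" if "i < L" for i
      proof -
        have "w (e2 + (e1 + i)) = w (e1 + i)" using e2(1) that by (simp add: same_window_def)
        then show ?thesis using e1(1) that by (simp add: same_window_def add.assoc)
      qed
      then have "same_window w L (e2 + e1) 0" by (simp add: same_window_def)
      moreover have "[e2 + e1 = p ^ k * (Suc j * d)] (mod p ^ Suc k)"
        using cong_add[OF e2(2) e1(2)] by (simp add: algebra_simps)
      ultimately show ?case by blast
    qed
    have "coprime d p"
      using d(1) prime_p by (metis atLeastLessThan_iff coprime_commute nat_dvd_not_less
          not_one_le_zero prime_imp_coprime_nat zero_less_iff_neq_zero)
    then obtain d' where d': "[d * d' = 1] (mod p)"
      using cong_solve_coprime_nat by (metis One_nat_def)
    have residues: "\<exists>e. same_window w L e 0 \<and> [e = p ^ k * r] (mod p ^ Suc k)" for r L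
    proof -
      obtain e where e: "same_window w L e 0" "[e = p ^ k * (r * d' * d)] (mod p ^ Suc k)"
        using multiples by blast
      have "[r * d' * d = r] (mod p)"
        using cong_scalar_left[OF d', of r] by (simp add: algebra_simps)
      then have "[p ^ k * (r * d' * d) = p ^ k * r] (mod p ^ Suc k)"
        unfolding cong_def power_Suc2 by (simp only: mult_mod_right[symmetric])
      then show ?thesis using e cong_trans by blast
    qed
    \<comment> \<open>The prefix that ends after the word in question is copied to \<open>e\<close>,
      whose class is chosen so that the word lands on a multiple of
      \<open>p ^ Suc k\<close>.\<close>
    have aligned: "\<exists>n'. same_window w M (p ^ k * n) (p ^ Suc k * n')" for n M
    proof -
      obtain r where r: "p dvd r + n"
        by (metis mult.commute dvd_triv_left le_add_diff_inverse2 mult_le_mono2 p_pos 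
            nat_mult_1_right Suc_leI One_nat_def)
      obtain e where e: "same_window w (p ^ k * n + M) e 0" "[e = p ^ k * r] (mod p ^ Suc k)"
        using residues by blast
      have "[e + p ^ k * n = p ^ k * (r + n)] (mod p ^ Suc k)"
        using cong_add[OF e(2) cong_refl, of "p ^ k * n"] by (simp only: distrib_left)
      moreover have "p ^ Suc k dvd p ^ k * (r + n)"
        unfolding power_Suc2 using r by (simp only: mult_dvd_mono dvd_refl)
      ultimately have "p ^ Suc k dvd e + p ^ k * n" using cong_dvd_iff by blast
      then obtain n' where n': "e + p ^ k * n = p ^ Suc k * n'" by blast
      have "w (p ^ k * n + i) = w (e + p ^ k * n + i)" if "i < M" for i
        using e(1) that by (simp add: same_window_def add.assoc)
      then show ?thesis using n' by (auto simp: same_window_def)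
    qed
    \<comment> \<open>Desubstitution: the word at \<open>p ^ Suc k * n'\<close> is the image of a
      word p times shorter at \<open>p ^ k * n'\<close>, to which the induction hypothesis
      applies.\<close>
    have "\<exists>b. same_window w (p ^ j) (p ^ k * n) (p ^ j * b)" for j n
    proof (induction j arbitrary: n)
      case 0
      then show ?case by (auto simp: same_window_def)
    next
      case (Suc j)
      obtain n' where n': "same_window w (p ^ Suc j) (p ^ k * n) (p ^ Suc k * n')"
        using aligned by blast
      obtain b where b: "same_window w (p ^ j) (p ^ k * n') (p ^ j * b)" using Suc by blast
      have "w (p ^ Suc k * n' + i) = w (p ^ Suc j * b + i)" if i: "i < p ^ Suc j" for i
      proof -
        have "i div p < p ^ j" using i by (simp add: less_mult_imp_div_less mult.commute)
        then have "w (p ^ k * n' + i div p) = w (p ^ j * b + i div p)"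
          using b by (simp add: same_window_def)
        then have "w (p * (p ^ k * n' + i div p) + i mod p) = w (p * (p ^ j * b + i div p) + i mod p)"
          by (rule block) (simp add: p_pos)
        then show ?thesis
          by (simp only: power_Suc distrib_left mult.assoc add.assoc mult_div_mod_eq)
      qed
      then show ?case using n' same_window_trans unfolding same_window_def by metis
    qed
    then show False using periodic_if_few_words assms by blast
  qed
qed

end

section \<open>Frequencies of window functions\<close>

text \<open>The p-th power map does not decrease the distance to 1 near 1, since
  \<open>z ^ p - 1 = (z - 1) * (\<Sum>i<p. z ^ i)\<close> and the sum is close to p. A sequence of
  iterates that tends to 1 must therefore be eventually equal to 1.\<close>

lemma power_tendsto_one_imp_root:
  fixes z :: complex
  assumes "p > 0" "norm z = 1" and lim: "(\<lambda>k. z ^ (p ^ k)) \<longlonglongrightarrow> 1"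
  shows "\<exists>k. z ^ (p ^ k) = 1"
proof (cases "p = 1")
  case True
  then show ?thesis using lim LIMSEQ_const_iff by auto
next
  case False
  with \<open>p > 0\<close> have p2: "p \<ge> 2" by simp
  define y where "y k = z ^ (p ^ k)" for k
  have y1: "norm (y k) = 1" for k by (simp add: y_def norm_power assms)
  \<comment> \<open>Within this radius the powers \<open>y k ^ i\<close> with \<open>i < p\<close>
    are all within 1/2 of 1, so their sum has modulus at least p/2, hence at least 1.\<close>
  have "eventually (\<lambda>k. dist (y k) 1 < 1 / (2 * real p)) sequentially"
    using tendstoD[OF lim, of "1 / (2 * real p)"] p2 by (simp add: y_def)
  then obtain K where K: "\<And>k. k \<ge> K \<Longrightarrow> norm (y k - 1) < 1 / (2 * real p)"
    by (auto simp: eventually_sequentially dist_norm)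
  have step: "norm (y k - 1) \<le> norm (y (Suc k) - 1)" if "k \<ge> K" for k
  proof -
    have "norm (y k ^ i - 1) \<le> 1 / 2" if "i < p" for i
    proof -
      have "norm (y k ^ i - 1 ^ i) \<le> real i * norm (y k - 1)"
        using norm_power_diff[of "y k" 1 i] y1 by simp
      also have "\<dots> \<le> real p * (1 / (2 * real p))"
        using K[OF \<open>k \<ge> K\<close>] that by (intro mult_mono) auto
      finally show ?thesis using p2 by simp
    qed
    then have "norm (\<Sum>i<p. y k ^ i - 1) \<le> (\<Sum>i<p. 1 / 2)"
      by (intro sum_norm_le) simp
    moreover have "(\<Sum>i<p. y k ^ i) = of_nat p + (\<Sum>i<p. y k ^ i - 1)"
      by (simp add: sum_subtractf)
    then have "norm (\<Sum>i<p. y k ^ i) \<ge> real p - norm (\<Sum>i<p. y k ^ i - 1)"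
      using norm_diff_ineq[of "of_nat p" "\<Sum>i<p. y k ^ i - 1"] by simp
    ultimately have "norm (\<Sum>i<p. y k ^ i) \<ge> 1" using p2 by simp
    moreover have "y (Suc k) - 1 = (y k - 1) * (\<Sum>i<p. y k ^ i)"
      unfolding power_diff_1_eq[symmetric] by (simp add: y_def power_mult[symmetric] mult.commute)
    ultimately show ?thesis
      using mult_left_mono[of 1 "norm (\<Sum>i<p. y k ^ i)" "norm (y k - 1)"] by (simp add: norm_mult)
  qed
  have "incseq (\<lambda>j. norm (y (K + j) - 1))" using step by (intro incseq_SucI) simp
  moreover have "(\<lambda>j. norm (y (K + j) - 1)) \<longlonglongrightarrow> 0"
  proof -
    have "(\<lambda>k. norm (y k - 1)) \<longlonglongrightarrow> norm (1 - 1 :: complex)"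
      unfolding y_def by (intro tendsto_intros lim)
    then show ?thesis using LIMSEQ_ignore_initial_segment[of _ _ K] by (simp add: add.commute)
  qed
  ultimately have "norm (y (K + 0) - 1) \<le> 0" by (rule incseq_le)
  then show ?thesis unfolding y_def by (intro exI[of _ K]) simp
qed

lemma sum_lessThan_add:
  fixes f :: "nat \<Rightarrow> 'b::comm_monoid_add"
  shows "(\<Sum>x<a + b. f x) = (\<Sum>x<a. f x) + (\<Sum>j<b. f (a + j))"
  by (induction b) (simp_all add: add.assoc)

lemma sum_lessThan_mult:
  fixes f :: "nat \<Rightarrow> 'b::comm_monoid_add"
  shows "(\<Sum>x<a * b. f x) = (\<Sum>i<b. \<Sum>j<a. f (a * i + j))"
proof (induction b)
  case (Suc b)
  have "a * Suc b = a * b + a" by simp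
  then show ?case unfolding \<open>a * Suc b = a * b + a\<close> sum_lessThan_add Suc.IH by simp
qed simp

lemma norm_twisted_sum_le:
  fixes g :: "nat \<Rightarrow> complex"
  assumes "norm l = 1" "\<And>x. norm (g x) \<le> H"
  shows "norm (\<Sum>m<N. l ^ (a + m) * g (b + m)) \<le> real N * H"
proof -
  have "norm (\<Sum>m<N. l ^ (a + m) * g (b + m)) \<le> (\<Sum>m<N. H)"
    by (intro sum_norm_le) (simp add: norm_mult norm_power assms)
  then show ?thesis by simp
qed

text \<open>The factor \<open>l ^ s\<close> aligns the twists, after which the two sums share all
  terms except at most \<open>s\<close> at either end.\<close>

lemma norm_twisted_sum_shift:
  fixes g :: "nat \<Rightarrow> complex"
  assumes "norm l = 1" "\<And>x. norm (g x) \<le> H"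
  shows "norm (l ^ s * (\<Sum>m<N. l ^ m * g (s + m)) - (\<Sum>m<N. l ^ m * g m)) \<le> 2 * real s * H"
proof -
  have "(\<Sum>m<s. l ^ m * g m) + l ^ s * (\<Sum>m<N. l ^ m * g (s + m)) = (\<Sum>m<s + N. l ^ m * g m)"
    unfolding sum_lessThan_add by (simp add: sum_distrib_left power_add mult.assoc)
  also have "\<dots> = (\<Sum>m<N. l ^ m * g m) + (\<Sum>m<s. l ^ (N + m) * g (N + m))"
    unfolding add.commute[of s N] sum_lessThan_add by simp
  finally have "l ^ s * (\<Sum>m<N. l ^ m * g (s + m)) - (\<Sum>m<N. l ^ m * g m) =
      (\<Sum>m<s. l ^ (N + m) * g (N + m)) - (\<Sum>m<s. l ^ (0 + m) * g (0 + m))"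
    by (simp add: algebra_simps)
  also have "norm \<dots> \<le> real s * H + real s * H"
    by (intro norm_triangle_le_diff add_mono norm_twisted_sum_le assms)
  finally show ?thesis by (simp only: mult_2 distrib_right)
qed

lemma norm_twisted_sum_translate_le:
  fixes g :: "nat \<Rightarrow> complex"
  assumes "norm l = 1" "\<And>x. norm (g x) \<le> H"
  shows "norm (\<Sum>m<N. l ^ m * g (s + m)) \<le> norm (\<Sum>m<N. l ^ m * g m) + 2 * real s * H"
proof -
  have "norm (l ^ s * (\<Sum>m<N. l ^ m * g (s + m))) = norm (\<Sum>m<N. l ^ m * g (s + m))"
    by (simp add: norm_mult norm_power assms(1))
  then show ?thesis
    using norm_twisted_sum_shift[where g = g and s = s and N = N, OF assms]
      norm_triangle_ineq2[of "l ^ s * (\<Sum>m<N. l ^ m * g (s + m))" "\<Sum>m<N. l ^ m * g m"]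
    by linarith
qed

text \<open>Quantitative convexity of the disc, from the parallelogram law. The lower bound for the
  norm of the sum may be squared only if it is nonnegative; otherwise
  \<open>4 * A\<^sup>2 - 4 * A * E\<close> is itself not positive.\<close>

lemma norm_diff_if_norm_add_large:
  fixes x y :: complex
  assumes "norm x \<le> A" "norm y \<le> A" "norm (x + y) \<ge> 2 * A - E" "E \<ge> 0"
  shows "norm (x - y) \<le> sqrt (4 * A * E)"
proof -
  have A: "A \<ge> 0" using assms(1) norm_ge_zero order_trans by blast
  have *: "(norm (x - y))\<^sup>2 = 2 * (norm x)\<^sup>2 + 2 * (norm y)\<^sup>2 - (norm (x + y))\<^sup>2"
    unfolding cmod_power2 by (simp add: power2_eq_square algebra_simps)
  have "(norm x)\<^sup>2 \<le> A\<^sup>2" "(norm y)\<^sup>2 \<le> A\<^sup>2" using assms by (simp_all add: power_mono)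
  moreover have "(norm (x + y))\<^sup>2 \<ge> 4 * A\<^sup>2 - 4 * A * E"
  proof (cases "2 * A - E \<ge> 0")
    case True
    then have "(2 * A - E)\<^sup>2 \<le> (norm (x + y))\<^sup>2" using assms(3) by (simp add: power_mono)
    moreover have "(2 * A - E)\<^sup>2 = 4 * A\<^sup>2 - 4 * A * E + E\<^sup>2"
      by (simp add: power2_eq_square algebra_simps)
    ultimately show ?thesis using zero_le_power2[of E] by linarith
  next
    case False
    then have "A * (A - E) \<le> 0" using A by (intro mult_nonneg_nonpos) auto
    then have "4 * A\<^sup>2 - 4 * A * E \<le> 0" by (simp add: power2_eq_square algebra_simps)
    then show ?thesis using zero_le_power2[of "norm (x + y)"] by linarith
  qed
  ultimately show ?thesis by (intro real_le_rsqrt) (use * in linarith)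
qed

lemma cong_if_dvd_diff:
  fixes n m :: nat
  assumes "n \<le> m" "d dvd m - n"
  shows "[n = m] (mod d)"
proof -
  obtain k where "m - n = d * k" using assms(2) by blast
  then have "m = n + d * k" using assms(1) by simp
  then show ?thesis by (simp add: cong_def)
qed

text \<open>A window as long as the least period determines everything to its right. Hence the
  distance between equal windows is itself a period, and its remainder modulo the least period must
  vanish.\<close>

lemma minimal_period:
  fixes w :: "nat \<Rightarrow> 'a"
  assumes "m > 0" "\<And>n. w (n + m) = w n"
  obtains q where "q > 0" "\<And>n. w (n + q) = w n" "determines_mod w q"
proof -
  define q where "q = (LEAST m. m > 0 \<and> (\<forall>n. w (n + m) = w n))"
  have q: "q > 0 \<and> (\<forall>n. w (n + q) = w n)"
    unfolding q_def by (rule LeastI[of _ m]) (use assms in auto)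
  have least: "q \<le> m'" if "m' > 0" "\<And>n. w (n + m') = w n" for m'
    unfolding q_def by (rule Least_le) (use that in auto)
  have mult: "w (n + q * j) = w n" for n j
  proof (induction j)
    case (Suc j)
    then show ?case using q by (metis add.assoc add.commute mult_Suc_right)
  qed simp
  have red: "w (n mod q + i) = w (n + i)" for n i
    using mult[of "n mod q + i" "n div q"] by (simp add: ac_simps)
  have "[n = n'] (mod q)" if win: "same_window w q n n'" and le: "n \<le> n'" for n n'
  proof -
    have eq: "w (n + i) = w (n' + i)" for i
    proof -
      have "w (n + i mod q) = w (n' + i mod q)" using win q by (simp add: same_window_def)
      then show ?thesis using red[of i n] red[of i n'] by (simp add: add.commute)
    qed
    have qn: "n \<le> q * n" using q by simp
    \<comment> \<open>\<open>eq\<close> speaks only of positions from \<open>n\<close> and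
      \<open>n'\<close> onwards; adding the multiple \<open>q * n\<close> of the period brings every
      \<open>i\<close> there.\<close>
    have "w (i + (n' - n)) = w i" for i
    proof -
      have "w (i + (n' - n)) = w (i + (n' - n) + q * n)" using mult by simp
      also have "i + (n' - n) + q * n = n' + (i + (q * n - n))"
        using le qn by linarith
      also have "w \<dots> = w (n + (i + (q * n - n)))" using eq by simp
      also have "n + (i + (q * n - n)) = i + q * n"
        using qn by linarith
      finally show ?thesis using mult by simp
    qed
    then have "w (i + (n' - n) mod q) = w i" for i
      using red[of "n' - n" i] by (simp add: add.commute)
    then have "(n' - n) mod q = 0"
      using least[of "(n' - n) mod q"] q by (meson mod_less_divisor not_le zero_less_iff_neq_zero)
    then show ?thesis using le by (simp add: cong_if_dvd_diff mod_eq_0_iff_dvd)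
  qed
  then have "[n = n'] (mod q)" if "same_window w q n n'" for n n'
    using that cong_sym[of n' n q] same_window_sym[of w q n n'] by (cases "n \<le> n'") auto
  then have "determines_mod w q" unfolding determines_mod_def by blast
  then show thesis using that[of q] q by simp
qed

section \<open>Window functions along a fixed point: return times and orders of frequencies\<close>

context subst_fixed_point
begin

text \<open>There are finitely many words of length \<open>W\<close>. This serves as compactness:
  bounds and limits that depend only on windows need to be checked at finitely many
  positions.\<close>

lemma window_representatives: "\<exists>M. \<forall>n. \<exists>m\<le>M. same_window w W n m"
proof -
  define F where "F n = map (\<lambda>i. w (n + i)) [0..<W]" for n
  have F: "same_window w W n m" if "F n = F m" for n m
    using that by (auto simp: F_def same_window_def)
  have "range F \<subseteq> {xs. set xs \<subseteq> range w \<and> length xs = W}" by (auto simp: F_def)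
  then have fin: "finite (range F)"
    using finite_lists_length_eq[OF finite_range, of W] finite_subset by blast
  define rep where "rep xs = (SOME m. F m = xs)" for xs
  have rep: "F (rep (F n)) = F n" for n unfolding rep_def by (rule someI) simp
  have "rep (F n) \<le> Max (rep ` range F)" for n using fin by (intro Max_ge) auto
  then show ?thesis using rep F by metis
qed

lemma window_function_bounded:
  fixes h :: "nat \<Rightarrow> complex"
  assumes "\<And>n m. same_window w W n m \<Longrightarrow> h n = h m"
  obtains H where "H > 0" "\<And>n. norm (h n) \<le> H"
proof -
  obtain M where M: "\<And>n. \<exists>m\<le>M. same_window w W n m" using window_representatives by blast
  have "norm (h n) \<le> (\<Sum>m\<le>M. norm (h m)) + 1" for n
  proof -
    obtain m where m: "m \<le> M" "same_window w W n m" using M by blast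
    have "norm (h m) \<le> (\<Sum>m\<le>M. norm (h m))" using m by (intro member_le_sum) auto
    then show ?thesis using assms[OF m(2)] by simp
  qed
  then show thesis using that[of "(\<Sum>m\<le>M. norm (h m)) + 1"]
    by (smt (verit) norm_ge_zero sum_nonneg)
qed

text \<open>The largest mean \<open>a k\<close> over an aligned block of length \<open>p\<^sup>k\<close> decreases to a positive limit. A mean
  over a block of length \<open>p\<^bsup>k+j\<^esup>\<close> that is nearly maximal is an average of means of
  smaller blocks, so these must be nearly equal, including two that come from the same letter
  at distance \<open>r\<close>.\<close>

lemma frequency_return:
  fixes h :: "nat \<Rightarrow> complex" and l :: complex
  assumes win: "\<And>n m. same_window w W n m \<Longrightarrow> h n = h m"
    and l: "norm l = 1" and c: "c > 0"
    and freq: "\<And>N. N > 0 \<Longrightarrow> \<exists>n. norm (\<Sum>m<N. l ^ m * h (n + m)) \<ge> c * real N"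
    and ret: "w n0 = w (n0 + r)"
  shows "\<exists>k. l ^ (p ^ k * r) = 1"
proof (cases "r = 0")
  case False
  obtain H where H: "H > 0" "\<And>n. norm (h n) \<le> H" using window_function_bounded[where h = h, OF win] by blast
  define V where "V k n = (\<Sum>i<p ^ k. l ^ i * h (p ^ k * n + i))" for k n
  have Vle: "norm (V k n) \<le> H * real p ^ k" for k n
    using norm_twisted_sum_le[of l h H 0 "p ^ k * n" "p ^ k"] l H
    by (simp add: V_def mult.commute)
  have Vsplit: "(\<Sum>x<p ^ k * M. l ^ x * h (p ^ k * n + x)) =
      (\<Sum>i<M. l ^ (p ^ k * i) * V k (n + i))" for k n M
    unfolding sum_lessThan_mult V_def sum_distrib_left
    by (simp add: power_add algebra_simps)
  \<comment> \<open>Equal letters give equal blocks, so the summands can differ only where the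
    window runs over the end of the block, which happens at most \<open>W\<close> times.\<close>
  have Vclose: "norm (V k n - V k m) \<le> 2 * H * real W" if "w n = w m" for k n m
  proof -
    define B where "B = {i \<in> {..<p ^ k}. p ^ k < i + W}"
    have "norm (l ^ i * h (p ^ k * n + i) - l ^ i * h (p ^ k * m + i)) \<le> (if i \<in> B then 2 * H else 0)"
      if i: "i < p ^ k" for i
    proof (cases "i \<in> B")
      case True
      have "norm (h (p ^ k * n + i) - h (p ^ k * m + i)) \<le> H + H"
        by (intro norm_triangle_le_diff add_mono H)
      then show ?thesis using True l by (simp add: right_diff_distrib[symmetric] norm_mult norm_power)
    next
      case False
      then have "same_window w W (p ^ k * n + i) (p ^ k * m + i)"
        using i block_power[OF \<open>w n = w m\<close>] by (auto simp: same_window_def B_def add.assoc)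
      then show ?thesis using win False by simp
    qed
    then have "norm (V k n - V k m) \<le> (\<Sum>i<p ^ k. if i \<in> B then 2 * H else 0)"
      unfolding V_def sum_subtractf[symmetric] by (intro sum_norm_le) simp
    also have "\<dots> = 2 * H * real (card B)"
      by (subst sum.inter_filter[symmetric]) (auto simp: B_def)
    also have "\<dots> \<le> 2 * H * real W"
    proof -
      have "card B \<le> card {p ^ k - W..<p ^ k}" by (intro card_mono) (auto simp: B_def)
      then have "card B \<le> W" by simp
      then show ?thesis using H by simp
    qed
    finally show ?thesis .
  qed
  define a where "a k = (SUP n. norm (V k n) / real p ^ k)" for k
  have pk: "real p ^ k > 0" for k using p_pos by simp
  have bdd: "bdd_above (range (\<lambda>n. norm (V k n) / real p ^ k))" for k
    using Vle pk by (intro bdd_aboveI[of _ H]) (auto simp: divide_le_eq)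
  have Va: "norm (V k n) \<le> a k * real p ^ k" for k n
    using cSUP_upper[OF _ bdd, of n k] pk by (simp add: a_def divide_le_eq)
  have a_sum: "norm (\<Sum>x<p ^ k * M. l ^ x * h (p ^ k * n + x)) \<le> real M * (a k * real p ^ k)"
    for k n M
  proof -
    have "norm (\<Sum>i<M. l ^ (p ^ k * i) * V k (n + i)) \<le> (\<Sum>i<M. a k * real p ^ k)"
      by (intro sum_norm_le) (simp add: norm_mult norm_power l Va)
    then show ?thesis unfolding Vsplit by simp
  qed
  have "a (Suc k) \<le> a k" for k
  proof -
    have "norm (V (Suc k) n) / real p ^ Suc k \<le> a k" for n
    proof -
      have "V (Suc k) n = (\<Sum>x<p ^ k * p. l ^ x * h (p ^ k * (p * n) + x))"
        by (simp add: V_def mult.assoc mult.left_commute mult.commute)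
      then have "norm (V (Suc k) n) \<le> real p * (a k * real p ^ k)" using a_sum by metis
      then show ?thesis using pk[of "Suc k"] by (simp add: divide_le_eq mult_ac)
    qed
    then show ?thesis unfolding a_def[of "Suc k"] by (intro cSUP_least) auto
  qed
  then have dec: "decseq a" by (rule decseq_SucI)
  have a_low: "a k \<ge> c / 2" for k
  proof -
    \<comment> \<open>Starting the sum at the beginning of the block that contains \<open>n\<close>
      costs at most \<open>2 * p ^ k * H\<close>. This \<open>M\<close> makes that less than half of
      \<open>c * p ^ k * M\<close>.\<close>
    obtain M :: nat where M: "real M > 4 * H / c" using reals_Archimedean2 by blast
    have M0: "real M > 0" using M H c by (smt (verit) divide_nonneg_pos)
    then have "p ^ k * M > 0" using p_pos by simp
    then obtain n where n: "norm (\<Sum>m<p ^ k * M. l ^ m * h (n + m)) \<ge> c * real (p ^ k * M)"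
      using freq by blast
    define g where "g x = h (p ^ k * (n div p ^ k) + x)" for x
    have g: "h (n + m) = g (n mod p ^ k + m)" for m
      by (simp add: g_def add.assoc[symmetric])
    have "c * real (p ^ k * M) \<le> norm (\<Sum>m<p ^ k * M. l ^ m * g m) + 2 * real (n mod p ^ k) * H"
      using n norm_twisted_sum_translate_le[where g = g and H = H and N = "p ^ k * M" and s = "n mod p ^ k", OF l] H(2)
      unfolding g by (simp add: g_def)
    also have "\<dots> \<le> real M * (a k * real p ^ k) + 2 * real p ^ k * H"
    proof (intro add_mono mult_right_mono mult_left_mono)
      have "real (n mod p ^ k) \<le> real (p ^ k)" using p_pos by (simp add: less_imp_le)
      then show "real (n mod p ^ k) \<le> real p ^ k" by simp
    qed (use a_sum H in \<open>auto simp: g_def\<close>)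
    finally have "real p ^ k * (c * real M) \<le> real p ^ k * (real M * a k + 2 * H)"
      by (simp add: algebra_simps)
    then have "c * real M \<le> real M * a k + 2 * H" using pk mult_le_cancel_left_pos by blast
    moreover have "2 * H \<le> real M * (c / 2)" using M c by (simp add: field_simps)
    ultimately have "real M * (c / 2) \<le> real M * a k" by (simp add: algebra_simps)
    then show ?thesis using M0 mult_le_cancel_left_pos by blast
  qed
  obtain m where m: "a \<longlonglongrightarrow> m" "\<And>k. m \<le> a k"
    using decseq_convergent[OF dec, of "c / 2"] a_low by blast
  have m0: "m > 0" using LIMSEQ_le_const[OF m(1), of "c / 2"] a_low c by force
  \<comment> \<open>One scale \<open>j\<close> is fixed at which every aligned block contains the
    letter \<open>w n0\<close> twice at distance \<open>r\<close>: each such block contains an image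
    of the letter \<open>w 0\<close>, hence a copy of a prefix reaching beyond
    \<open>n0 + r\<close>.\<close>
  obtain j where j: "\<And>n. \<exists>i. i + r < p ^ j \<and> w (p ^ j * n + i) = w n0 \<and> w (p ^ j * n + (i + r)) = w n0"
  proof -
    obtain k where k: "\<And>n m. \<exists>i<p ^ k. w (p ^ k * n + i) = w m" using primitive by blast
    define e where "e = n0 + r"
    have e: "n0 + r < p ^ e" unfolding e_def using power_gt_expt p_gt1 by simp
    have "\<exists>i. i + r < p ^ (e + k) \<and> w (p ^ (e + k) * n + i) = w n0 \<and>
        w (p ^ (e + k) * n + (i + r)) = w n0" for n
    proof -
      obtain i where i: "i < p ^ k" "w (p ^ k * n + i) = w 0" using k by blast
      have *: "w (p ^ e * (p ^ k * n + i) + x) = w x" if "x < p ^ e" for x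
        using block_power[OF i(2) that] by simp
      have "p ^ e * (Suc i) \<le> p ^ e * p ^ k" using i by (intro mult_le_mono) auto
      then have "p ^ e * i + n0 + r < p ^ (e + k)" using e by (simp add: power_add)
      moreover have "p ^ e * (p ^ k * n + i) + x = p ^ (e + k) * n + (p ^ e * i + x)" for x
        by (simp add: power_add algebra_simps)
      ultimately show ?thesis
        using *[of n0] *[of "n0 + r"] e ret by (intro exI[of _ "p ^ e * i + n0"]) (auto simp: add.assoc)
    qed
    then show thesis using that by blast
  qed
  \<comment> \<open>The total deficit: \<open>p ^ j\<close> means are each at most
    \<open>a k\<close>, while their average comes within \<open>1 / Suc k\<close> of the limit
    \<open>m\<close>.\<close>
  define E where "E k = real (p ^ j) * (a k - m + 1 / real (Suc k))" for k
  have E0: "E k \<ge> 0" for k using m(2)[of k] by (simp add: E_def)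
  define z where "z k = (l ^ r) ^ (p ^ k)" for k
  have key: "norm (z k - 1) * (a k - E k) \<le> sqrt (4 * a k * E k) + 2 * H * real W / real p ^ k" for k
  proof -
    have "m - 1 / real (Suc k) < a (k + j)" using m(2)[of "k + j"] by (smt (verit) divide_pos_pos of_nat_0_less_iff zero_less_Suc)
    then obtain n where n: "m - 1 / real (Suc k) < norm (V (k + j) n) / real p ^ (k + j)"
      unfolding a_def by (subst (asm) less_cSUP_iff[OF _ bdd]) auto
    define t where "t i = l ^ (p ^ k * i) * V k (p ^ j * n + i) / of_real (real p ^ k)" for i
    have tle: "norm (t i) \<le> a k" for i
      using Va[of k "p ^ j * n + i"] pk[of k]
      by (simp add: t_def norm_mult norm_divide norm_power l divide_le_eq)
    have "V (k + j) n = (\<Sum>i<p ^ j. l ^ (p ^ k * i) * V k (p ^ j * n + i))"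
      using Vsplit[of k "p ^ j * n" "p ^ j"] by (simp add: V_def power_add mult.assoc)
    then have "V (k + j) n / of_real (real p ^ k) = (\<Sum>i<p ^ j. t i)"
      by (simp add: t_def sum_divide_distrib)
    then have "norm (\<Sum>i<p ^ j. t i) = norm (V (k + j) n) / real p ^ k"
      using pk[of k] by (metis norm_divide norm_of_real abs_of_pos)
    then have "norm (V (k + j) n) / real p ^ (k + j) = norm (\<Sum>i<p ^ j. t i) / real p ^ j"
      by (simp add: power_add)
    then have "m - 1 / real (Suc k) < norm (\<Sum>i<p ^ j. t i) / real p ^ j" using n by (simp only:)
    then have big: "norm (\<Sum>i<p ^ j. t i) \<ge> real (p ^ j) * (m - 1 / real (Suc k))"
      unfolding pos_less_divide_eq[OF pk] by (simp add: mult.commute)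
    obtain i where i: "i + r < p ^ j" "w (p ^ j * n + i) = w n0" "w (p ^ j * n + (i + r)) = w n0"
      using j by blast
    define R where "R = {..<p ^ j} - {i, i + r}"
    \<comment> \<open>The other \<open>p ^ j - 2\<close> terms are bounded by \<open>a k\<close>
      each, so the pair may fall short of \<open>2 * a k\<close> by at most the total
      deficit.\<close>
    have split: "(\<Sum>i<p ^ j. t i) = (\<Sum>i\<in>R. t i) + (t i + t (i + r))"
      unfolding R_def using i False
      by (subst sum.subset_diff[of "{i, i + r}" "{..<p ^ j}"]) auto
    have "real (card R) = real (p ^ j) - 2"
      unfolding R_def using i False by (subst card_Diff_subset) (auto simp: of_nat_diff)
    then have "norm (\<Sum>i\<in>R. t i) \<le> (real (p ^ j) - 2) * a k"
      using sum_norm_le[of R t "\<lambda>_. a k"] tle by simp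
    then have "norm (t i + t (i + r)) \<ge> real (p ^ j) * (m - 1 / real (Suc k)) - (real (p ^ j) - 2) * a k"
      using big norm_triangle_ineq[of "\<Sum>i\<in>R. t i" "t i + t (i + r)"] unfolding split by linarith
    then have add: "norm (t i + t (i + r)) \<ge> 2 * a k - E k"
      by (simp add: E_def algebra_simps)
    have diff: "norm (t i - t (i + r)) \<le> sqrt (4 * a k * E k)"
      by (rule norm_diff_if_norm_add_large[OF tle tle add E0])
    have low: "norm (t (i + r)) \<ge> a k - E k"
      using add tle[of i] norm_triangle_ineq[of "t i" "t (i + r)"] by linarith
    \<comment> \<open>The two blocks come from the same letter and differ only in their boundary
      windows; \<open>U\<close> is this error after normalization. Apart from it,
      \<open>t (i + r)\<close> is \<open>t i\<close> turned by \<open>z k\<close>, and since the two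
      are nearly equal and not small, \<open>z k\<close> is near 1.\<close>
    define U where "U = l ^ (p ^ k * i) * (V k (p ^ j * n + i) - V k (p ^ j * n + (i + r))) / of_real (real p ^ k)"
    have Ule: "norm U \<le> 2 * H * real W / real p ^ k"
      using Vclose[of "p ^ j * n + i" "p ^ j * n + (i + r)" k] i pk[of k]
      by (simp add: U_def norm_mult norm_divide norm_power l divide_right_mono)
    have zk: "t (i + r) = z k * (t i - U)"
      by (simp add: t_def U_def z_def diff_divide_distrib[symmetric] right_diff_distrib
          power_add power_mult[symmetric] distrib_left distrib_right mult_ac)
    have z1: "norm (z k) = 1" by (simp add: z_def norm_power l)
    have "(z k - 1) * (t i - U) = (t (i + r) - t i) + U" using zk by (simp add: algebra_simps)
    then have "norm (z k - 1) * norm (t i - U) \<le> norm (t i - t (i + r)) + norm U"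
      using norm_triangle_ineq[of "t (i + r) - t i" U] by (metis norm_minus_commute norm_mult)
    moreover have eq: "norm (t i - U) = norm (t (i + r))" using zk z1 by (simp add: norm_mult)
    ultimately have "norm (z k - 1) * norm (t (i + r)) \<le> sqrt (4 * a k * E k) + 2 * H * real W / real p ^ k"
      unfolding eq using diff Ule by (meson add_mono order_trans)
    moreover have "norm (z k - 1) * (a k - E k) \<le> norm (z k - 1) * norm (t (i + r))"
      using low by (intro mult_left_mono) auto
    ultimately show ?thesis by (rule order_trans[rotated])
  qed
  have Elim: "E \<longlonglongrightarrow> 0"
  proof -
    have "E \<longlonglongrightarrow> real (p ^ j) * (m - m + 0)"
      unfolding E_def by (intro tendsto_intros m LIMSEQ_Suc[OF lim_1_over_n])
    then show ?thesis by simp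
  qed
  have rhs: "(\<lambda>k. (2 / m) * (sqrt (4 * a k * E k) + 2 * H * real W / real p ^ k)) \<longlonglongrightarrow> 0"
  proof -
    have "(\<lambda>k. 2 * H * real W / real p ^ k) \<longlonglongrightarrow> 0"
      using p_gt1 by (intro LIMSEQ_divide_realpow_zero) simp
    then have "(\<lambda>k. (2 / m) * (sqrt (4 * a k * E k) + 2 * H * real W / real p ^ k)) \<longlonglongrightarrow>
        (2 / m) * (sqrt (4 * m * 0) + 0)"
      by (intro tendsto_intros m Elim)
    then show ?thesis by simp
  qed
  have "eventually (\<lambda>k. E k < m / 2) sequentially"
    using order_tendstoD(2)[OF Elim, of "m / 2"] m0 by simp
  then have "eventually (\<lambda>k. norm (norm (z k - 1)) \<le>
      (2 / m) * (sqrt (4 * a k * E k) + 2 * H * real W / real p ^ k)) sequentially"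
  proof eventually_elim
    case (elim k)
    have "norm (z k - 1) * (m / 2) \<le> norm (z k - 1) * (a k - E k)"
      using elim m(2)[of k] by (intro mult_left_mono) auto
    also note key[of k]
    finally have "(2 / m) * (norm (z k - 1) * (m / 2)) \<le>
        (2 / m) * (sqrt (4 * a k * E k) + 2 * H * real W / real p ^ k)"
      using m0 by (intro mult_left_mono) auto
    moreover have "(2 / m) * (norm (z k - 1) * (m / 2)) = norm (norm (z k - 1))" using m0 by simp
    ultimately show ?case by (simp only:)
  qed
  then have "(\<lambda>k. norm (z k - 1)) \<longlonglongrightarrow> 0" using rhs by (rule Lim_null_comparison)
  then have "z \<longlonglongrightarrow> 1" using LIM_zero_cancel tendsto_norm_zero_iff by blast
  then have "\<exists>k. (l ^ r) ^ (p ^ k) = 1"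
    unfolding z_def using p_pos l by (intro power_tendsto_one_imp_root) (auto simp: norm_power)
  then show ?thesis by (metis mult.commute power_mult)
qed simp

text \<open>Over whole periods the twisted sum is a geometric sum in \<open>l ^ q\<close> times a
  bounded factor. It stays bounded if \<open>l ^ q\<close> is not 1, which contradicts linear
  growth.\<close>

lemma frequency_periodic:
  fixes h :: "nat \<Rightarrow> complex" and l :: complex
  assumes per: "q > 0" "\<And>n. h (n + q) = h n"
    and bdd: "\<And>n. norm (h n) \<le> H"
    and l: "norm l = 1" and c: "c > 0"
    and freq: "\<And>N. N > 0 \<Longrightarrow> \<exists>n. norm (\<Sum>m<N. l ^ m * h (n + m)) \<ge> c * real N"
  shows "l ^ q = 1"
proof (rule ccontr)
  assume neq: "l ^ q \<noteq> 1"
  have H: "H \<ge> 0" using bdd norm_ge_zero order_trans by blast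
  define b where "b = 2 / norm (l ^ q - 1) * (real q * H)"
  have bound: "norm (\<Sum>x<q * M. l ^ x * h (n + x)) \<le> b" for M n
  proof -
    have per': "h (x + q * i) = h x" for x i
    proof (induction i)
      case (Suc i)
      then show ?case using per(2)[of "x + q * i"] by (simp add: algebra_simps)
    qed simp
    have "(\<Sum>x<q * M. l ^ x * h (n + x)) = (\<Sum>i<M. (l ^ q) ^ i) * (\<Sum>j<q. l ^ j * h (n + j))"
      unfolding sum_lessThan_mult sum_product
    proof (intro sum.cong refl)
      fix i j
      show "l ^ (q * i + j) * h (n + (q * i + j)) = (l ^ q) ^ i * (l ^ j * h (n + j))"
        using per'[of "n + j" i] by (simp add: power_add power_mult[symmetric] ac_simps)
    qed
    moreover have "norm (\<Sum>i<M. (l ^ q) ^ i) \<le> 2 / norm (l ^ q - 1)"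
    proof -
      have "(\<Sum>i<M. (l ^ q) ^ i) = ((l ^ q) ^ M - 1) / (l ^ q - 1)"
        using geometric_sum[OF neq] by simp
      moreover have "norm ((l ^ q) ^ M - 1) \<le> 2"
        using norm_triangle_ineq4[of "(l ^ q) ^ M" 1] by (simp add: norm_power l)
      ultimately show ?thesis by (simp add: norm_divide divide_right_mono)
    qed
    moreover have "norm (\<Sum>j<q. l ^ j * h (n + j)) \<le> real q * H"
      using norm_twisted_sum_le[where g = h and a = 0 and b = n and N = q, OF l bdd] by simp
    ultimately show ?thesis unfolding b_def by (simp only: norm_mult) (intro mult_mono; simp)
  qed
  obtain M :: nat where M: "real M > b / c" using reals_Archimedean2 by blast
  have "b \<ge> 0" unfolding b_def using H by simp
  then have "real M > 0" using M c by (smt (verit) divide_nonneg_pos)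
  then have "q * M > 0" using per by simp
  then obtain n where "norm (\<Sum>m<q * M. l ^ m * h (n + m)) \<ge> c * real (q * M)" using freq by blast
  then have "c * real (q * M) \<le> b" using bound order_trans by blast
  moreover have "c * real M \<le> c * real (q * M)"
    using per(1) c by (intro mult_left_mono of_nat_mono) auto
  moreover have "b < c * real M" using M c by (simp add: field_simps)
  ultimately show False by linarith
qed

theorem frequency_determined:
  fixes h :: "nat \<Rightarrow> complex" and l :: complex
  assumes win: "\<And>n m. same_window w W n m \<Longrightarrow> h n = h m"
    and l: "norm l = 1" and c: "c > 0"
    and freq: "\<And>N. N > 0 \<Longrightarrow> \<exists>n. norm (\<Sum>m<N. l ^ m * h (n + m)) \<ge> c * real N"
  obtains q where "q > 0" "l ^ q = 1" "determines_mod w q"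
proof (cases "periodic_seq w")
  case True
  then obtain q where q: "q > 0" "\<And>n. w (n + q) = w n" "determines_mod w q"
    using minimal_period unfolding periodic_seq_def by metis
  obtain H where H: "\<And>n. norm (h n) \<le> H" using window_function_bounded[where h = h, OF win] by blast
  have "h (n + q) = h n" for n
  proof (rule win, unfold same_window_def, intro allI impI)
    show "w (n + q + i) = w (n + i)" for i using q(2)[of "n + i"] by (simp add: ac_simps)
  qed
  then have "l ^ q = 1" using frequency_periodic[OF q(1) _ H l c freq] by blast
  then show thesis using that q by blast
next
  case False
  have ret: "\<exists>k. l ^ (p ^ k * r) = 1" if "w n = w (n + r)" for n r
    using frequency_return[OF win l c freq that] by blast
  \<comment> \<open>Some letter occurs twice because the alphabet is finite; one positive return
    time already makes \<open>l\<close> a root of unity.\<close>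
  have "\<not> inj w" using finite_range finite_imageD infinite_UNIV_nat by blast
  then obtain n n' where n: "n < n'" "w n = w n'"
    by (auto simp: inj_on_def) (metis linorder_neqE_nat)
  then obtain k where "l ^ (p ^ k * (n' - n)) = 1" using ret[of n "n' - n"] by auto
  moreover have "p ^ k * (n' - n) > 0" using n p_pos by simp
  ultimately have ex: "\<exists>q. q > 0 \<and> l ^ q = 1" by blast
  define q where "q = (LEAST q. q > 0 \<and> l ^ q = 1)"
  have q: "q > 0" "l ^ q = 1" using LeastI_ex[OF ex] unfolding q_def by auto
  have dvd: "q dvd x" if "l ^ x = 1" for x
  proof -
    have "l ^ (x mod q) = 1"
      using that q(2) by (metis mult_div_mod_eq power_add power_mult power_one mult_1)
    then have "\<not> x mod q > 0" using not_less_Least[of "x mod q" "\<lambda>q. q > 0 \<and> l ^ q = 1"] q(1)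
      by (auto simp: q_def[symmetric])
    then show ?thesis by auto
  qed
  obtain j d where jd: "q = p ^ j * d" "\<not> p dvd d"
    using multiplicity_decompose'[of q p] q(1) prime_p by (metis not_prime_unit less_not_refl)
  have cop: "coprime (p ^ i) d" for i
    using jd(2) prime_p by (simp add: prime_imp_coprime)
  \<comment> \<open>The order \<open>q\<close> divides \<open>p ^ k\<close> times any return time of
    a letter, so the part \<open>d\<close> of \<open>q\<close> that is prime to p divides the return
    time itself.\<close>
  have "[n = m] (mod d)" if eq: "w n = w m" and le: "n \<le> m" for n m
  proof -
    obtain k where "l ^ (p ^ k * (m - n)) = 1" using ret[of n "m - n"] eq le_add_diff_inverse[OF le] by metis
    then have "d dvd p ^ k * (m - n)" using dvd jd(1) dvd_mult_right by blast
    then have "d dvd m - n" using cop[of k] by (simp add: coprime_dvd_mult_right_iff coprime_commute)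
    then show ?thesis using le by (simp add: cong_if_dvd_diff)
  qed
  then have "[n = m] (mod d)" if "same_window w 1 n m" for n m
    using that cong_sym[of m n d] by (cases "n \<le> m") (auto simp: same_window_def)
  then have "determines_mod w d" unfolding determines_mod_def by blast
  then have "determines_mod w q"
    unfolding jd(1)
    using determines_mod_coprime_mult[OF determines_mod_prime_power[OF False]] cop by blast
  then show thesis using that q by blast
qed

end

section \<open>Frequencies of almost periodic sequences\<close>

lemma root_of_unity_orthogonality:
  assumes "n < L" "m < L"
  defines "w \<equiv> cis (2 * pi / real L)"
  shows "(\<Sum>j<L. w ^ (j * n) * cnj (w ^ (j * m))) = (if n = m then of_nat L else 0)"
proof -
  have L: "L > 0" using assms by simp
  have w1: "w ^ k * cnj (w ^ k) = 1" for k
    by (simp add: w_def cis_cnj cis_mult flip: power_mult_distrib)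
  define y where "y = w ^ n * cnj (w ^ m)"
  have y: "w ^ (j * n) * cnj (w ^ (j * m)) = y ^ j" for j
    by (simp add: y_def power_mult_distrib power_mult[symmetric] mult.commute)
  show ?thesis
  proof (cases "n = m")
    case True
    then have "y = 1" using w1 by (simp add: y_def)
    then show ?thesis using True unfolding y by simp
  next
    case False
    have pw: "w ^ k = cis (2 * pi * real k / real L)" for k
    proof -
      have "2 * pi * real k / real L = real k * (2 * pi / real L)" by simp
      then show ?thesis unfolding w_def Complex.DeMoivre by (simp only:)
    qed
    have "inj_on (\<lambda>k. cis (2 * pi * real k / real L)) {..<L}"
      using Complex.bij_betw_roots_unity[OF L] by (rule bij_betw_imp_inj_on)
    then have "w ^ n \<noteq> w ^ m" unfolding pw using False assms by (auto simp: inj_on_def)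
    moreover have "y * w ^ m = w ^ n" using w1[of m] by (simp add: y_def mult_ac)
    ultimately have "y \<noteq> 1" by auto
    moreover have "w ^ L = 1" using pw[of L] L by simp
    then have "y ^ L = 1"
      by (simp add: y_def power_mult_distrib power_mult[symmetric] mult.commute)
        (simp add: power_mult flip: complex_cnj_power)
    ultimately show ?thesis using False unfolding y by (simp add: geometric_sum)
  qed
qed

lemma fourier_parseval:
  fixes f g :: "nat \<Rightarrow> complex" and L :: nat
  defines "F \<equiv> \<lambda>f j. \<Sum>n<L. cis (2 * pi / real L) ^ (j * n) * f n"
  shows "(\<Sum>j<L. F f j * cnj (F g j)) = of_nat L * (\<Sum>n<L. f n * cnj (g n))"
proof -
  define w where "w = cis (2 * pi / real L)"
  have "(\<Sum>j<L. F f j * cnj (F g j)) =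
      (\<Sum>j<L. \<Sum>n<L. \<Sum>m<L. (f n * cnj (g m)) * (w ^ (j * n) * cnj (w ^ (j * m))))"
    by (simp add: F_def w_def sum_product mult_ac)
  also have "\<dots> = (\<Sum>n<L. \<Sum>m<L. \<Sum>j<L. (f n * cnj (g m)) * (w ^ (j * n) * cnj (w ^ (j * m))))"
    by (rule trans[OF sum.swap]) (intro sum.cong refl sum.swap)
  also have "\<dots> = (\<Sum>n<L. \<Sum>m<L. (f n * cnj (g m)) * (if n = m then of_nat L else 0))"
    unfolding sum_distrib_left[symmetric] w_def
    by (intro sum.cong refl arg_cong2[of _ _ _ _ "(*)"] root_of_unity_orthogonality) auto
  also have "\<dots> = (\<Sum>n<L. f n * cnj (g n) * of_nat L)"
    by (intro sum.cong refl) (simp add: if_distrib[of "(*) _"] cong: if_cong)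
  finally show ?thesis by (simp add: sum_distrib_left mult.commute)
qed

text \<open>By Parseval, \<open>\<Sum>\<^sub>j \<bar>F b j\<bar>\<^sup>2 cnj (F e j)\<close> is a sum of autocorrelations of \<open>a\<close>
  over the shifts in \<open>B\<close>; zero padding to length \<open>4 M\<close> avoids wrap-around. If these are all large,
  so is the largest \<open>\<bar>F b j\<bar>\<close>.\<close>

lemma large_fourier_coefficient:
  fixes a :: "nat \<Rightarrow> complex"
  assumes M: "M > 0" and B: "B \<subseteq> {..<M}" and H: "\<And>n. norm (a n) \<le> H"
    and C: "\<And>d. d \<in> B \<Longrightarrow> C \<le> Re (\<Sum>n<2 * M - d. a (n + d) * cnj (a n))"
  obtains l where "norm l = 1"
    "2 * real (card B) * C \<le> norm (\<Sum>n<2 * M. l ^ n * a n) * real M * (2 * H\<^sup>2 + 1)"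
proof -
  \<comment> \<open>The truncation \<open>b\<close> is supported below \<open>2 * M\<close> and the
    shifts in \<open>B\<close> are below \<open>M\<close>, so shifted copies stay below
    \<open>3 * M\<close> and never wrap around.\<close>
  define L where "L = 4 * M"
  define w where "w = cis (2 * pi / real L)"
  define F where "F f j = (\<Sum>n<L. w ^ (j * n) * f n)" for f :: "nat \<Rightarrow> complex" and j
  have parseval: "(\<Sum>j<L. F f j * cnj (F g j)) = of_nat L * (\<Sum>n<L. f n * cnj (g n))" for f g
    unfolding F_def w_def by (rule fourier_parseval)
  define b where "b n = (if n < 2 * M then a n else 0)" for n
  define s where "s d n = (if d \<le> n then b (n - d) else 0)" for d n
  define e :: "nat \<Rightarrow> complex" where "e n = (if n \<in> B then 1 else 0)" for n
  have H0: "H \<ge> 0" using H norm_ge_zero order_trans by blast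
  have L0: "L > 0" using M by (simp add: L_def)
  have shift: "F (s d) j = w ^ (j * d) * F b j" if "d \<in> B" for d j
  proof -
    have "F (s d) j = (\<Sum>n\<in>{d..<d + 2 * M}. w ^ (j * n) * b (n - d))"
      unfolding F_def s_def b_def using that B
      by (intro sum.mono_neutral_cong_right) (auto simp: L_def)
    also have "\<dots> = (\<Sum>n<2 * M. w ^ (j * (n + d)) * b n)"
      by (rule sum.reindex_bij_witness[of _ "\<lambda>n. n + d" "\<lambda>n. n - d"]) auto
    also have "\<dots> = (\<Sum>n<L. w ^ (j * (n + d)) * b n)"
      by (intro sum.mono_neutral_left) (auto simp: L_def b_def)
    finally show ?thesis
      by (simp add: F_def sum_distrib_left power_add distrib_left mult_ac)
  qed
  have corr: "real L * C \<le> Re (\<Sum>j<L. F b j * cnj (F (s d) j))" if d: "d \<in> B" for d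
  proof -
    have "(\<Sum>n<L. b n * cnj (s d n)) = (\<Sum>n\<in>{d..<2 * M}. a n * cnj (a (n - d)))"
      unfolding s_def b_def by (intro sum.mono_neutral_cong_right) (auto simp: L_def)
    also have "\<dots> = (\<Sum>n<2 * M - d. a (n + d) * cnj (a n))"
      by (rule sum.reindex_bij_witness[of _ "\<lambda>n. n + d" "\<lambda>n. n - d"]) auto
    finally have "(\<Sum>j<L. F b j * cnj (F (s d) j)) =
        of_real (real L) * (\<Sum>n<2 * M - d. a (n + d) * cnj (a n))"
      by (simp add: parseval)
    then have "Re (\<Sum>j<L. F b j * cnj (F (s d) j)) =
        real L * Re (\<Sum>n<2 * M - d. a (n + d) * cnj (a n))"
      by (simp only: scaleR_conv_of_real[symmetric] scaleR_complex.sel)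
    then show ?thesis using C[OF d] by (simp add: mult_left_mono)
  qed
  have eF: "F e j = (\<Sum>d\<in>B. w ^ (j * d))" for j
    unfolding F_def e_def using B
    by (subst sum.mono_neutral_cong_right[of _ B _ "\<lambda>d. w ^ (j * d)"]) (auto simp: L_def)
  obtain j0 where j0: "j0 < L" "\<And>j. j < L \<Longrightarrow> norm (F b j) \<le> norm (F b j0)"
  proof -
    have "Max ((\<lambda>j. norm (F b j)) ` {..<L}) \<in> (\<lambda>j. norm (F b j)) ` {..<L}"
      using L0 by (intro Max_in) auto
    then obtain j0 where "j0 < L" "Max ((\<lambda>j. norm (F b j)) ` {..<L}) = norm (F b j0)" by auto
    then show thesis using that[of j0] Max_ge[of "(\<lambda>j. norm (F b j)) ` {..<L}"] by simp
  qed
  define A where "A = norm (F b j0)"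
  have sq: "(\<Sum>j<L. (norm (F f j))\<^sup>2) = real L * (\<Sum>n<L. (norm (f n))\<^sup>2)" for f
  proof -
    have "complex_of_real (\<Sum>j<L. (norm (F f j))\<^sup>2) = of_nat L * (\<Sum>n<L. f n * cnj (f n))"
      unfolding parseval[symmetric] by (simp only: of_real_sum complex_norm_square)
    also have "\<dots> = of_real (real L * (\<Sum>n<L. (norm (f n))\<^sup>2))"
      by (simp only: of_real_mult of_real_sum complex_norm_square of_real_of_nat_eq)
    finally show ?thesis by (simp only: of_real_eq_iff)
  qed
  have "real (card B) * (real L * C) \<le> (\<Sum>d\<in>B. Re (\<Sum>j<L. F b j * cnj (F (s d) j)))"
    using sum_mono[of B "\<lambda>_. real L * C", OF corr] by simp
  also have "\<dots> = Re (\<Sum>d\<in>B. \<Sum>j<L. F b j * cnj (F (s d) j))" by simp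
  also have "(\<Sum>d\<in>B. \<Sum>j<L. F b j * cnj (F (s d) j)) = (\<Sum>j<L. F b j * cnj (F b j) * cnj (F e j))"
    by (subst sum.swap) (auto simp: eF shift sum_distrib_left intro!: sum.cong)
  also have "Re \<dots> \<le> norm (\<Sum>j<L. F b j * cnj (F b j) * cnj (F e j))" by (rule complex_Re_le_cmod)
  \<comment> \<open>One factor \<open>norm (F b j)\<close> is replaced by its maximum
    \<open>A\<close>; the remaining product is split by the arithmetic-geometric mean inequality
    into squares that Parseval evaluates.\<close>
  also have "\<dots> \<le> (\<Sum>j<L. A * (((norm (F b j))\<^sup>2 + (norm (F e j))\<^sup>2) / 2))"
  proof (intro sum_norm_le)
    fix j assume "j \<in> {..<L}"
    then have "norm (F b j) \<le> A" using j0 by (simp add: A_def)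
    moreover have "norm (F b j) * norm (F e j) \<le> ((norm (F b j))\<^sup>2 + (norm (F e j))\<^sup>2) / 2"
      using sum_squares_bound[of "norm (F b j)" "norm (F e j)"] by simp
    ultimately have "norm (F b j) * (norm (F b j) * norm (F e j)) \<le>
        A * (((norm (F b j))\<^sup>2 + (norm (F e j))\<^sup>2) / 2)"
      by (intro mult_mono) (auto simp: A_def)
    then show "norm (F b j * cnj (F b j) * cnj (F e j)) \<le>
        A * (((norm (F b j))\<^sup>2 + (norm (F e j))\<^sup>2) / 2)"
      by (simp add: norm_mult mult.assoc)
  qed
  also have "\<dots> = A * (real L * ((\<Sum>n<L. (norm (b n))\<^sup>2) + (\<Sum>n<L. (norm (e n))\<^sup>2)) / 2)"
    by (simp add: sum_distrib_left[symmetric] sum_divide_distrib[symmetric] sum.distrib sq distrib_left)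
  also have "\<dots> \<le> A * (real L * (2 * real M * H\<^sup>2 + real M) / 2)"
  proof -
    have "(\<Sum>n<L. (norm (b n))\<^sup>2) = (\<Sum>n<2 * M. (norm (a n))\<^sup>2)"
      unfolding b_def by (intro sum.mono_neutral_cong_right) (auto simp: L_def)
    also have "\<dots> \<le> (\<Sum>n<2 * M. H\<^sup>2)" by (intro sum_mono power_mono H) auto
    finally have 1: "(\<Sum>n<L. (norm (b n))\<^sup>2) \<le> 2 * real M * H\<^sup>2" by simp
    have "(\<Sum>n<L. (norm (e n))\<^sup>2) = (\<Sum>n\<in>B. 1)"
      unfolding e_def using B by (intro sum.mono_neutral_cong_right) (auto simp: L_def)
    also have "\<dots> \<le> real M" using card_mono[OF _ B] by simp
    finally show ?thesis using 1 by (intro mult_left_mono divide_right_mono add_mono) (auto simp: A_def)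
  qed
  finally have "real L * (2 * (real (card B) * C)) \<le> real L * (A * (real M * (2 * H\<^sup>2 + 1)))"
    by (simp add: algebra_simps)
  then have "2 * real (card B) * C \<le> A * real M * (2 * H\<^sup>2 + 1)"
    using L0 by (simp add: mult.assoc)
  moreover have "F b j0 = (\<Sum>n<2 * M. (w ^ j0) ^ n * a n)"
    unfolding F_def b_def power_mult by (intro sum.mono_neutral_cong_right) (auto simp: L_def)
  ultimately show thesis
    using that[of "w ^ j0"] by (simp add: A_def norm_power w_def)
qed

section \<open>Almost periods and Fourier-Bohr coefficients\<close>

lemma card_syndetic:
  fixes j :: nat
  assumes "\<And>n. \<exists>t<G. P (n + t)"
  shows "j \<le> card {d. d < j * G \<and> P d}"
proof (induction j)
  case (Suc j)
  obtain t where t: "t < G" "P (j * G + t)" using assms by blast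
  have "insert (j * G + t) {d. d < j * G \<and> P d} \<subseteq> {d. d < Suc j * G \<and> P d}"
    using t by auto
  then have "card (insert (j * G + t) {d. d < j * G \<and> P d}) \<le> card {d. d < Suc j * G \<and> P d}"
    by (intro card_mono) auto
  then show ?case using Suc by simp
qed simp

text \<open>Coarse almost periods repeat the nonzero value at \<open>n1\<close> with positive
  frequency, so the mean square is bounded below. Along fine almost periods the autocorrelations are
  close to this mean square. Both kinds have bounded gaps, which makes \<kappa> independent of the
  length.\<close>

lemma almost_periodic_large_coefficients:
  fixes \<phi> :: "nat \<Rightarrow> complex"
  assumes H: "H > 0" "\<And>n. norm (\<phi> n) \<le> H"
    and ap: "\<And>d. d > 0 \<Longrightarrow> \<exists>G>0. \<forall>n. \<exists>t<G. \<forall>m. norm (\<phi> (n + t + m) - \<phi> m) \<le> d"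
    and nz: "\<phi> n1 \<noteq> 0"
  obtains \<kappa> g where "\<kappa> > 0" "g > 0"
    "\<And>k. k > n1 \<Longrightarrow> \<exists>l. norm l = 1 \<and> \<kappa> * real (k * g) \<le> norm (\<Sum>n<k * g. l ^ n * \<phi> n)"
proof -
  define c1 where "c1 = norm (\<phi> n1)"
  have c1: "c1 > 0" using nz by (simp add: c1_def)
  obtain G1 where G1: "G1 > 0" "\<And>n. \<exists>t<G1. \<forall>m. norm (\<phi> (n + t + m) - \<phi> m) \<le> c1 / 2"
    using ap[of "c1 / 2"] c1 by auto
  \<comment> \<open>In length \<open>M = 2 * k * G1 * G2\<close> at least \<open>k * G2\<close>
    positions have modulus at least \<open>c1 / 2\<close>, giving the mean square \<open>c2\<close>.
    The tolerance \<open>d2\<close> below keeps the error of an autocorrelation under half of the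
    energy.\<close>
  define c2 where "c2 = c1\<^sup>2 / (8 * real G1)"
  have c2: "c2 > 0" using c1 G1 by (simp add: c2_def)
  define d2 where "d2 = c2 / (4 * H)"
  have d2: "d2 > 0" using c2 H by (simp add: d2_def)
  obtain G2 where G2: "G2 > 0" "\<And>n. \<exists>t<G2. \<forall>m. norm (\<phi> (n + t + m) - \<phi> m) \<le> d2"
    using ap[OF d2] by auto
  define K where "K = 2 * H\<^sup>2 + 1"
  have K: "K > 0" by (simp add: K_def add_nonneg_pos)
  define \<kappa> where "\<kappa> = c2 / (2 * real G2 * K)"
  have \<kappa>: "\<kappa> > 0" using c2 G2 K by (simp add: \<kappa>_def)
  have "\<exists>l. norm l = 1 \<and> \<kappa> * real (k * (4 * G1 * G2)) \<le> norm (\<Sum>n<k * (4 * G1 * G2). l ^ n * \<phi> n)"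
    if k: "k > n1" for k
  proof -
    \<comment> \<open>A common multiple of both gaps. Almost periods are taken from its first half,
      so that adding \<open>n1 < k\<close> stays below \<open>M\<close>.\<close>
    define M where "M = 2 * k * G1 * G2"
    have M: "M > 0" using k G1 G2 by (simp add: M_def)
    have energy: "real M * c2 \<le> (\<Sum>n<M. (norm (\<phi> n))\<^sup>2)"
    proof -
      define P where "P = {t. t < k * G2 * G1 \<and> (\<forall>m. norm (\<phi> (t + m) - \<phi> m) \<le> c1 / 2)}"
      have P: "k * G2 \<le> card P" "finite P"
        unfolding P_def using card_syndetic[OF G1(2), of "k * G2"] by auto
      have low: "(c1 / 2)\<^sup>2 \<le> (norm (\<phi> (t + n1)))\<^sup>2" if "t \<in> P" for t
      proof (rule power_mono)
        have "norm (\<phi> (t + n1) - \<phi> n1) \<le> c1 / 2" using that by (auto simp: P_def)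
        then show "c1 / 2 \<le> norm (\<phi> (t + n1))"
          using norm_triangle_ineq2[of "\<phi> n1" "\<phi> (t + n1)"] norm_minus_commute[of "\<phi> n1"]
          by (simp add: c1_def)
      qed (use c1 in simp)
      have "k * 1 \<le> k * (G2 * G1)" using G1 G2 by (intro mult_le_mono2) simp
      moreover have "M = k * (G2 * G1) + k * (G2 * G1)" by (simp add: M_def mult_ac)
      ultimately have "t + n1 < M" if "t < k * (G2 * G1)" for t using that k by linarith
      then have sub: "(\<lambda>t. t + n1) ` P \<subseteq> {..<M}" by (auto simp: P_def mult.assoc)
      have "real (k * G2) * (c1 / 2)\<^sup>2 \<le> (\<Sum>t\<in>P. (c1 / 2)\<^sup>2)"
        using P(1) by (simp del: of_nat_mult add: mult_right_mono)
      also have "\<dots> \<le> (\<Sum>t\<in>P. (norm (\<phi> (t + n1)))\<^sup>2)" by (intro sum_mono low)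
      also have "\<dots> = (\<Sum>n\<in>(\<lambda>t. t + n1) ` P. (norm (\<phi> n))\<^sup>2)"
        by (simp add: sum.reindex)
      also have "\<dots> \<le> (\<Sum>n<M. (norm (\<phi> n))\<^sup>2)" using sub by (intro sum_mono2) auto
      finally show ?thesis using G1 by (simp add: M_def c2_def power2_eq_square field_simps)
    qed
    define B where "B = {d. d < 2 * k * G1 * G2 \<and> (\<forall>m. norm (\<phi> (d + m) - \<phi> m) \<le> d2)}"
    have B: "2 * k * G1 \<le> card B" "B \<subseteq> {..<M}"
      unfolding B_def M_def using card_syndetic[OF G2(2), of "2 * k * G1"] by auto
    have "real M * c2 / 2 \<le> Re (\<Sum>n<2 * M - d. \<phi> (n + d) * cnj (\<phi> n))" if d: "d \<in> B" for d
    proof -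
      have dM: "d < M" using d B by auto
      have "(norm (\<phi> n))\<^sup>2 - d2 * H \<le> Re (\<phi> (n + d) * cnj (\<phi> n))" for n
      proof -
        have "norm ((\<phi> (n + d) - \<phi> n) * cnj (\<phi> n)) \<le> d2 * H"
          using d H by (auto simp: B_def norm_mult add.commute intro!: mult_mono less_imp_le[OF d2])
        then have "\<bar>Re ((\<phi> (n + d) - \<phi> n) * cnj (\<phi> n))\<bar> \<le> d2 * H"
          using abs_Re_le_cmod order_trans by blast
        moreover have "\<phi> (n + d) * cnj (\<phi> n) =
            (\<phi> (n + d) - \<phi> n) * cnj (\<phi> n) + of_real ((norm (\<phi> n))\<^sup>2)"
          by (simp add: algebra_simps complex_norm_square del: of_real_power)
        ultimately show ?thesis by (simp only: plus_complex.sel Re_complex_of_real abs_le_iff) simp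
      qed
      then have "(\<Sum>n<2 * M - d. (norm (\<phi> n))\<^sup>2 - d2 * H) \<le> Re (\<Sum>n<2 * M - d. \<phi> (n + d) * cnj (\<phi> n))"
        unfolding Re_sum by (intro sum_mono)
      then have "(\<Sum>n<2 * M - d. (norm (\<phi> n))\<^sup>2) - real (2 * M - d) * (d2 * H) \<le>
          Re (\<Sum>n<2 * M - d. \<phi> (n + d) * cnj (\<phi> n))"
        by (simp only: sum_subtractf sum_constant card_lessThan)
      moreover have "(\<Sum>n<M. (norm (\<phi> n))\<^sup>2) \<le> (\<Sum>n<2 * M - d. (norm (\<phi> n))\<^sup>2)"
        using dM by (intro sum_mono2) auto
      moreover have "real (2 * M - d) * (d2 * H) \<le> real (2 * M) * (d2 * H)"
        using d2 H by (intro mult_right_mono of_nat_mono) auto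
      moreover have "real (2 * M) * (d2 * H) = real M * c2 / 2" using H by (simp add: d2_def)
      ultimately show ?thesis using energy by linarith
    qed
    then obtain l where l: "norm l = 1"
      "2 * real (card B) * (real M * c2 / 2) \<le> norm (\<Sum>n<2 * M. l ^ n * \<phi> n) * real M * (2 * H\<^sup>2 + 1)"
      using large_fourier_coefficient[of M B \<phi> H "real M * c2 / 2"] M B(2) H(2) by blast
    have "real (2 * k * G1) * c2 \<le> real (card B) * c2" using B(1) c2 by (intro mult_right_mono of_nat_mono) auto
    moreover have "real M * (real (card B) * c2) \<le> real M * (norm (\<Sum>n<2 * M. l ^ n * \<phi> n) * K)"
      using l(2) by (simp add: K_def mult_ac)
    then have "real (card B) * c2 \<le> norm (\<Sum>n<2 * M. l ^ n * \<phi> n) * K"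
      using M mult_le_cancel_left_pos[of "real M"] by simp
    ultimately have "real (2 * k * G1) * c2 / K \<le> norm (\<Sum>n<2 * M. l ^ n * \<phi> n)"
      using K by (simp add: pos_divide_le_eq)
    moreover have "real (2 * k * G1) * c2 / K = \<kappa> * real (2 * M)"
      using G2 K by (simp add: \<kappa>_def M_def field_simps)
    moreover have "2 * M = k * (4 * G1 * G2)" by (simp add: M_def)
    ultimately show ?thesis using l(1) by metis
  qed
  then show thesis using that[of \<kappa> "4 * G1 * G2"] \<kappa> G1 G2 by simp
qed

text \<open>A nonzero almost periodic sequence has a nonzero Fourier--Bohr coefficient. The frequency is
  a limit of frequencies of large coefficients of longer and longer initial segments.\<close>

lemma almost_periodic_frequency:
  fixes \<phi> :: "nat \<Rightarrow> complex"
  assumes H: "H > 0" "\<And>n. norm (\<phi> n) \<le> H"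
    and ap: "\<And>d. d > 0 \<Longrightarrow> \<exists>G>0. \<forall>n. \<exists>t<G. \<forall>m. norm (\<phi> (n + t + m) - \<phi> m) \<le> d"
    and nz: "\<phi> n1 \<noteq> 0"
  obtains l c where "norm l = 1" "c > 0"
    "\<And>N. N > 0 \<Longrightarrow> \<exists>n. c * real N \<le> norm (\<Sum>x<N. l ^ x * \<phi> (n + x))"
proof -
  obtain \<kappa> g where \<kappa>: "\<kappa> > 0" and g: "g > 0" and big: "\<And>k. k > n1 \<Longrightarrow>
      \<exists>l. norm l = 1 \<and> \<kappa> * real (k * g) \<le> norm (\<Sum>n<k * g. l ^ n * \<phi> n)"
    using almost_periodic_large_coefficients[OF H ap nz] by metis
  have "\<exists>l. norm l = 1 \<and> \<kappa> * real ((n1 + Suc i) * g) \<le> norm (\<Sum>n<(n1 + Suc i) * g. l ^ n * \<phi> n)" for i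
    by (rule big) simp
  then obtain L where L: "\<And>i. norm (L i) = 1"
      "\<And>i. \<kappa> * real ((n1 + Suc i) * g) \<le> norm (\<Sum>n<(n1 + Suc i) * g. L i ^ n * \<phi> n)" by metis
  have "compact (sphere 0 1 :: complex set)" by simp
  then obtain l r where lr: "l \<in> sphere 0 1" "strict_mono r" "(L \<circ> r) \<longlonglongrightarrow> l"
    using L(1) unfolding compact_def by (metis dist_0_norm mem_sphere)
  have l1: "norm l = 1" using lr(1) by simp
  have "\<exists>n. \<kappa> / 2 * real N \<le> norm (\<Sum>x<N. l ^ x * \<phi> (n + x))" if N: "N > 0" for N
  proof (rule ccontr)
    assume "\<not> ?thesis"
    then have small: "\<And>n. norm (\<Sum>x<N. l ^ x * \<phi> (n + x)) \<le> \<kappa> / 2 * real N" by (simp add: not_le less_imp_le)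
    \<comment> \<open>Replacing \<open>l\<close> by a frequency within \<open>e\<close> changes a
      sum of length \<open>N\<close> by at most a quarter of
      \<open>\<kappa> * real N\<close>.\<close>
    define e where "e = \<kappa> / (4 * H * real N)"
    have "e > 0" using \<kappa> H N by (simp add: e_def)
    obtain K :: nat where K: "real K > 4 * real N * H / \<kappa>" using reals_Archimedean2 by blast
    have "eventually (\<lambda>i. dist ((L \<circ> r) i) l < e) sequentially" using tendstoD[OF lr(3) \<open>e > 0\<close>] .
    then obtain I where I: "\<And>i. i \<ge> I \<Longrightarrow> dist ((L \<circ> r) i) l < e"
      unfolding eventually_sequentially by blast
    define i where "i = max I K"
    have i: "i \<ge> K" "dist ((L \<circ> r) i) l < e" using I[of i] by (auto simp: i_def)
    define l' where "l' = L (r i)"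
    have l': "norm l' = 1" using L by (simp add: l'_def)
    have block: "norm (\<Sum>x<N. l' ^ x * \<phi> (n + x)) \<le> 3 / 4 * \<kappa> * real N" for n
    proof -
      have "norm (l' ^ x * \<phi> (n + x) - l ^ x * \<phi> (n + x)) \<le> \<kappa> / 4" if "x < N" for x
      proof -
        have "norm (l' ^ x - l ^ x) \<le> real x * norm (l' - l)"
          by (intro norm_power_diff) (simp_all add: l' l1)
        also have "\<dots> \<le> real N * e"
          using that i(2) by (intro mult_mono) (auto simp: l'_def dist_norm)
        finally have "norm (l' ^ x - l ^ x) * norm (\<phi> (n + x)) \<le> real N * e * H"
          using H by (intro mult_mono) (auto intro: order_trans[OF norm_ge_zero])
        then show ?thesis using N H by (simp add: e_def norm_mult left_diff_distrib[symmetric])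
      qed
      then have "norm (\<Sum>x<N. l' ^ x * \<phi> (n + x) - l ^ x * \<phi> (n + x)) \<le> (\<Sum>x<N. \<kappa> / 4)"
        by (intro sum_norm_le) simp
      then have "norm ((\<Sum>x<N. l' ^ x * \<phi> (n + x)) - (\<Sum>x<N. l ^ x * \<phi> (n + x))) \<le> \<kappa> / 4 * real N"
        by (simp only: sum_subtractf) (simp add: mult.commute)
      then show ?thesis
        using small[of n] norm_triangle_ineq2[of "\<Sum>x<N. l' ^ x * \<phi> (n + x)" "\<Sum>x<N. l ^ x * \<phi> (n + x)"]
        by simp
    qed
    \<comment> \<open>The long segment is cut into blocks of length \<open>N\<close>. Each
      contributes at most three quarters of the claimed size, and the remainder at most
      \<open>real N * H\<close>; since \<open>T \<ge> K\<close>, this is too little.\<close>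
    define T where "T = (n1 + Suc (r i)) * g"
    have T: "T = N * (T div N) + T mod N" by simp
    have "(\<Sum>x<T. l' ^ x * \<phi> x) = (\<Sum>j<T div N. l' ^ (N * j) * (\<Sum>x<N. l' ^ x * \<phi> (N * j + x)))
        + (\<Sum>x<T mod N. l' ^ (N * (T div N) + x) * \<phi> (N * (T div N) + x))"
      by (subst T, subst sum_lessThan_add, subst sum_lessThan_mult)
        (simp add: sum_distrib_left power_add mult.assoc)
    also have "norm \<dots> \<le> (\<Sum>j<T div N. 3 / 4 * \<kappa> * real N) + real (T mod N) * H"
      by (intro norm_triangle_mono sum_norm_le norm_twisted_sum_le l' H)
        (simp only: norm_mult norm_power l' power_one mult_1 block)
    also have "\<dots> \<le> 3 / 4 * \<kappa> * real T + real N * H"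
    proof (intro add_mono mult_right_mono)
      have "real (T div N) * real N \<le> real T"
        by (metis div_times_less_eq_dividend of_nat_le_iff of_nat_mult)
      then show "(\<Sum>j<T div N. 3 / 4 * \<kappa> * real N) \<le> 3 / 4 * \<kappa> * real T"
        using mult_left_mono[of "real (T div N) * real N" "real T" "3 / 4 * \<kappa>"] \<kappa> by (simp add: mult_ac)
      show "real (T mod N) \<le> real N" using N by (simp add: less_imp_le)
    qed (use H in simp)
    finally have "\<kappa> * real T \<le> 3 / 4 * \<kappa> * real T + real N * H"
      using L(2)[of "r i"] unfolding T_def l'_def by linarith
    then have "real T \<le> 4 * real N * H / \<kappa>" using \<kappa> by (simp add: field_simps)
    moreover have "K \<le> T"
    proof -
      have "i \<le> r i" using lr(2) by (rule seq_suble)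
      then have "K \<le> (n1 + Suc (r i)) * 1" using i(1) by simp
      also have "\<dots> \<le> T" unfolding T_def using g by (intro mult_le_mono2) simp
      finally show ?thesis .
    qed
    ultimately show False using K by linarith
  qed
  then show thesis using that[of l "\<kappa> / 2"] l1 \<kappa> by simp
qed

section \<open>Regular sequences over a tower of fixed points\<close>

locale profinite_fixed_point =
  fixes p :: nat and u :: "nat \<Rightarrow> nat \<Rightarrow> 's"
  assumes levels: "subst_fixed_point p (level \<alpha> u)"
    and refine: "\<alpha> \<le> \<beta> \<Longrightarrow> u n \<beta> = u m \<beta> \<Longrightarrow> u n \<alpha> = u m \<alpha>"
begin

text \<open>One parameter measures both the level and the length of the common window.\<close>

definition near :: "nat \<Rightarrow> nat \<Rightarrow> nat \<Rightarrow> bool" where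
  "near W n m \<longleftrightarrow> same_window (level W u) W n m"

definition moduli :: "nat set" where
  "moduli = {q. q > 0 \<and> (\<exists>\<alpha>. determines_mod (level \<alpha> u) q)}"

text \<open>These are the sequences that are read off along the orbit of \<open>u\<close> in an equicontinuous factor.\<close>

definition regular :: "(nat \<Rightarrow> complex) \<Rightarrow> bool" where
  "regular \<phi> \<longleftrightarrow>
     (\<forall>e>0. \<exists>W. \<forall>n m. near W n m \<longrightarrow> (\<forall>j. norm (\<phi> (n + j) - \<phi> (m + j)) \<le> e))"

lemma near_iff: "near W n m \<longleftrightarrow> (\<forall>i<W. u (n + i) W = u (m + i) W)"
  by (simp add: near_def same_window_def level_def)

lemma near_mono: "near W n m \<Longrightarrow> V \<le> W \<Longrightarrow> near V n m"
  unfolding near_iff by (meson less_le_trans refine)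

lemma near_sym: "near W n m \<Longrightarrow> near W m n"
  unfolding near_iff by simp

lemma near_trans: "near W n m \<Longrightarrow> near W m l \<Longrightarrow> near W n l"
  unfolding near_iff by simp

lemma near_representatives: "\<exists>M. \<forall>n. \<exists>m\<le>M. near W n m"
  unfolding near_def by (rule subst_fixed_point.window_representatives[OF levels])

lemma moduli_near:
  assumes "q \<in> moduli"
  obtains W where "\<And>n m. near W n m \<Longrightarrow> [n = m] (mod q)"
proof -
  obtain \<alpha> V where V: "\<And>n m. same_window (level \<alpha> u) V n m \<Longrightarrow> [n = m] (mod q)"
    using assms by (auto simp: moduli_def determines_mod_def)
  have "same_window (level \<alpha> u) V n m" if "near (max \<alpha> V) n m" for n m
    using that unfolding near_iff same_window_def level_def
    by (meson less_le_trans max.cobounded1 max.cobounded2 refine)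
  then show thesis using that V by blast
qed

lemma moduli_lcm:
  assumes "a \<in> moduli" "b \<in> moduli"
  shows "lcm a b \<in> moduli"
proof -
  obtain V W where VW: "\<And>n m. near V n m \<Longrightarrow> [n = m] (mod a)" "\<And>n m. near W n m \<Longrightarrow> [n = m] (mod b)"
    using assms moduli_near by metis
  have "[n = m] (mod lcm a b)" if "near (max V W) n m" for n m
    using that near_mono VW by (intro cong_cong_lcm_nat) (meson max.cobounded1 max.cobounded2)+
  then show ?thesis
    using assms unfolding moduli_def determines_mod_def near_def by (auto simp: lcm_pos_nat)
qed

lemma one_in_moduli: "1 \<in> moduli"
  using determines_mod_one by (auto simp: moduli_def)

lemma moduli_Lcm: "finite F \<Longrightarrow> F \<subseteq> moduli \<Longrightarrow> Lcm F \<in> moduli"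
  by (induction F rule: finite_induct) (auto simp: moduli_lcm one_in_moduli[simplified])

text \<open>A divisibility chain that is cofinal in \<open>moduli\<close>: every modulus
  \<open>q\<close> divides \<open>modulus i\<close> as soon as \<open>i \<ge> q\<close>. Closure
  under least common multiples keeps the chain inside \<open>moduli\<close>.\<close>

definition modulus :: "nat \<Rightarrow> nat" where
  "modulus i = Lcm (moduli \<inter> {..i})"

lemma modulus_in_moduli: "modulus i \<in> moduli"
  unfolding modulus_def by (intro moduli_Lcm) auto

lemma modulus_pos: "modulus i > 0"
  using modulus_in_moduli by (simp add: moduli_def)

lemma modulus_dvd: "i \<le> j \<Longrightarrow> modulus i dvd modulus j"
  unfolding modulus_def by (rule Lcm_subset) auto

lemma dvd_modulus: "q \<in> moduli \<Longrightarrow> q \<le> i \<Longrightarrow> q dvd modulus i"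
  unfolding modulus_def by (rule dvd_Lcm) auto

lemma regular_bounded:
  assumes "regular \<phi>"
  obtains H where "H > 0" "\<And>n. norm (\<phi> n) \<le> H"
proof -
  obtain W where W: "\<And>n m j. near W n m \<Longrightarrow> norm (\<phi> (n + j) - \<phi> (m + j)) \<le> 1"
    using assms unfolding regular_def by (metis zero_less_one)
  obtain M where M: "\<And>n. \<exists>m\<le>M. near W n m" using near_representatives by blast
  have "norm (\<phi> n) \<le> (\<Sum>m\<le>M. norm (\<phi> m)) + 1" for n
  proof -
    obtain m where m: "m \<le> M" "near W n m" using M by blast
    have "norm (\<phi> m) \<le> (\<Sum>m\<le>M. norm (\<phi> m))" using m by (intro member_le_sum) auto
    then show ?thesis using W[OF m(2), of 0] norm_triangle_ineq2[of "\<phi> n" "\<phi> m"] by simp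
  qed
  moreover have "(\<Sum>m\<le>M. norm (\<phi> m)) + 1 > 0" by (simp add: add_nonneg_pos sum_nonneg)
  ultimately show thesis using that by blast
qed

text \<open>Every time at which the orbit returns near its starting window is an almost period, and
  \<open>prefix_recurrence\<close> bounds the gaps.\<close>

lemma regular_almost_periodic:
  assumes "regular \<phi>" "d > 0"
  shows "\<exists>G>0. \<forall>n. \<exists>t<G. \<forall>m. norm (\<phi> (n + t + m) - \<phi> m) \<le> d"
proof -
  obtain W where W: "\<And>n m j. near W n m \<Longrightarrow> norm (\<phi> (n + j) - \<phi> (m + j)) \<le> d"
    using assms unfolding regular_def by metis
  obtain G where "G > 0" "\<And>n. \<exists>t<G. near W (n + t) 0"
    using subst_fixed_point.prefix_recurrence[OF levels, of 0 W W] unfolding near_def by blast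
  then show ?thesis using W[of _ 0] by (metis add_0)
qed

text \<open>Evaluating \<psi> at the least position of each \<open>near\<close> class gives a
  genuine window function at a single level, within \<open>c / 2\<close> of \<psi> everywhere. Half
  of the frequency bound survives, and \<open>frequency_determined\<close> applies.\<close>

lemma regular_frequency_root:
  assumes "regular \<psi>" and l: "norm l = 1" and c: "c > 0"
    and freq: "\<And>N. N > 0 \<Longrightarrow> \<exists>n. c * real N \<le> norm (\<Sum>x<N. l ^ x * \<psi> (n + x))"
  obtains q where "q \<in> moduli" "l ^ q = 1"
proof -
  obtain W where W: "\<And>n m j. near W n m \<Longrightarrow> norm (\<psi> (n + j) - \<psi> (m + j)) \<le> c / 2"
    using assms(1) c unfolding regular_def by (meson half_gt_zero)
  define rep where "rep n = (LEAST m. near W n m)" for n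
  have rep: "near W n (rep n)" for n
    unfolding rep_def by (rule LeastI[of _ n]) (simp add: near_iff)
  have "near W n = near W m" if "near W n m" for n m
    using that near_sym near_trans by blast
  then have win: "\<psi> (rep n) = \<psi> (rep m)" if "same_window (level W u) W n m" for n m
    using that unfolding rep_def near_def[symmetric] by simp
  have freq': "\<exists>n. c / 2 * real N \<le> norm (\<Sum>x<N. l ^ x * \<psi> (rep (n + x)))" if "N > 0" for N
  proof -
    obtain n where n: "c * real N \<le> norm (\<Sum>x<N. l ^ x * \<psi> (n + x))" using freq \<open>N > 0\<close> by blast
    have "norm (l ^ x * \<psi> (n + x) - l ^ x * \<psi> (rep (n + x))) \<le> c / 2" for x
      using W[OF rep[of "n + x"], of 0] l
      by (simp add: right_diff_distrib[symmetric] norm_mult norm_power)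
    then have "norm (\<Sum>x<N. l ^ x * \<psi> (n + x) - l ^ x * \<psi> (rep (n + x))) \<le> (\<Sum>x<N. c / 2)"
      by (intro sum_norm_le)
    then have "norm ((\<Sum>x<N. l ^ x * \<psi> (n + x)) - (\<Sum>x<N. l ^ x * \<psi> (rep (n + x)))) \<le> c / 2 * real N"
      by (simp only: sum_subtractf) (simp add: mult.commute)
    then show ?thesis
      using n norm_triangle_ineq2[of "\<Sum>x<N. l ^ x * \<psi> (n + x)" "\<Sum>x<N. l ^ x * \<psi> (rep (n + x))"]
      by (intro exI[of _ n]) (simp add: field_simps)
  qed
  obtain q where "q > 0" "l ^ q = 1" "determines_mod (level W u) q"
    using subst_fixed_point.frequency_determined[where h = "\<lambda>n. \<psi> (rep n)",
        OF levels win l half_gt_zero[OF c] freq'] by blast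
  then show thesis using that by (auto simp: moduli_def)
qed

text \<open>If \<open>\<phi>\<close> is not nearly periodic along the moduli, the translates of \<open>\<phi>\<close> by suitable multiples
  of the moduli converge to some \<open>\<phi>' \<noteq> \<phi>\<close>. A frequency of \<open>\<phi>' - \<phi>\<close> has order a
  modulus; but on frequencies of such an order these translations act trivially.\<close>

theorem regular_nearly_periodic:
  assumes reg: "regular \<phi>" and "e > 0"
  shows "\<exists>q\<in>moduli. \<forall>n m. [n = m] (mod q) \<longrightarrow> norm (\<phi> n - \<phi> m) \<le> e"
proof (rule ccontr)
  assume neg: "\<not> ?thesis"
  have "\<exists>t m. modulus i dvd t \<and> norm (\<phi> (m + t) - \<phi> m) > e" for i
  proof -
    obtain n m where nm: "[n = m] (mod modulus i)" "norm (\<phi> n - \<phi> m) > e"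
      using neg modulus_in_moduli[of i] by (auto simp: not_le)
    show ?thesis
    proof (cases "m \<le> n")
      case True
      then show ?thesis using nm
        by (intro exI[of _ "n - m"] exI[of _ m]) (simp add: cong_altdef_nat)
    next
      case False
      then show ?thesis using nm cong_sym[OF nm(1)]
        by (intro exI[of _ "m - n"] exI[of _ n]) (simp add: cong_altdef_nat norm_minus_commute)
    qed
  qed
  then obtain t m where tm: "\<And>i. modulus i dvd t i" "\<And>i. norm (\<phi> (m i + t i) - \<phi> (m i)) > e"
    by metis
  obtain H where H: "H > 0" "\<And>n. norm (\<phi> n) \<le> H" using regular_bounded[OF reg] by blast
  \<comment> \<open>Diagonal extraction gives pointwise convergence of the translates, which are
    uniformly bounded.\<close>
  obtain k where k: "strict_mono k" "\<And>x. \<exists>l. (\<lambda>i. \<phi> (x + t (k i))) \<longlonglongrightarrow> l"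
    using function_convergent_subsequence[of "UNIV :: nat set" "\<lambda>i x. \<phi> (x + t i)" H] H by auto
  obtain \<phi>' where \<phi>': "\<And>x. (\<lambda>i. \<phi> (x + t (k i))) \<longlonglongrightarrow> \<phi>' x" using k(2) by metis
  have shift_close: "norm (\<phi>' (n + j) - \<phi>' (m + j)) \<le> d"
    if W: "\<And>n m j. near W n m \<Longrightarrow> norm (\<phi> (n + j) - \<phi> (m + j)) \<le> d" and "near W n m" for W d n m j
  proof (rule LIMSEQ_le_const2)
    show "(\<lambda>i. norm (\<phi> (n + j + t (k i)) - \<phi> (m + j + t (k i)))) \<longlonglongrightarrow> norm (\<phi>' (n + j) - \<phi>' (m + j))"
      by (intro tendsto_intros \<phi>')
    show "\<exists>N. \<forall>i\<ge>N. norm (\<phi> (n + j + t (k i)) - \<phi> (m + j + t (k i))) \<le> d"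
      using W[OF \<open>near W n m\<close>] by (simp add: add.assoc)
  qed
  \<comment> \<open>All translates inherit the same dependence on windows, so convergence at
    finitely many representatives implies uniform convergence.\<close>
  have unif: "\<exists>I. \<forall>i\<ge>I. \<forall>x. norm (\<phi> (x + t (k i)) - \<phi>' x) \<le> d" if "d > 0" for d
  proof -
    obtain W where W: "\<And>n m j. near W n m \<Longrightarrow> norm (\<phi> (n + j) - \<phi> (m + j)) \<le> d / 3"
      using reg \<open>d > 0\<close> unfolding regular_def by (metis divide_pos_pos zero_less_numeral)
    obtain M where M: "\<And>n. \<exists>m\<le>M. near W n m" using near_representatives by blast
    have "eventually (\<lambda>i. \<forall>m\<in>{..M}. dist (\<phi> (m + t (k i))) (\<phi>' m) < d / 3) sequentially"
      using \<open>d > 0\<close> by (intro eventually_ball_finite ballI tendstoD[OF \<phi>']) simp_all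
    then obtain I where I: "\<And>i m. i \<ge> I \<Longrightarrow> m \<le> M \<Longrightarrow> norm (\<phi> (m + t (k i)) - \<phi>' m) < d / 3"
      by (auto simp: eventually_sequentially dist_norm)
    have "norm (\<phi> (x + t (k i)) - \<phi>' x) \<le> d" if "i \<ge> I" for i x
    proof -
      obtain m where m: "m \<le> M" "near W x m" using M by blast
      have "norm (\<phi> (x + t (k i)) - \<phi> (m + t (k i))) \<le> d / 3" using W m by blast
      moreover have "norm (\<phi>' x - \<phi>' m) \<le> d / 3" using shift_close[OF W m(2), of 0] by simp
      moreover have "norm (\<phi> (m + t (k i)) - \<phi>' m) < d / 3" using I that m by blast
      ultimately show ?thesis
        using norm_triangle_ineq[of "\<phi> (x + t (k i)) - \<phi> (m + t (k i))" "\<phi> (m + t (k i)) - \<phi>' m"]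
          norm_triangle_ineq4[of "\<phi> (x + t (k i)) - \<phi>' m" "\<phi>' x - \<phi>' m"] by simp
    qed
    then show ?thesis by blast
  qed
  define \<psi> where "\<psi> x = \<phi>' x - \<phi> x" for x
  have "regular \<psi>"
    unfolding regular_def
  proof (intro allI impI)
    fix d :: real assume "d > 0"
    then obtain W where W: "\<And>n m j. near W n m \<Longrightarrow> norm (\<phi> (n + j) - \<phi> (m + j)) \<le> d / 2"
      using reg unfolding regular_def by (meson half_gt_zero)
    have "norm (\<psi> (n + j) - \<psi> (m + j)) \<le> d" if "near W n m" for n m j
      using W[OF that, of j] shift_close[OF W that, of j]
        norm_triangle_ineq4[of "\<phi>' (n + j) - \<phi>' (m + j)" "\<phi> (n + j) - \<phi> (m + j)"]
      by (simp add: \<psi>_def algebra_simps)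
    then show "\<exists>W. \<forall>n m. near W n m \<longrightarrow> (\<forall>j. norm (\<psi> (n + j) - \<psi> (m + j)) \<le> d)" by blast
  qed
  obtain n1 where "\<psi> n1 \<noteq> 0"
  proof -
    obtain I where I: "\<And>x. norm (\<phi> (x + t (k I)) - \<phi>' x) \<le> e / 2"
      using unif[of "e / 2"] \<open>e > 0\<close> by auto
    \<comment> \<open>At this position the translate differs from \<phi> by more than
      \<open>e\<close> but from its limit by at most \<open>e / 2\<close>.\<close>
    have "\<psi> (m (k I)) \<noteq> 0"
      using I[of "m (k I)"] tm(2)[of "k I"] \<open>e > 0\<close> by (auto simp: \<psi>_def)
    then show thesis using that by blast
  qed
  moreover obtain H' where "H' > 0" "\<And>n. norm (\<psi> n) \<le> H'"
    using regular_bounded[OF \<open>regular \<psi>\<close>] by blast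
  ultimately obtain l c where l: "norm l = 1" and c: "c > 0"
    and freq: "\<And>N. N > 0 \<Longrightarrow> \<exists>n. c * real N \<le> norm (\<Sum>x<N. l ^ x * \<psi> (n + x))"
    using almost_periodic_frequency[OF _ _ regular_almost_periodic[OF \<open>regular \<psi>\<close>]] by blast
  obtain q where q: "q \<in> moduli" "l ^ q = 1"
    using regular_frequency_root[OF \<open>regular \<psi>\<close> l c freq] by blast
  obtain I where I: "\<And>i x. i \<ge> I \<Longrightarrow> norm (\<phi> (x + t (k i)) - \<phi>' x) \<le> c / 2"
    using unif[of "c / 2"] c by auto
  \<comment> \<open>Besides being far out in the subsequence, \<open>i \<ge> q\<close> makes
    \<open>q\<close> divide \<open>t (k i)\<close>, so \<open>l ^ s = 1\<close>.\<close>
  define i where "i = max I q"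
  define s where "s = t (k i)"
  have "q \<le> k i" using seq_suble[OF k(1), of i] by (simp add: i_def)
  then have "q dvd s" using dvd_modulus[OF q(1)] tm(1) dvd_trans unfolding s_def by blast
  then have ls: "l ^ s = 1" using q(2) by (auto simp: power_mult elim!: dvdE)
  obtain N :: nat where N: "real N > 4 * real s * H / c" using reals_Archimedean2 by blast
  then have "real N > 0" using H c by (smt (verit) divide_nonneg_pos mult_nonneg_nonneg of_nat_0_le_iff)
  then obtain n where n: "c * real N \<le> norm (\<Sum>x<N. l ^ x * \<psi> (n + x))" using freq by auto
  have "norm (\<Sum>x<N. l ^ x * \<psi> (n + x) - l ^ x * (\<phi> (n + x + s) - \<phi> (n + x))) \<le> (\<Sum>x<N. c / 2)"
  proof (intro sum_norm_le)
    fix x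
    have "l ^ x * \<psi> (n + x) - l ^ x * (\<phi> (n + x + s) - \<phi> (n + x)) = l ^ x * (\<phi>' (n + x) - \<phi> (n + x + s))"
      by (simp add: \<psi>_def algebra_simps)
    then show "norm (l ^ x * \<psi> (n + x) - l ^ x * (\<phi> (n + x + s) - \<phi> (n + x))) \<le> c / 2"
      using I[of i "n + x"] l by (simp add: norm_mult norm_power norm_minus_commute i_def s_def)
  qed
  \<comment> \<open>Because \<open>l ^ s = 1\<close>, a translate of \<phi> by \<open>s\<close> has
    the same twisted sum as \<phi> up to end terms, a bound that does not grow with
    \<open>N\<close>.\<close>
  moreover have "norm (\<Sum>x<N. l ^ x * (\<phi> (n + x + s) - \<phi> (n + x))) \<le> 2 * real s * H"
    using norm_twisted_sum_shift[OF l, where g = "\<lambda>x. \<phi> (n + x)" and H = H and s = s and N = N] H(2) ls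
    by (simp add: right_diff_distrib sum_subtractf add_ac)
  ultimately have "norm (\<Sum>x<N. l ^ x * \<psi> (n + x)) \<le> real N * (c / 2) + 2 * real s * H"
    using norm_triangle_ineq2[of "\<Sum>x<N. l ^ x * \<psi> (n + x)" "\<Sum>x<N. l ^ x * (\<phi> (n + x + s) - \<phi> (n + x))"]
    by (simp add: sum_subtractf)
  then have "c * real N \<le> 4 * real s * H" using n by (simp add: field_simps)
  then show False using N c by (simp add: field_simps)
qed

end

section \<open>Inverse limits of finite sets and odometers\<close>

lemma topspace_inverse_limit:
  "topspace (inverse_limit X \<psi>) =
     {s. (\<forall>\<alpha>. s \<alpha> \<in> topspace (X \<alpha>)) \<and> (\<forall>\<alpha> \<beta>. \<alpha> \<le> \<beta> \<longrightarrow> \<psi> \<alpha> \<beta> (s \<beta>) = s \<alpha>)}"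
  by (auto simp: inverse_limit_def PiE_iff)

lemma topspace_state_limit:
  "topspace (state_limit S \<psi>) =
     {s. (\<forall>\<alpha>. s \<alpha> \<in> S \<alpha>) \<and> (\<forall>\<alpha> \<beta>. \<alpha> \<le> \<beta> \<longrightarrow> \<psi> \<alpha> \<beta> (s \<beta>) = s \<alpha>)}"
  by (simp add: state_limit_def topspace_inverse_limit)

lemma state_limit_refine:
  assumes "x \<in> topspace (state_limit S \<psi>)" "y \<in> topspace (state_limit S \<psi>)"
    and "\<alpha> \<le> \<beta>" "x \<beta> = y \<beta>"
  shows "x \<alpha> = y \<alpha>"
  using assms unfolding topspace_state_limit by (metis (mono_tags, lifting) mem_Collect_eq)

lemma continuous_map_state_limit_component:
  "continuous_map (state_limit S \<psi>) (discrete_topology (S \<alpha>)) (\<lambda>x. x \<alpha>)"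
  unfolding state_limit_def inverse_limit_def
  by (intro continuous_map_from_subtopology continuous_map_product_projection) simp

text \<open>A basic open set restricts finitely many coordinates, but a coordinate of higher index
  determines all lower ones, so a single coordinate suffices.\<close>

lemma openin_state_limit_iff:
  "openin (state_limit S \<psi>) U \<longleftrightarrow>
     U \<subseteq> topspace (state_limit S \<psi>) \<and>
     (\<forall>x\<in>U. \<exists>N. \<forall>y\<in>topspace (state_limit S \<psi>). y N = x N \<longrightarrow> y \<in> U)"
  (is "?L \<longleftrightarrow> ?R")
proof
  assume L: ?L
  define C where "C = {s. \<forall>\<alpha> \<beta>. \<alpha> \<le> \<beta> \<longrightarrow> \<psi> \<alpha> \<beta> (s \<beta>) = s \<alpha>}"
  obtain V where V: "openin (product_topology (\<lambda>\<alpha>. discrete_topology (S \<alpha>)) UNIV) V" "U = V \<inter> C"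
    using L by (auto simp: state_limit_def inverse_limit_def C_def openin_subtopology)
  have "\<exists>N. \<forall>y\<in>topspace (state_limit S \<psi>). y N = x N \<longrightarrow> y \<in> U" if x: "x \<in> U" for x
  proof -
    have xt: "x \<in> topspace (state_limit S \<psi>)" using x openin_subset[OF L] by blast
    obtain B where B: "finite {i. B i \<noteq> S i}" "x \<in> Pi\<^sub>E UNIV B" "Pi\<^sub>E UNIV B \<subseteq> V"
      using V x unfolding openin_product_topology_alt by auto
    define N where "N = Max (insert 0 {i. B i \<noteq> S i})"
    have "y \<in> U" if y: "y \<in> topspace (state_limit S \<psi>)" and eq: "y N = x N" for y
    proof -
      have "y i \<in> B i" for i
      proof (cases "B i = S i")
        case True
        then show ?thesis using y by (simp add: topspace_state_limit)
      next
        case False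
        then have "i \<le> N" using B(1) by (auto simp: N_def)
        then have "y i = x i" using state_limit_refine[OF y xt _ eq] by blast
        then show ?thesis using B(2) by (auto simp: PiE_iff)
      qed
      then have "y \<in> V" using B(3) by (auto simp: PiE_iff)
      then show ?thesis using y V(2) by (auto simp: topspace_state_limit C_def)
    qed
    then show ?thesis by blast
  qed
  then show ?R using openin_subset[OF L] by blast
next
  assume R: ?R
  show ?L
  proof (subst openin_subopen, intro ballI)
    fix x assume x: "x \<in> U"
    then obtain N where N: "\<And>y. y \<in> topspace (state_limit S \<psi>) \<Longrightarrow> y N = x N \<Longrightarrow> y \<in> U"
      using R by blast
    have xt: "x \<in> topspace (state_limit S \<psi>)" using R x by blast
    have "openin (state_limit S \<psi>) {y \<in> topspace (state_limit S \<psi>). y N \<in> {x N}}"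
      using xt by (intro openin_continuous_map_preimage[OF continuous_map_state_limit_component])
        (auto simp: topspace_state_limit)
    then show "\<exists>T. openin (state_limit S \<psi>) T \<and> x \<in> T \<and> T \<subseteq> U"
      using N xt by (intro exI[of _ "{y \<in> topspace (state_limit S \<psi>). y N \<in> {x N}}"]) auto
  qed
qed

lemma compact_space_state_limit:
  assumes "\<And>\<alpha>. finite (S \<alpha>)"
  shows "compact_space (state_limit S \<psi>)"
proof -
  define P where "P = product_topology (\<lambda>\<alpha>. discrete_topology (S \<alpha>)) UNIV"
  have "closedin P {s \<in> topspace P. \<psi> \<alpha> \<beta> (s \<beta>) = s \<alpha>}" for \<alpha> \<beta>
  proof (rule closedin_continuous_maps_eq)
    \<comment> \<open>The maps \<psi> are arbitrary functions here and may leave the sets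
      \<open>S \<alpha>\<close>, so both sides of the equation are compared in the discrete space on
      the whole type.\<close>
    show "Hausdorff_space (discrete_topology (UNIV :: 'a set))" by simp
    have proj: "continuous_map P (discrete_topology (S \<gamma>)) (\<lambda>s. s \<gamma>)" for \<gamma>
      unfolding P_def by (intro continuous_map_product_projection) simp
    show "continuous_map P (discrete_topology UNIV) (\<lambda>s. \<psi> \<alpha> \<beta> (s \<beta>))"
      using continuous_map_compose[OF proj, of _ _ "\<psi> \<alpha> \<beta>"] by (simp add: o_def)
    show "continuous_map P (discrete_topology UNIV) (\<lambda>s. s \<alpha>)"
      using continuous_map_compose[OF proj, of _ _ "\<lambda>a. a"] by (simp add: o_def)
  qed
  then have "closedin P (\<Inter>(\<alpha>, \<beta>)\<in>{(\<alpha>, \<beta>). \<alpha> \<le> \<beta>}. {s \<in> topspace P. \<psi> \<alpha> \<beta> (s \<beta>) = s \<alpha>})"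
    by (intro closedin_Inter) auto
  moreover have "compact_space P" unfolding P_def compact_space_product_topology
    using assms by (simp add: compact_space_discrete_topology)
  ultimately have "compactin P (\<Inter>(\<alpha>, \<beta>)\<in>{(\<alpha>, \<beta>). \<alpha> \<le> \<beta>}. {s \<in> topspace P. \<psi> \<alpha> \<beta> (s \<beta>) = s \<alpha>})"
    by (rule closedin_compact_space[rotated])
  moreover have "(\<Inter>(\<alpha>, \<beta>)\<in>{(\<alpha>, \<beta>). \<alpha> \<le> \<beta>}. {s \<in> topspace P. \<psi> \<alpha> \<beta> (s \<beta>) = s \<alpha>}) =
      topspace P \<inter> {s. \<forall>\<alpha> \<beta>. \<alpha> \<le> \<beta> \<longrightarrow> \<psi> \<alpha> \<beta> (s \<beta>) = s \<alpha>}"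
    by auto
  ultimately have "compactin P (topspace P \<inter> {s. \<forall>\<alpha> \<beta>. \<alpha> \<le> \<beta> \<longrightarrow> \<psi> \<alpha> \<beta> (s \<beta>) = s \<alpha>})"
    by (simp only:)
  from compact_space_subtopology[OF this]
  have "compact_space (subtopology P {s. \<forall>\<alpha> \<beta>. \<alpha> \<le> \<beta> \<longrightarrow> \<psi> \<alpha> \<beta> (s \<beta>) = s \<alpha>})"
    by (simp only: subtopology_restrict)
  then show ?thesis by (simp add: state_limit_def inverse_limit_def P_def)
qed

lemma Hausdorff_space_inverse_limit:
  assumes "\<And>\<alpha>. Hausdorff_space (X \<alpha>)"
  shows "Hausdorff_space (inverse_limit X \<psi>)"
  unfolding inverse_limit_def
  by (intro Hausdorff_space_subtopology) (simp add: Hausdorff_space_product_topology assms)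

lemma Hausdorff_space_state_limit: "Hausdorff_space (state_limit S \<psi>)"
  unfolding state_limit_def by (rule Hausdorff_space_inverse_limit) simp

lemma continuous_map_state_limitI:
  assumes "\<And>\<alpha>. continuous_map X (discrete_topology (S \<alpha>)) (\<lambda>x. f x \<alpha>)"
    and "f ` topspace X \<subseteq> topspace (state_limit S \<psi>)"
  shows "continuous_map X (state_limit S \<psi>) f"
  using assms
  by (auto simp: state_limit_def inverse_limit_def continuous_map_in_subtopology
      continuous_map_componentwise_UNIV topspace_inverse_limit)

text \<open>The usual ultrametric given by the first differing coordinate. It provides the metric
  that \<open>equicontinuous_system\<close> requires and makes adding one an isometry.\<close>

definition tower_dist :: "(nat \<Rightarrow> 'a) \<Rightarrow> (nat \<Rightarrow> 'a) \<Rightarrow> real" where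
  "tower_dist x y = (if x = y then 0 else inverse (real (Suc (LEAST n. x n \<noteq> y n))))"

lemma tower_dist_ge:
  assumes "x k \<noteq> y k"
  shows "inverse (real (Suc k)) \<le> tower_dist x y"
proof -
  have "(LEAST n. x n \<noteq> y n) \<le> k" using assms by (rule Least_le)
  then show ?thesis using assms by (auto simp: tower_dist_def intro!: le_imp_inverse_le)
qed

lemma tower_dist_eq:
  assumes "x \<noteq> y"
  obtains k where "x k \<noteq> y k" "tower_dist x y = inverse (real (Suc k))"
proof -
  have "\<exists>k. x k \<noteq> y k" using assms by auto
  then have "x (LEAST n. x n \<noteq> y n) \<noteq> y (LEAST n. x n \<noteq> y n)" by (rule LeastI_ex)
  then show thesis using that assms by (simp add: tower_dist_def)
qed

lemma Metric_space_tower_dist: "Metric_space M tower_dist"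
proof
  show "0 \<le> tower_dist x y" for x y :: "nat \<Rightarrow> 'a" by (simp add: tower_dist_def)
  show "tower_dist x y = tower_dist y x" for x y :: "nat \<Rightarrow> 'a"
    by (simp add: tower_dist_def eq_commute)
  show "(tower_dist x y = 0) = (x = y)" for x y :: "nat \<Rightarrow> 'a" by (simp add: tower_dist_def)
  show "tower_dist x z \<le> tower_dist x y + tower_dist y z" for x y z :: "nat \<Rightarrow> 'a"
  proof (cases "x = z")
    case False
    then obtain k where k: "x k \<noteq> z k" "tower_dist x z = inverse (real (Suc k))"
      by (rule tower_dist_eq)
    have "x k \<noteq> y k \<or> y k \<noteq> z k" using k(1) by metis
    then have "tower_dist x z \<le> tower_dist x y \<or> tower_dist x z \<le> tower_dist y z"
      unfolding k(2) using tower_dist_ge[of x k y] tower_dist_ge[of y k z] by blast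
    moreover have "0 \<le> tower_dist x y" "0 \<le> tower_dist y z" by (simp_all add: tower_dist_def)
    ultimately show ?thesis by linarith
  qed (simp add: tower_dist_def)
qed

lemma mtopology_tower_dist:
  "Metric_space.mtopology (topspace (state_limit S \<psi>)) tower_dist = state_limit S \<psi>"
proof -
  define M where "M = topspace (state_limit S \<psi>)"
  interpret Metric_space M tower_dist by (rule Metric_space_tower_dist)
  have "(\<exists>r>0. mball x r \<subseteq> U) \<longleftrightarrow> (\<exists>N. \<forall>y\<in>M. y N = x N \<longrightarrow> y \<in> U)" if x: "x \<in> M" for x U
  proof
    assume "\<exists>r>0. mball x r \<subseteq> U"
    then obtain r where r: "r > 0" "mball x r \<subseteq> U" by blast
    obtain N where N: "inverse (real (Suc N)) < r" using reals_Archimedean[OF r(1)] by blast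
    have "y \<in> U" if y: "y \<in> M" "y N = x N" for y
    proof -
      have "tower_dist x y < r"
      proof (cases "x = y")
        case False
        then obtain k where k: "x k \<noteq> y k" "tower_dist x y = inverse (real (Suc k))"
          by (rule tower_dist_eq)
        have "N < k"
          using k(1) state_limit_refine[of y S \<psi> x k N] x y by (auto simp: M_def not_less[symmetric])
        then have "inverse (real (Suc k)) < inverse (real (Suc N))" by simp
        then show ?thesis unfolding k(2) using N by (rule order.strict_trans)
      qed (use r in \<open>simp add: tower_dist_def\<close>)
      then show ?thesis using r(2) x y(1) by (auto simp: mball_def)
    qed
    then show "\<exists>N. \<forall>y\<in>M. y N = x N \<longrightarrow> y \<in> U" by blast
  next
    assume "\<exists>N. \<forall>y\<in>M. y N = x N \<longrightarrow> y \<in> U"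
    then obtain N where N: "\<And>y. y \<in> M \<Longrightarrow> y N = x N \<Longrightarrow> y \<in> U" by blast
    have "y \<in> U" if "y \<in> mball x (inverse (real (Suc N)))" for y
    proof -
      have "x N = y N" using that tower_dist_ge[of x N y] by (force simp: mball_def)
      then show ?thesis using that N[of y] by (auto simp: mball_def)
    qed
    then show "\<exists>r>0. mball x r \<subseteq> U" by (intro exI[of _ "inverse (real (Suc N))"]) auto
  qed
  then have "(\<forall>x. x \<in> U \<longrightarrow> (\<exists>r>0. mball x r \<subseteq> U)) \<longleftrightarrow> (\<forall>x\<in>U. \<exists>N. \<forall>y\<in>M. y N = x N \<longrightarrow> y \<in> U)"
    if "U \<subseteq> M" for U
    using subsetD[OF that] unfolding Ball_def[of U] by simp
  then have "openin mtopology U \<longleftrightarrow> openin (state_limit S \<psi>) U" for U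
    unfolding openin_mtopology openin_state_limit_iff M_def[symmetric] by (intro conj_cong refl)
  then show ?thesis unfolding topology_eq M_def by blast
qed

section \<open>Odometers as isometric systems\<close>

lemma odometer_space_eq: "odometer_space s = state_limit (\<lambda>n. {0..<s n}) (\<lambda>m n x. x mod s m)"
  by (simp add: odometer_space_def state_limit_def)

lemma odometer_map_eq_iff:
  assumes "x \<in> topspace (odometer_space s)" "y \<in> topspace (odometer_space s)"
  shows "odometer_map s x n = odometer_map s y n \<longleftrightarrow> x n = y n"
proof -
  have "x n < s n" "y n < s n" using assms by (auto simp: odometer_space_eq topspace_state_limit)
  then show ?thesis
    unfolding odometer_map_def cong_def[symmetric] cong_add_rcancel_nat by (simp add: cong_def)
qed

lemma odometer_map_closed:
  assumes "\<And>m n. m \<le> n \<Longrightarrow> s m dvd s n" "x \<in> topspace (odometer_space s)"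
  shows "odometer_map s x \<in> topspace (odometer_space s)"
proof -
  have x: "x n < s n" "m \<le> n \<Longrightarrow> x n mod s m = x m" for m n
    using assms(2) by (auto simp: odometer_space_eq topspace_state_limit)
  have "(x n + 1) mod s n mod s m = (x m + 1) mod s m" if "m \<le> n" for m n
    using x(2)[OF that] assms(1)[OF that] by (metis mod_add_left_eq mod_mod_cancel)
  then show ?thesis
    using x(1) by (auto simp: odometer_space_eq topspace_state_limit odometer_map_def)
      (metis mod_less_divisor not_less_zero zero_less_iff_neq_zero)
qed

lemma continuous_odometer_map:
  assumes "\<And>m n. m \<le> n \<Longrightarrow> s m dvd s n"
  shows "continuous_map (odometer_space s) (odometer_space s) (odometer_map s)"
  unfolding continuous_map_def
proof (intro conjI allI impI)
  show "odometer_map s \<in> topspace (odometer_space s) \<rightarrow> topspace (odometer_space s)"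
    using odometer_map_closed[of s, OF assms] by blast
  fix U assume U: "openin (odometer_space s) U"
  show "openin (odometer_space s) {x \<in> topspace (odometer_space s). odometer_map s x \<in> U}"
    unfolding odometer_space_eq openin_state_limit_iff
    unfolding odometer_space_eq[symmetric]
  proof (intro conjI ballI)
    fix x assume x: "x \<in> {x \<in> topspace (odometer_space s). odometer_map s x \<in> U}"
    then obtain N where N: "\<forall>y\<in>topspace (odometer_space s). y N = odometer_map s x N \<longrightarrow> y \<in> U"
      using U unfolding odometer_space_eq openin_state_limit_iff by blast
    then show "\<exists>N. \<forall>y\<in>topspace (odometer_space s). y N = x N \<longrightarrow>
        y \<in> {x \<in> topspace (odometer_space s). odometer_map s x \<in> U}"
      using x odometer_map_eq_iff odometer_map_closed[of s, OF assms] by (intro exI[of _ N]) auto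
  qed auto
qed

text \<open>Adding one preserves equality and inequality in every coordinate, hence the first
  differing coordinate; all iterates are isometries.\<close>

lemma equicontinuous_odometer:
  assumes "\<And>m n. m \<le> n \<Longrightarrow> s m dvd s n"
  shows "equicontinuous_system (odometer_space s) (odometer_map s)"
proof -
  let ?O = "topspace (odometer_space s)"
  have orbit: "(odometer_map s ^^ n) x \<in> ?O" if "x \<in> ?O" for n x
    using that by (induction n) (auto intro: odometer_map_closed[of s, OF assms])
  have iso: "tower_dist ((odometer_map s ^^ n) x) ((odometer_map s ^^ n) y) = tower_dist x y"
    if "x \<in> ?O" "y \<in> ?O" for n x y
  proof (induction n)
    case (Suc n)
    have step: "odometer_map s a k = odometer_map s b k \<longleftrightarrow> a k = b k" if "a \<in> ?O" "b \<in> ?O" for a b k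
      using that by (rule odometer_map_eq_iff)
    have "tower_dist (odometer_map s a) (odometer_map s b) = tower_dist a b" if "a \<in> ?O" "b \<in> ?O" for a b
      using step[OF that] unfolding tower_dist_def fun_eq_iff by simp
    then show ?case using Suc orbit that by simp
  qed simp
  show ?thesis
    unfolding equicontinuous_system_def
  proof (intro conjI exI[of _ tower_dist] Metric_space_tower_dist continuous_odometer_map assms allI impI)
    show "compact_space (odometer_space s)"
      unfolding odometer_space_eq by (rule compact_space_state_limit) simp
    show "Metric_space.mtopology ?O tower_dist = odometer_space s"
      unfolding odometer_space_eq by (rule mtopology_tower_dist)
    show "\<exists>\<eta>>0. \<forall>x\<in>?O. \<forall>y\<in>?O. tower_dist x y < \<eta> \<longrightarrow>
        (\<forall>n. tower_dist ((odometer_map s ^^ n) x) ((odometer_map s ^^ n) y) < \<epsilon>)" if "\<epsilon> > 0" for \<epsilon>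
      using that iso by (intro exI[of _ \<epsilon>]) auto
  qed
qed

lemma shift_power: "(shift ^^ n) x = (\<lambda>i. x (n + i))"
  by (induction n arbitrary: x) (auto simp: shift_def funpow_swap1)

section \<open>The subshift over an inverse limit\<close>

text \<open>The analogue of \<open>near\<close> for arbitrary points. With one parameter for level
  and length, the resulting cylinders in the limit are nested or disjoint.\<close>

definition agree :: "nat \<Rightarrow> (nat \<Rightarrow> nat \<Rightarrow> 's) \<Rightarrow> (nat \<Rightarrow> nat \<Rightarrow> 's) \<Rightarrow> bool" where
  "agree W x y \<longleftrightarrow> (\<forall>i<W. x i W = y i W)"

lemma agree_sym: "agree W x y \<Longrightarrow> agree W y x"
  by (simp add: agree_def)

lemma agree_trans: "agree W x y \<Longrightarrow> agree W y z \<Longrightarrow> agree W x z"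
  by (simp add: agree_def)

lemma agree_mono:
  assumes "\<And>n. x n \<in> topspace (state_limit S \<psi>)" "\<And>n. y n \<in> topspace (state_limit S \<psi>)"
    and "agree W x y" "V \<le> W"
  shows "agree V x y"
  unfolding agree_def
proof (intro allI impI)
  fix i assume "i < V"
  then have "x i W = y i W" using assms(3,4) by (simp add: agree_def)
  then show "x i V = y i V" by (rule state_limit_refine[OF assms(1,2,4)])
qed

lemma topspace_seq_space: "topspace (seq_space A) = {x. \<forall>n. x n \<in> topspace A}"
  by (auto simp: seq_space_def PiE_iff)

lemma Hausdorff_space_seq_space: "Hausdorff_space A \<Longrightarrow> Hausdorff_space (seq_space A)"
  by (simp add: seq_space_def Hausdorff_space_product_topology)

lemma topspace_subshift:
  "topspace (subshift A x) = seq_space A closure_of {(shift ^^ n) x | n. True}"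
  by (simp add: subshift_def closure_of_subset_topspace Int_absorb1)

lemma continuous_map_shift_subshift:
  "continuous_map (subshift A x) (subshift A x) shift"
proof -
  have c: "continuous_map (seq_space A) (seq_space A) shift"
    unfolding seq_space_def continuous_map_componentwise_UNIV shift_def
    by (intro allI continuous_map_product_projection) simp
  have "shift ` {(shift ^^ n) x | n. True} \<subseteq> {(shift ^^ n) x | n. True}"
    by (auto intro: exI[of _ "Suc _"])
  then have "shift ` C \<subseteq> C" if "C = seq_space A closure_of {(shift ^^ n) x | n. True}" for C
    unfolding that by (rule order_trans[OF continuous_map_image_closure_subset[OF c] closure_of_mono])
  then show ?thesis
    unfolding subshift_def
    by (intro continuous_map_into_subtopology continuous_map_from_subtopology c)
      (auto simp: closure_of_subset_topspace)
qed

text \<open>A neighbourhood restricts finitely many positions, each through one level;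
  \<open>W\<close> exceeds all those positions and levels.\<close>

lemma openin_seq_space_window:
  assumes T: "openin (seq_space (state_limit S \<psi>)) T" and x: "x \<in> T"
  obtains W where "\<And>y. y \<in> topspace (seq_space (state_limit S \<psi>)) \<Longrightarrow> agree W x y \<Longrightarrow> y \<in> T"
proof -
  let ?A = "state_limit S \<psi>"
  have xt: "x n \<in> topspace ?A" for n
    using openin_subset[OF T] x by (auto simp: topspace_seq_space)
  obtain B where B: "finite {i. B i \<noteq> topspace ?A}" "\<And>i. openin ?A (B i)" "x \<in> Pi\<^sub>E UNIV B" "Pi\<^sub>E UNIV B \<subseteq> T"
    using T x unfolding seq_space_def openin_product_topology_alt by auto
  have "\<exists>N. \<forall>b\<in>topspace ?A. b N = x i N \<longrightarrow> b \<in> B i" for i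
    using B(2)[of i] B(3) unfolding openin_state_limit_iff by (auto simp: PiE_iff)
  then obtain N where N: "\<And>i b. b \<in> topspace ?A \<Longrightarrow> b (N i) = x i (N i) \<Longrightarrow> b \<in> B i" by metis
  define F where "F = {i. B i \<noteq> topspace ?A}"
  define W where "W = Suc (Max (insert 0 (F \<union> N ` F)))"
  have "y \<in> T" if y: "y \<in> topspace (seq_space ?A)" and agr: "agree W x y" for y
  proof -
    have yt: "y n \<in> topspace ?A" for n using y by (simp add: topspace_seq_space)
    have "y i \<in> B i" for i
    proof (cases "i \<in> F")
      case True
      then have "i \<le> Max (insert 0 (F \<union> N ` F))" "N i \<le> Max (insert 0 (F \<union> N ` F))"
        using B(1) by (auto simp: F_def intro!: Max_ge)
      then have "i < W" "N i \<le> W" by (auto simp: W_def)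
      then have "y i W = x i W" using agr by (simp add: agree_def)
      then have "y i (N i) = x i (N i)" by (rule state_limit_refine[OF yt xt \<open>N i \<le> W\<close>])
      then show ?thesis using N yt by blast
    next
      case False
      then show ?thesis using yt by (simp add: F_def)
    qed
    then show ?thesis using B(4) by (auto simp: PiE_iff)
  qed
  then show thesis using that by blast
qed

lemma openin_seq_space_agree:
  "openin (seq_space (state_limit S \<psi>)) {y \<in> topspace (seq_space (state_limit S \<psi>)). agree W x y}"
proof -
  let ?Q = "seq_space (state_limit S \<psi>)"
  have "openin ?Q {y \<in> topspace ?Q. y i W \<in> {x i W} \<inter> S W}" for i
  proof (rule openin_continuous_map_preimage)
    have "continuous_map ?Q (state_limit S \<psi>) (\<lambda>y. y i)"
      unfolding seq_space_def by (intro continuous_map_product_projection) simp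
    from continuous_map_compose[OF this continuous_map_state_limit_component[of S \<psi> W]]
    show "continuous_map ?Q (discrete_topology (S W)) (\<lambda>y. y i W)" by (simp only: o_def)
  qed auto
  then have "openin ?Q ((\<Inter>i\<in>{..<W}. {y \<in> topspace ?Q. y i W \<in> {x i W} \<inter> S W}) \<inter> topspace ?Q)"
    by (intro openin_INT) auto
  moreover have "(\<Inter>i\<in>{..<W}. {y \<in> topspace ?Q. y i W \<in> {x i W} \<inter> S W}) \<inter> topspace ?Q =
      {y \<in> topspace ?Q. agree W x y}"
    by (auto simp: agree_def topspace_seq_space topspace_state_limit)
  ultimately show ?thesis by simp
qed

locale limit_subshift =
  fixes p :: nat and S :: "nat \<Rightarrow> 's set" and \<psi> :: "nat \<Rightarrow> nat \<Rightarrow> 's \<Rightarrow> 's"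
    and u :: "nat \<Rightarrow> nat \<Rightarrow> 's"
  assumes finite_S: "finite (S \<alpha>)"
    and u_state: "u n \<in> topspace (state_limit S \<psi>)"
    and u_levels: "subst_fixed_point p (level \<alpha> u)"
begin

sublocale profinite_fixed_point p u
  by (rule profinite_fixed_point.intro[OF u_levels]) (rule state_limit_refine[OF u_state u_state])

abbreviation A where "A \<equiv> state_limit S \<psi>"
abbreviation X where "X \<equiv> subshift A u"

lemma agree_orbit: "agree W ((shift ^^ n) u) ((shift ^^ m) u) \<longleftrightarrow> near W n m"
  by (simp add: agree_def near_iff shift_power)

lemma X_state: "x \<in> topspace X \<Longrightarrow> x n \<in> topspace A"
  using closure_of_subset_topspace[of "seq_space A"] by (auto simp: topspace_subshift topspace_seq_space)

lemma X_agree_mono: "x \<in> topspace X \<Longrightarrow> y \<in> topspace X \<Longrightarrow> agree W x y \<Longrightarrow> V \<le> W \<Longrightarrow> agree V x y"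
  using agree_mono[OF X_state X_state] .

lemma in_X_iff:
  "x \<in> topspace X \<longleftrightarrow> (\<forall>n. x n \<in> topspace A) \<and> (\<forall>W. \<exists>n. agree W x ((shift ^^ n) u))"
proof (intro iffI conjI allI)
  assume x: "x \<in> topspace X"
  then show "x n \<in> topspace A" for n by (rule X_state)
  then have mem: "x \<in> {y \<in> topspace (seq_space A). agree W x y}" for W
    by (simp add: topspace_seq_space agree_def)
  fix W
  from x have "x \<in> seq_space A closure_of {(shift ^^ n) u | n. True}" by (simp only: topspace_subshift)
  then have "\<exists>y. y \<in> {(shift ^^ n) u | n. True} \<and> y \<in> {y \<in> topspace (seq_space A). agree W x y}"
    using mem[of W] openin_seq_space_agree[of S \<psi> W x] by (simp only: in_closure_of)
  then show "\<exists>n. agree W x ((shift ^^ n) u)" by auto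
next
  assume x: "(\<forall>n. x n \<in> topspace A) \<and> (\<forall>W. \<exists>n. agree W x ((shift ^^ n) u))"
  have "\<exists>y\<in>{(shift ^^ n) u | n. True}. y \<in> T" if T: "openin (seq_space A) T" "x \<in> T" for T
  proof -
    obtain W where W: "\<And>y. y \<in> topspace (seq_space A) \<Longrightarrow> agree W x y \<Longrightarrow> y \<in> T"
      using openin_seq_space_window[OF T] by blast
    obtain n where "agree W x ((shift ^^ n) u)" using x by blast
    then have "(shift ^^ n) u \<in> T" using W u_state by (simp add: topspace_seq_space shift_power)
    then show ?thesis by blast
  qed
  then show "x \<in> topspace X" using x by (auto simp: topspace_subshift in_closure_of topspace_seq_space)
qed

lemma orbit_in_X: "(shift ^^ n) u \<in> topspace X"
  unfolding in_X_iff by (auto simp: shift_power u_state agree_def)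

lemma u_in_X: "u \<in> topspace X"
  using orbit_in_X[of 0] by simp

lemma shift_in_X: "x \<in> topspace X \<Longrightarrow> shift x \<in> topspace X"
  using continuous_map_shift_subshift[of A u] by (auto simp: continuous_map_def)

lemma X_approx: "x \<in> topspace X \<Longrightarrow> \<exists>n. agree W x ((shift ^^ n) u)"
  by (simp add: in_X_iff)

lemma agree_shift:
  assumes "x \<in> topspace X" "y \<in> topspace X" "agree (W + n) x y"
  shows "agree W ((shift ^^ n) x) ((shift ^^ n) y)"
  unfolding agree_def shift_power
proof (intro allI impI)
  fix i assume "i < W"
  then have "x (n + i) (W + n) = y (n + i) (W + n)" using assms(3) by (simp add: agree_def)
  then show "x (n + i) W = y (n + i) W"
    by (rule state_limit_refine[OF X_state[OF assms(1)] X_state[OF assms(2)], rotated]) simp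
qed

lemma openin_X_agree: "openin X {y \<in> topspace X. agree W x y}"
proof -
  have "{y \<in> topspace X. agree W x y} = {y \<in> topspace (seq_space A). agree W x y} \<inter> topspace X"
    using X_state by (auto simp: topspace_seq_space)
  then show ?thesis
    using openin_seq_space_agree[of S \<psi> W x] unfolding subshift_def topspace_subshift openin_subtopology
    by (auto simp: topspace_subtopology closure_of_subset_topspace Int_absorb1)
qed

lemma openin_X_window:
  assumes "openin X T" "x \<in> T"
  obtains W where "\<And>y. y \<in> topspace X \<Longrightarrow> agree W x y \<Longrightarrow> y \<in> T"
proof -
  obtain T' where T': "openin (seq_space A) T'" "T = T' \<inter> topspace X"
    using assms(1) unfolding subshift_def topspace_subshift openin_subtopology
    by (auto simp: topspace_subtopology closure_of_subset_topspace Int_absorb1)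
  then obtain W where "\<And>y. y \<in> topspace (seq_space A) \<Longrightarrow> agree W x y \<Longrightarrow> y \<in> T'"
    using openin_seq_space_window[OF T'(1), of x] assms(2) by blast
  then show thesis using that[of W] T'(2) X_state by (auto simp: topspace_seq_space)
qed

lemma continuous_map_X_if_locally_constant:
  assumes "\<And>x. x \<in> topspace X \<Longrightarrow> f x \<in> topspace Y"
    and "\<And>x y. x \<in> topspace X \<Longrightarrow> y \<in> topspace X \<Longrightarrow> agree W x y \<Longrightarrow> f x = f y"
  shows "continuous_map X Y f"
  unfolding continuous_map_def
proof (intro conjI allI impI)
  show "f \<in> topspace X \<rightarrow> topspace Y" using assms(1) by blast
  fix U assume "openin Y U"
  show "openin X {x \<in> topspace X. f x \<in> U}"
  proof (subst openin_subopen, intro ballI)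
    fix x assume x: "x \<in> {x \<in> topspace X. f x \<in> U}"
    have "f y \<in> U" if "y \<in> topspace X" "agree W x y" for y using assms(2)[of x y] x that by simp
    then show "\<exists>T. openin X T \<and> x \<in> T \<and> T \<subseteq> {x \<in> topspace X. f x \<in> U}"
      using x openin_X_agree[of W x]
      by (intro exI[of _ "{y \<in> topspace X. agree W x y}"]) (auto simp: agree_def)
  qed
qed

lemma compact_space_X: "compact_space X"
proof -
  have "compact_space A" using finite_S by (rule compact_space_state_limit)
  then have "compact_space (seq_space A)"
    by (simp add: seq_space_def compact_space_product_topology)
  then have "compactin (seq_space A) (seq_space A closure_of {(shift ^^ n) u | n. True})"
    by (rule closedin_compact_space) simp
  then show ?thesis unfolding subshift_def by (rule compact_space_subtopology)
qed

text \<open>The Heine-Cantor theorem with cylinders in place of a metric on the subshift: finitely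
  many of them cover, and the largest parameter among them works everywhere.\<close>

lemma X_uniformly_continuous:
  assumes M: "Metric_space M d" and f: "continuous_map X (Metric_space.mtopology M d) f" and "e > 0"
  obtains W where "\<And>x y. x \<in> topspace X \<Longrightarrow> y \<in> topspace X \<Longrightarrow> agree W x y \<Longrightarrow> d (f x) (f y) < e"
proof -
  interpret Metric_space M d by (rule M)
  have fM: "f x \<in> M" if "x \<in> topspace X" for x
    using f that by (auto simp: continuous_map_def)
  have "\<exists>W. \<forall>y\<in>topspace X. agree W x y \<longrightarrow> d (f x) (f y) < e / 2" if x: "x \<in> topspace X" for x
  proof -
    have "openin X {y \<in> topspace X. f y \<in> mball (f x) (e / 2)}"
      by (intro openin_continuous_map_preimage[OF f] openin_mball)
    moreover have "x \<in> {y \<in> topspace X. f y \<in> mball (f x) (e / 2)}"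
      using x fM \<open>e > 0\<close> by simp
    ultimately obtain W where "\<And>y. y \<in> topspace X \<Longrightarrow> agree W x y \<Longrightarrow>
        y \<in> {y \<in> topspace X. f y \<in> mball (f x) (e / 2)}"
      using openin_X_window by blast
    then show ?thesis by (intro exI[of _ W]) auto
  qed
  then obtain w where w: "\<And>x y. x \<in> topspace X \<Longrightarrow> y \<in> topspace X \<Longrightarrow> agree (w x) x y \<Longrightarrow>
      d (f x) (f y) < e / 2" by metis
  define C where "C x = {y \<in> topspace X. agree (w x) x y}" for x
  have op: "\<forall>U\<in>C ` topspace X. openin X U" unfolding C_def using openin_X_agree by blast
  have cov: "topspace X \<subseteq> \<Union>(C ` topspace X)" by (auto simp: C_def agree_def)
  obtain \<F> where \<F>: "finite \<F>" "\<F> \<subseteq> C ` topspace X" "topspace X \<subseteq> \<Union>\<F>"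
    using compact_space_X[unfolded compact_space_alt, rule_format, of "C ` topspace X"] op cov by blast
  obtain F where F: "F \<subseteq> topspace X" "finite F" "\<F> = C ` F"
    using finite_subset_image[OF \<F>(1,2)] by blast
  define W where "W = Max (insert 0 (w ` F))"
  have "d (f x) (f y) < e" if xy: "x \<in> topspace X" "y \<in> topspace X" "agree W x y" for x y
  proof -
    obtain z where z: "z \<in> F" "x \<in> C z" using \<F>(3) F(3) xy(1) by blast
    then have zx: "agree (w z) z x" by (simp add: C_def)
    have "w z \<le> W" unfolding W_def using F(2) z(1) by (intro Max_ge) auto
    then have "agree (w z) z y" using X_agree_mono[OF xy] agree_trans[OF zx] by blast
    then have "d (f z) (f x) < e / 2" "d (f z) (f y) < e / 2" using w z(1) F(1) zx xy by blast+
    moreover have "d (f x) (f y) \<le> d (f x) (f z) + d (f z) (f y)"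
      using xy z F fM by (intro triangle) auto
    moreover have "d (f x) (f z) = d (f z) (f x)" by (rule commute)
    ultimately show ?thesis by linarith
  qed
  then show thesis using that by blast
qed

section \<open>Positions modulo q and the projection to the odometer\<close>

definition window_of :: "nat \<Rightarrow> nat" where
  "window_of q = (SOME W. \<forall>n m. near W n m \<longrightarrow> [n = m] (mod q))"

text \<open>For a modulus \<open>q\<close> this is the continuous extension of
  \<open>n mod q\<close> from the orbit of \<open>u\<close> to the subshift; any orbit point in the
  same cylinder gives the same residue.\<close>

definition res :: "nat \<Rightarrow> (nat \<Rightarrow> nat \<Rightarrow> 's) \<Rightarrow> nat" where
  "res q x = (SOME n. agree (window_of q) x ((shift ^^ n) u)) mod q"

lemma res_eq:
  assumes q: "q \<in> moduli" and x: "agree (window_of q) x ((shift ^^ n) u)"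
  shows "res q x = n mod q"
proof -
  have "\<exists>W. \<forall>n m. near W n m \<longrightarrow> [n = m] (mod q)" using moduli_near[OF q] by metis
  then have W: "\<forall>n m. near (window_of q) n m \<longrightarrow> [n = m] (mod q)"
    unfolding window_of_def by (rule someI_ex)
  define m where "m = (SOME n. agree (window_of q) x ((shift ^^ n) u))"
  have "agree (window_of q) x ((shift ^^ m) u)" unfolding m_def using x by (rule someI)
  then have "near (window_of q) m n"
    using x agree_sym agree_trans unfolding agree_orbit[symmetric] by blast
  then show ?thesis using W by (simp add: res_def m_def[symmetric] cong_def)
qed

lemma res_locally_constant:
  assumes "q \<in> moduli" "x \<in> topspace X" "agree (window_of q) x y"
  shows "res q x = res q y"
proof -
  obtain n where n: "agree (window_of q) x ((shift ^^ n) u)" using X_approx assms by blast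
  then have "agree (window_of q) y ((shift ^^ n) u)" using assms(3) agree_sym agree_trans by blast
  then show ?thesis using res_eq[OF assms(1)] n by metis
qed

lemma X_approx_res:
  assumes "x \<in> topspace X" "finite F" "F \<subseteq> moduli"
  shows "\<exists>n. agree W x ((shift ^^ n) u) \<and> (\<forall>q\<in>F. res q x = n mod q)"
proof -
  define V where "V = Max (insert W (window_of ` F))"
  obtain n where n: "agree V x ((shift ^^ n) u)" using X_approx assms by blast
  have "agree W' x ((shift ^^ n) u)" if "W' \<in> insert W (window_of ` F)" for W'
    using X_agree_mono[OF assms(1) orbit_in_X n] Max_ge[of "insert W (window_of ` F)" W'] assms(2) that
    by (simp add: V_def)
  then show ?thesis using res_eq assms(3) by (intro exI[of _ n]) blast
qed

lemma res_shift:
  assumes q: "q \<in> moduli" and x: "x \<in> topspace X"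
  shows "res q (shift x) = (res q x + 1) mod q"
proof -
  obtain n where n: "agree (window_of q + 1) x ((shift ^^ n) u)" "res q x = n mod q"
    using X_approx_res[OF x, of "{q}" "window_of q + 1"] q by auto
  have "agree (window_of q) (shift x) ((shift ^^ Suc n) u)"
    using agree_shift[OF x orbit_in_X n(1)] by simp
  then have "res q (shift x) = Suc n mod q" by (rule res_eq[OF q])
  then show ?thesis using n(2) by (simp add: mod_Suc_eq)
qed

lemma root_continuous_eigenvalue:
  assumes q: "q \<in> moduli" and l: "l ^ q = (1 :: complex)"
  shows "continuous_eigenvalue X shift l"
  unfolding continuous_eigenvalue_def
proof (intro exI[of _ "\<lambda>x. l ^ res q x"] conjI)
  show "continuous_map X euclidean (\<lambda>x. l ^ res q x)"
    using res_locally_constant[OF q]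
    by (intro continuous_map_X_if_locally_constant[where W = "window_of q"]) auto
  have "q > 0" using q by (simp add: moduli_def)
  then have "l \<noteq> 0" using l by (metis power_0_left zero_neq_one not_gr_zero)
  then show "\<exists>x\<in>topspace X. l ^ res q x \<noteq> 0" using u_in_X by auto
  have "l ^ (n mod q) = l ^ n" for n
    using l by (metis mult_div_mod_eq power_add power_mult power_one mult_1)
  then show "\<forall>x\<in>topspace X. l ^ res q (shift x) = l * l ^ res q x"
    using res_shift[OF q] by simp
qed

definition odometer_projection :: "(nat \<Rightarrow> nat \<Rightarrow> 's) \<Rightarrow> nat \<Rightarrow> nat" where
  "odometer_projection x = (\<lambda>i. res (modulus i) x)"

text \<open>Surjectivity: the image is compact, hence closed, and it is dense since the orbit point
  at time \<open>z N\<close> has coordinate \<open>z N\<close> at index \<open>N\<close>.\<close>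

lemma odometer_projection_factor_map:
  "factor_map X shift (odometer_space modulus) (odometer_map modulus) odometer_projection"
  unfolding factor_map_def
proof (intro conjI ballI)
  let ?O = "odometer_space modulus"
  have into: "odometer_projection x \<in> topspace ?O" if x: "x \<in> topspace X" for x
    unfolding odometer_space_eq topspace_state_limit
  proof (intro CollectI conjI allI impI)
    show "odometer_projection x \<alpha> \<in> {0..<modulus \<alpha>}" for \<alpha>
      using modulus_pos by (simp add: odometer_projection_def res_def)
    fix \<alpha> \<beta> :: nat assume le: "\<alpha> \<le> \<beta>"
    obtain n where "res (modulus \<alpha>) x = n mod modulus \<alpha>" "res (modulus \<beta>) x = n mod modulus \<beta>"
      using X_approx_res[OF x, of "{modulus \<alpha>, modulus \<beta>}"] modulus_in_moduli by auto
    then show "odometer_projection x \<beta> mod modulus \<alpha> = odometer_projection x \<alpha>"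
      using modulus_dvd[OF le] by (simp add: odometer_projection_def mod_mod_cancel)
  qed
  show cont: "continuous_map X ?O odometer_projection"
    unfolding odometer_space_eq
  proof (rule continuous_map_state_limitI)
    show "odometer_projection ` topspace X \<subseteq> topspace (state_limit (\<lambda>n. {0..<modulus n}) (\<lambda>m n x. x mod modulus m))"
      using into by (auto simp: odometer_space_eq)
    show "continuous_map X (discrete_topology {0..<modulus \<alpha>}) (\<lambda>x. odometer_projection x \<alpha>)" for \<alpha>
      using res_locally_constant[OF modulus_in_moduli] modulus_pos
      by (intro continuous_map_X_if_locally_constant[where W = "window_of (modulus \<alpha>)"])
        (auto simp: odometer_projection_def res_def)
  qed
  have closed: "closedin ?O (odometer_projection ` topspace X)"
    using compact_space_X cont
    by (intro compactin_imp_closedin image_compactin[of X])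
      (auto simp: odometer_space_eq Hausdorff_space_state_limit compact_space_def)
  show "odometer_projection ` topspace X = topspace ?O"
  proof
    show "odometer_projection ` topspace X \<subseteq> topspace ?O" using into by blast
    show "topspace ?O \<subseteq> odometer_projection ` topspace X"
    proof
      fix z assume z: "z \<in> topspace ?O"
      have "z \<in> ?O closure_of (odometer_projection ` topspace X)"
        unfolding in_closure_of
      proof (intro conjI z allI impI)
        fix T assume "z \<in> T \<and> openin ?O T"
        then obtain N where N: "\<And>y. y \<in> topspace ?O \<Longrightarrow> y N = z N \<Longrightarrow> y \<in> T"
          unfolding odometer_space_eq openin_state_limit_iff by blast
        have "odometer_projection ((shift ^^ z N) u) N = z N"
          using z res_eq[OF modulus_in_moduli, of N "(shift ^^ z N) u" "z N"]
          by (auto simp: odometer_projection_def agree_def odometer_space_eq topspace_state_limit)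
        then show "\<exists>y. y \<in> odometer_projection ` topspace X \<and> y \<in> T"
          using N into orbit_in_X by blast
      qed
      then show "z \<in> odometer_projection ` topspace X" using closed closure_of_closedin by blast
    qed
  qed
  show "odometer_projection (shift x) = odometer_map modulus (odometer_projection x)"
    if "x \<in> topspace X" for x
    using res_shift[OF modulus_in_moduli that] by (simp add: odometer_projection_def odometer_map_def)
qed

section \<open>Equicontinuous factors\<close>

lemma equicontinuous_factor_collapses:
  assumes Z: "equicontinuous_system Z Q" and \<rho>: "factor_map X shift Z Q \<rho>"
    and x: "x \<in> topspace X" and y: "y \<in> topspace X"
    and eq: "odometer_projection x = odometer_projection y"
  shows "\<rho> x = \<rho> y"
proof (rule ccontr)
  assume neq: "\<rho> x \<noteq> \<rho> y"
  obtain d where d: "Metric_space (topspace Z) d" "Metric_space.mtopology (topspace Z) d = Z"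
    and ec: "\<And>\<epsilon>. \<epsilon> > 0 \<Longrightarrow> \<exists>\<eta>>0. \<forall>x\<in>topspace Z. \<forall>y\<in>topspace Z. d x y < \<eta> \<longrightarrow>
        (\<forall>n. d ((Q ^^ n) x) ((Q ^^ n) y) < \<epsilon>)"
    using Z unfolding equicontinuous_system_def by blast
  interpret Metric_space "topspace Z" d by (rule d(1))
  have cont: "continuous_map X (Metric_space.mtopology (topspace Z) d) \<rho>"
    using \<rho> d(2) by (simp add: factor_map_def)
  have \<rho>Z: "\<rho> a \<in> topspace Z" if "a \<in> topspace X" for a
    using \<rho> that unfolding factor_map_def by blast
  have \<rho>_shift: "\<rho> ((shift ^^ j) a) = (Q ^^ j) (\<rho> a) \<and> (shift ^^ j) a \<in> topspace X"
    if "a \<in> topspace X" for a j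
    using that \<rho> by (induction j) (auto simp: factor_map_def shift_in_X)
  define e where "e = d (\<rho> x) (\<rho> y)"
  have e: "e > 0" using neq x y \<rho>Z by (simp add: e_def mdist_pos_eq)
  \<comment> \<open>Distances to \<rho> x along the orbit turn the factor into a scalar sequence.
    Equicontinuity makes it regular, hence nearly periodic along some modulus. Orbit points
    approximating x and y at times congruent to this modulus then have almost equal distances to
    \<rho> x.\<close>
  define \<phi> where "\<phi> n = complex_of_real (d (\<rho> ((shift ^^ n) u)) (\<rho> x))" for n
  have dist_diff: "\<bar>d a c - d b c\<bar> \<le> d a b" if "a \<in> topspace Z" "b \<in> topspace Z" "c \<in> topspace Z" for a b c
    using triangle[of a b c] triangle[of b a c] commute[of a b] that by linarith
  have "regular \<phi>"
    unfolding regular_def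
  proof (intro allI impI)
    fix \<epsilon> :: real assume "\<epsilon> > 0"
    from ec[OF this] obtain \<eta> where \<eta>: "\<eta> > 0"
      "\<forall>x\<in>topspace Z. \<forall>y\<in>topspace Z. d x y < \<eta> \<longrightarrow> (\<forall>n. d ((Q ^^ n) x) ((Q ^^ n) y) < \<epsilon>)"
      by (elim exE conjE)
    obtain W where W: "\<And>a b. a \<in> topspace X \<Longrightarrow> b \<in> topspace X \<Longrightarrow> agree W a b \<Longrightarrow> d (\<rho> a) (\<rho> b) < \<eta>"
      using X_uniformly_continuous[OF d(1) cont \<eta>(1)] by blast
    have "norm (\<phi> (n + j) - \<phi> (m + j)) \<le> \<epsilon>" if "near W n m" for n m j
    proof -
      have 1: "\<rho> ((shift ^^ (k + j)) u) = (Q ^^ j) (\<rho> ((shift ^^ k) u))" for k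
        using \<rho>_shift[OF orbit_in_X[of k], of j] by (simp add: add.commute funpow_add)
      have "d (\<rho> ((shift ^^ n) u)) (\<rho> ((shift ^^ m) u)) < \<eta>"
        using W orbit_in_X that by (simp add: agree_orbit)
      then have "d (\<rho> ((shift ^^ (n + j)) u)) (\<rho> ((shift ^^ (m + j)) u)) < \<epsilon>"
        unfolding 1 using \<eta>(2) \<rho>Z orbit_in_X by blast
      then show ?thesis
        using dist_diff[of "\<rho> ((shift ^^ (n + j)) u)" "\<rho> ((shift ^^ (m + j)) u)" "\<rho> x"] \<rho>Z orbit_in_X x
        by (simp add: \<phi>_def norm_of_real flip: of_real_diff)
    qed
    then show "\<exists>W. \<forall>n m. near W n m \<longrightarrow> (\<forall>j. norm (\<phi> (n + j) - \<phi> (m + j)) \<le> \<epsilon>)" by blast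
  qed
  then obtain q where q: "q \<in> moduli" "\<And>n m. [n = m] (mod q) \<Longrightarrow> norm (\<phi> n - \<phi> m) \<le> e / 4"
    using regular_nearly_periodic[of \<phi> "e / 4"] e by auto
  obtain W where W: "\<And>a b. a \<in> topspace X \<Longrightarrow> b \<in> topspace X \<Longrightarrow> agree W a b \<Longrightarrow> d (\<rho> a) (\<rho> b) < e / 4"
    using X_uniformly_continuous[OF d(1) cont, of "e / 4"] e by auto
  obtain n where n: "agree W x ((shift ^^ n) u)" "res (modulus q) x = n mod modulus q"
    using X_approx_res[OF x, of "{modulus q}" W] modulus_in_moduli by auto
  obtain m where m: "agree W y ((shift ^^ m) u)" "res (modulus q) y = m mod modulus q"
    using X_approx_res[OF y, of "{modulus q}" W] modulus_in_moduli by auto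
  have "res (modulus q) x = res (modulus q) y" using fun_cong[OF eq] by (simp add: odometer_projection_def)
  then have "[n = m] (mod modulus q)" using n m by (simp add: cong_def)
  then have "[n = m] (mod q)" using dvd_modulus[OF q(1) order_refl] cong_dvd_modulus_nat by blast
  then have "norm (\<phi> n - \<phi> m) \<le> e / 4" by (rule q(2))
  then have "\<bar>d (\<rho> ((shift ^^ n) u)) (\<rho> x) - d (\<rho> ((shift ^^ m) u)) (\<rho> x)\<bar> \<le> e / 4"
    by (simp add: \<phi>_def norm_of_real flip: of_real_diff)
  moreover have "d (\<rho> ((shift ^^ n) u)) (\<rho> x) < e / 4"
    using W[OF x orbit_in_X n(1)] by (simp add: commute)
  moreover have "d (\<rho> y) (\<rho> ((shift ^^ m) u)) < e / 4" using W[OF y orbit_in_X m(1)] .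
  moreover have "e \<le> d (\<rho> y) (\<rho> ((shift ^^ m) u)) + d (\<rho> ((shift ^^ m) u)) (\<rho> x)"
    unfolding e_def commute[of "\<rho> x"] using \<rho>Z x y orbit_in_X by (intro triangle) auto
  ultimately show False using e by linarith
qed

text \<open>The projection maps a compact space onto a Hausdorff space, so it is a quotient map, and
  a factor map that is constant on its fibres descends.\<close>

lemma equicontinuous_factor_of_odometer:
  assumes "equicontinuous_system Z Q" "factor_map X shift Z Q \<rho>"
  shows "\<exists>\<phi>. factor_map (odometer_space modulus) (odometer_map modulus) Z Q \<phi> \<and>
    (\<forall>x\<in>topspace X. \<rho> x = \<phi> (odometer_projection x))"
proof -
  let ?O = "odometer_space modulus"
  have pr: "continuous_map X ?O odometer_projection" "odometer_projection ` topspace X = topspace ?O"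
    "\<And>x. x \<in> topspace X \<Longrightarrow> odometer_projection (shift x) = odometer_map modulus (odometer_projection x)"
    using odometer_projection_factor_map by (auto simp: factor_map_def)
  have \<rho>: "continuous_map X Z \<rho>" "\<rho> ` topspace X = topspace Z"
    "\<And>x. x \<in> topspace X \<Longrightarrow> \<rho> (shift x) = Q (\<rho> x)"
    using assms(2) by (auto simp: factor_map_def)
  have "quotient_map X ?O odometer_projection"
    using pr compact_space_X
    by (intro T1_Spaces.continuous_imp_quotient_map) (simp_all add: odometer_space_eq Hausdorff_space_state_limit)
  then obtain \<phi> where \<phi>: "continuous_map ?O Z \<phi>" "\<phi> ` topspace ?O = \<rho> ` topspace X"
      "\<And>x. x \<in> topspace X \<Longrightarrow> \<phi> (odometer_projection x) = \<rho> x"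
    using quotient_map_lift_exists[OF _ \<rho>(1)] equicontinuous_factor_collapses[OF assms] by metis
  have "\<phi> (odometer_map modulus z) = Q (\<phi> z)" if z: "z \<in> topspace ?O" for z
  proof -
    obtain x where x: "x \<in> topspace X" "z = odometer_projection x" using z pr(2) by blast
    then show ?thesis using pr(3)[OF x(1)] \<phi>(3)[OF x(1)] \<phi>(3)[OF shift_in_X[OF x(1)]] \<rho>(3)[OF x(1)] by simp
  qed
  then have "factor_map ?O (odometer_map modulus) Z Q \<phi>"
    using \<phi> \<rho>(2) by (simp add: factor_map_def)
  then show ?thesis using \<phi>(3) by auto
qed

text \<open>The odometer is transported to the fibres of its projection, which turns its points into
  sets of points of the subshift.\<close>

lemma maximal_equicontinuous_factor_exists:
  "\<exists>(Y :: (nat \<Rightarrow> nat \<Rightarrow> 's) set topology) R \<pi>. maximal_equicontinuous_factor X shift Y R \<pi>"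
proof -
  let ?O = "odometer_space modulus" and ?R = "odometer_map modulus"
  define e where "e z = {x \<in> topspace X. odometer_projection x = z}" for z
  have im: "odometer_projection ` topspace X = topspace ?O"
    using odometer_projection_factor_map by (simp add: factor_map_def)
  have inj: "inj_on e (topspace ?O)" unfolding inj_on_def im[symmetric] e_def by blast
  have eqO: "equicontinuous_system ?O ?R" by (rule equicontinuous_odometer[OF modulus_dvd])
  obtain Y R g where Y: "equicontinuous_system Y R" "factor_map ?O ?R Y R e" "factor_map Y R ?O ?R g"
    and g: "\<And>z. z \<in> topspace ?O \<Longrightarrow> g (e z) = z"
    by (rule equicontinuous_system_transfer[OF eqO inj], rule that) simp_all
  have "maximal_equicontinuous_factor X shift Y R (e \<circ> odometer_projection)"
    unfolding maximal_equicontinuous_factor_def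
  proof (intro conjI allI impI Y(1) factor_map_compose[OF odometer_projection_factor_map Y(2)])
    fix Z :: "(nat \<Rightarrow> nat \<Rightarrow> 's) set topology" and Q \<rho>
    assume Z: "equicontinuous_system Z Q \<and> factor_map X shift Z Q \<rho>"
    from equicontinuous_factor_of_odometer[OF conjunct1[OF Z] conjunct2[OF Z]]
    obtain \<phi> where \<phi>: "factor_map ?O ?R Z Q \<phi>" "\<forall>x\<in>topspace X. \<rho> x = \<phi> (odometer_projection x)"
      by (elim exE conjE)
    have "\<rho> x = (\<phi> \<circ> g) ((e \<circ> odometer_projection) x)" if x: "x \<in> topspace X" for x
    proof -
      have "odometer_projection x \<in> topspace ?O" unfolding im[symmetric] using x by (rule imageI)
      then show ?thesis using \<phi>(2) g x by simp
    qed
    then show "\<exists>\<phi>. factor_map Y R Z Q \<phi> \<and> (\<forall>x\<in>topspace X. \<rho> x = \<phi> ((e \<circ> odometer_projection) x))"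
      using factor_map_compose[OF Y(3) \<phi>(1)] by (intro exI[of _ "\<phi> \<circ> g"] conjI ballI)
  qed
  then show ?thesis by blast
qed

text \<open>Both systems are universal, so there are factor maps in both directions. These commute
  with the surjections from the subshift and are therefore inverse to each other.\<close>

lemma maximal_equicontinuous_factor_is_odometer:
  assumes mef: "maximal_equicontinuous_factor X shift Y R \<pi>"
  shows "is_odometer Y R"
proof -
  let ?O = "odometer_space modulus" and ?R = "odometer_map modulus"
  have pr: "odometer_projection ` topspace X = topspace ?O"
    using odometer_projection_factor_map by (simp add: factor_map_def)
  have Y: "equicontinuous_system Y R" "factor_map X shift Y R \<pi>"
    using mef by (auto simp: maximal_equicontinuous_factor_def)
  have \<pi>: "\<pi> ` topspace X = topspace Y" using Y(2) by (simp add: factor_map_def)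
  obtain f where f: "factor_map Y R ?O ?R f" "\<And>x. x \<in> topspace X \<Longrightarrow> odometer_projection x = f (\<pi> x)"
    using maximal_equicontinuous_factorD[OF mef equicontinuous_odometer[OF modulus_dvd]
        odometer_projection_factor_map] by blast
  obtain g where g: "factor_map ?O ?R Y R g" "\<And>x. x \<in> topspace X \<Longrightarrow> \<pi> x = g (odometer_projection x)"
    using equicontinuous_factor_of_odometer[OF Y] by blast
  have "g (f y) = y" if "y \<in> topspace Y" for y
    using that f(2) g(2) unfolding \<pi>[symmetric] by force
  moreover have "f (g z) = z" if "z \<in> topspace ?O" for z
    using that f(2) g(2) unfolding pr[symmetric] by force
  ultimately have "homeomorphic_maps Y ?O f g"
    using f(1) g(1) by (simp add: homeomorphic_maps_def factor_map_def)
  then have "conjugate Y R ?O ?R"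
    using f(1) unfolding conjugate_def factor_map_def by (blast dest: homeomorphic_maps_map[THEN iffD1])
  then show ?thesis
    unfolding is_odometer_def using modulus_pos modulus_dvd[OF le_SucI[OF order_refl]] by blast
qed

section \<open>The levels and the inverse limit of their subshifts\<close>

lemma level_factor_map:
  "factor_map X shift (subshift (discrete_topology (S \<alpha>)) (level \<alpha> u)) shift (level \<alpha>)"
proof -
  let ?D = "seq_space (discrete_topology (S \<alpha>))"
  have c: "continuous_map (seq_space A) ?D (level \<alpha>)"
    unfolding seq_space_def continuous_map_componentwise_UNIV level_def
  proof
    fix k
    have "continuous_map (product_topology (\<lambda>_. A) UNIV) A (\<lambda>x. x k)"
      by (intro continuous_map_product_projection) simp
    from continuous_map_compose[OF this continuous_map_state_limit_component[of S \<psi> \<alpha>]]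
    show "continuous_map (product_topology (\<lambda>_. A) UNIV) (discrete_topology (S \<alpha>)) (\<lambda>x. x k \<alpha>)"
      by (simp add: o_def)
  qed
  have orb: "level \<alpha> ` {(shift ^^ n) u | n. True} = {(shift ^^ n) (level \<alpha> u) | n. True}"
    by (auto simp: shift_power level_def image_iff)
  have into: "level \<alpha> ` topspace X \<subseteq> topspace (subshift (discrete_topology (S \<alpha>)) (level \<alpha> u))"
    unfolding topspace_subshift orb[symmetric] by (rule continuous_map_image_closure_subset[OF c])
  have cont: "continuous_map X ?D (level \<alpha>)"
    unfolding subshift_def by (rule continuous_map_from_subtopology[OF c])
  \<comment> \<open>Surjectivity: the image is closed by compactness and contains the orbit at level
    \<alpha>, hence the closure of that orbit.\<close>
  have "compactin ?D (level \<alpha> ` topspace X)"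
    using compact_space_X cont by (intro image_compactin[of X]) (simp_all add: compact_space_def)
  then have "closedin ?D (level \<alpha> ` topspace X)"
    by (intro compactin_imp_closedin Hausdorff_space_seq_space) auto
  moreover have "{(shift ^^ n) (level \<alpha> u) | n. True} \<subseteq> level \<alpha> ` topspace X"
    unfolding orb[symmetric] using orbit_in_X by blast
  ultimately have "topspace (subshift (discrete_topology (S \<alpha>)) (level \<alpha> u)) \<subseteq> level \<alpha> ` topspace X"
    unfolding topspace_subshift by (rule closure_of_minimal[rotated])
  moreover have "continuous_map X (subshift (discrete_topology (S \<alpha>)) (level \<alpha> u)) (level \<alpha>)"
    unfolding subshift_def[of "discrete_topology (S \<alpha>)"]
    using cont into by (intro continuous_map_into_subtopology) (auto simp: topspace_subshift)
  ultimately show ?thesis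
    using into by (auto simp: factor_map_def level_def shift_def)
qed

lemma homeomorphic_inverse_limit:
  "homeomorphic_map X
     (inverse_limit (\<lambda>\<alpha>. subshift (discrete_topology (S \<alpha>)) (level \<alpha> u)) (\<lambda>\<alpha> \<beta> x n. \<psi> \<alpha> \<beta> (x n)))
     (\<lambda>x \<alpha>. level \<alpha> x)"
proof (rule continuous_imp_homeomorphic_map)
  let ?X = "\<lambda>\<alpha>. subshift (discrete_topology (S \<alpha>)) (level \<alpha> u)"
  let ?L = "inverse_limit ?X (\<lambda>\<alpha> \<beta> x n. \<psi> \<alpha> \<beta> (x n))"
  have lev: "continuous_map X (?X \<alpha>) (level \<alpha>)" "level \<alpha> ` topspace X = topspace (?X \<alpha>)" for \<alpha>
    using level_factor_map by (auto simp: factor_map_def)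
  have into: "(\<lambda>\<alpha>. level \<alpha> x) \<in> topspace ?L" if x: "x \<in> topspace X" for x
  proof -
    have bond: "\<psi> \<alpha> \<beta> (x n \<beta>) = x n \<alpha>" if "\<alpha> \<le> \<beta>" for \<alpha> \<beta> n
      using X_state[OF x, of n] that by (simp add: topspace_state_limit)
    show ?thesis
      unfolding topspace_inverse_limit
    proof (intro CollectI conjI allI impI)
      show "level \<alpha> x \<in> topspace (?X \<alpha>)" for \<alpha> using lev(2) x by blast
      show "(\<lambda>n. \<psi> \<alpha> \<beta> (level \<beta> x n)) = level \<alpha> x" if "\<alpha> \<le> \<beta>" for \<alpha> \<beta>
        using bond[OF that] by (simp add: level_def)
    qed
  qed
  show "continuous_map X ?L (\<lambda>x \<alpha>. level \<alpha> x)"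
    unfolding inverse_limit_def continuous_map_in_subtopology continuous_map_componentwise_UNIV
    using lev(1) into by (auto simp: topspace_inverse_limit)
  show "compact_space X" by (rule compact_space_X)
  have "Hausdorff_space (?X \<alpha>)" for \<alpha>
    unfolding subshift_def by (intro Hausdorff_space_subtopology Hausdorff_space_seq_space) simp
  then show "Hausdorff_space ?L" by (rule Hausdorff_space_inverse_limit)
  show "inj_on (\<lambda>x \<alpha>. level \<alpha> x) (topspace X)"
    by (auto simp: inj_on_def level_def fun_eq_iff)
  show "(\<lambda>x \<alpha>. level \<alpha> x) ` topspace X = topspace ?L"
  proof
    show "(\<lambda>x \<alpha>. level \<alpha> x) ` topspace X \<subseteq> topspace ?L" using into by blast
    show "topspace ?L \<subseteq> (\<lambda>x \<alpha>. level \<alpha> x) ` topspace X"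
    proof
      fix y assume y: "y \<in> topspace ?L"
      define x where "x n \<alpha> = y \<alpha> n" for n \<alpha>
      have "y \<alpha> \<in> level \<alpha> ` topspace X" for \<alpha>
        unfolding lev(2) using y by (simp add: topspace_inverse_limit)
      then have "\<exists>z. z \<in> topspace X \<and> level \<alpha> z = y \<alpha>" for \<alpha> by (metis imageE)
      then obtain z where z: "\<And>\<alpha>. z \<alpha> \<in> topspace X" "\<And>\<alpha>. level \<alpha> (z \<alpha>) = y \<alpha>" by metis
      have xz: "x n \<alpha> = z \<alpha> n \<alpha>" for n \<alpha>
        using z(2)[of \<alpha>] by (auto simp: x_def level_def fun_eq_iff)
      have "x \<in> topspace X"
        unfolding in_X_iff
      proof (intro conjI allI)
        have "\<psi> \<alpha> \<beta> (y \<beta> n) = y \<alpha> n" if "\<alpha> \<le> \<beta>" for \<alpha> \<beta> n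
          using y that unfolding topspace_inverse_limit by (auto dest: fun_cong)
        moreover have "x n \<alpha> \<in> S \<alpha>" for n \<alpha>
          using X_state[OF z(1)[of \<alpha>], of n] unfolding xz by (simp add: topspace_state_limit)
        ultimately show "x n \<in> topspace A" for n by (simp add: topspace_state_limit x_def)
        \<comment> \<open>\<open>agree W\<close> looks only at level \<open>W\<close>, where the
          glued sequence coincides with the point \<open>z W\<close> of the subshift.\<close>
        show "\<exists>n. agree W x ((shift ^^ n) u)" for W
          using X_approx[OF z(1)[of W], of W] by (simp add: agree_def xz)
      qed
      then show "y \<in> (\<lambda>x \<alpha>. level \<alpha> x) ` topspace X"
        by (rule rev_image_eqI) (auto simp: level_def x_def)
    qed
  qed
qed

end

section \<open>Invariant measures and measurable eigenvalues\<close>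

lemma space_borel_of: "space (borel_of X) = topspace X"
  unfolding borel_of_def by (rule space_measure_of) (auto dest: openin_subset)

lemma sets_borel_of: "sets (borel_of X) = sigma_sets (topspace X) {U. openin X U}"
  unfolding borel_of_def by (rule sets_measure_of) (auto dest: openin_subset)

lemma openin_sets_borel_of: "openin X U \<Longrightarrow> U \<in> sets (borel_of X)"
  by (simp add: sets_borel_of)

lemma continuous_map_measurable_borel_of:
  assumes "continuous_map X Y f"
  shows "f \<in> measurable (borel_of X) (borel_of Y)"
  unfolding borel_of_def[of Y]
proof (rule measurable_measure_of)
  show "{U. openin Y U} \<subseteq> Pow (topspace Y)" by (auto dest: openin_subset)
  show "f \<in> space (borel_of X) \<rightarrow> topspace Y"
    using assms by (auto simp: continuous_map_def space_borel_of)
  fix U assume "U \<in> {U. openin Y U}"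
  then have "openin X {x \<in> topspace X. f x \<in> U}"
    using assms by (auto simp: continuous_map_def)
  moreover have "f -` U \<inter> space (borel_of X) = {x \<in> topspace X. f x \<in> U}"
    by (auto simp: space_borel_of)
  ultimately show "f -` U \<inter> space (borel_of X) \<in> sets (borel_of X)"
    by (simp add: openin_sets_borel_of)
qed

lemma invariant_borel_prob_factor:
  assumes inv: "invariant_borel_prob X T \<mu>" and \<pi>: "factor_map X T Y R \<pi>"
    and R: "continuous_map Y Y R"
  shows "invariant_borel_prob Y R (distr \<mu> (borel_of Y) \<pi>)"
proof -
  have \<mu>: "prob_space \<mu>" "sets \<mu> = sets (borel_of X)" "T \<in> measurable \<mu> \<mu>" "distr \<mu> \<mu> T = \<mu>"
    using inv by (auto simp: invariant_borel_prob_def)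
  let ?B = "borel_of Y"
  let ?D = "distr \<mu> ?B \<pi>"
  have m\<pi>: "\<pi> \<in> measurable \<mu> ?B"
    using continuous_map_measurable_borel_of[of X Y \<pi>] \<pi> measurable_cong_sets[OF \<mu>(2) refl]
    by (auto simp: factor_map_def)
  have mR: "R \<in> measurable ?B ?B" by (rule continuous_map_measurable_borel_of[OF R])
  have sp: "space \<mu> = topspace X" using sets_eq_imp_space_eq[OF \<mu>(2)] by (simp add: space_borel_of)
  have "distr ?D ?D R = distr ?D ?B R" by (rule distr_cong) simp_all
  also have "\<dots> = distr \<mu> ?B (R \<circ> \<pi>)" using mR m\<pi> by (rule distr_distr)
  also have "\<dots> = distr \<mu> ?B (\<pi> \<circ> T)"
    using \<pi> by (intro distr_cong) (auto simp: factor_map_def sp)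
  also have "\<dots> = distr (distr \<mu> \<mu> T) ?B \<pi>" using m\<pi> \<mu>(3) by (rule distr_distr[symmetric])
  finally have "distr ?D ?D R = ?D" using \<mu>(4) by simp
  moreover have "prob_space ?D" using prob_space.prob_space_distr[OF \<mu>(1) m\<pi>] .
  ultimately show ?thesis
    using mR by (simp add: invariant_borel_prob_def)
qed

text \<open>Dynkin's argument: the sets over which the integral vanishes are closed under
  complements and disjoint countable unions, so the vanishing spreads from the intersection-stable
  generator to all measurable sets.\<close>

lemma AE_zero_if_integrals_zero:
  fixes f :: "'a \<Rightarrow> complex"
  assumes f: "integrable M f" and gen: "sets M = sigma_sets \<Omega> G" "Int_stable G" "G \<subseteq> Pow \<Omega>" "\<Omega> \<in> G"
    and zero: "\<And>C. C \<in> G \<Longrightarrow> (LINT x:C|M. f x) = 0"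
  shows "AE x in M. f x = 0"
proof -
  have space: "space M = \<Omega>"
    using gen(1,3) by (metis Union_Pow_eq sets.top sets.sets_into_space sigma_sets_into_sp
        sigma_sets_top subset_antisym)
  have si: "set_integrable M A f" if "A \<in> sets M" for A
    unfolding set_integrable_def using integrable_mult_indicator[OF that f] .
  have all: "(LINT x:A|M. f x) = 0" if "A \<in> sigma_sets \<Omega> G" for A
    using gen(2,3) that
  proof (induction rule: sigma_sets_induct_disjoint)
    case (compl A)
    have A: "A \<in> sets M" "\<Omega> - A \<in> sets M" "\<Omega> \<in> sets M"
      using compl(1) gen by (auto simp: sigma_sets.Compl sigma_sets.Basic)
    have "A \<subseteq> \<Omega>" using sets.sets_into_space[OF A(1)] space by simp
    then have "(LINT x:\<Omega>|M. f x) = (LINT x:A|M. f x) + (LINT x:\<Omega> - A|M. f x)"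
      using set_integral_Un[of A "\<Omega> - A" M f] si A by (simp add: Un_absorb1)
    then show ?case using compl(2) zero[OF gen(4)] by simp
  next
    case (union A)
    have A: "A i \<in> sets M" for i using union(2) gen(1) by auto
    have "(LINT x:(\<Union>i. A i)|M. f x) = (\<Sum>i. (LINT x:(A i)|M. f x))"
      using A union(1) si[of "\<Union>i. A i"]
      by (intro lebesgue_integral_countable_add) (auto simp: disjoint_family_on_def)
    then show ?case using union(3) by simp
  qed (use zero in \<open>auto simp: set_lebesgue_integral_def\<close>)
  \<comment> \<open>The uniqueness of densities is applied to real functions, so real and imaginary
    parts are treated separately, both as bounded linear images of \<open>f\<close>.\<close>
  have part: "AE x in M. g (f x) = 0" if "bounded_linear g" for g :: "complex \<Rightarrow> real"
  proof (rule density_unique_real)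
    interpret bounded_linear g by (rule that)
    show "integrable M (\<lambda>x. g (f x))" using f by (rule integrable_bounded_linear[OF that])
    show "integrable M (\<lambda>x. 0 :: real)" by simp
    fix A assume "A \<in> sets M"
    then have "g (LINT x:A|M. f x) = (LINT x:A|M. g (f x))"
      using integral_bounded_linear[OF that, of M "\<lambda>x. indicator A x *\<^sub>R f x"] si[of A]
      by (simp add: set_lebesgue_integral_def set_integrable_def scaleR)
    then show "(LINT x:A|M. g (f x)) = (LINT x:A|M. 0)"
      using all \<open>A \<in> sets M\<close> gen(1) by (simp add: zero)
  qed
  have "AE x in M. Re (f x) = 0" "AE x in M. Im (f x) = 0"
    using part[OF bounded_linear_Re] part[OF bounded_linear_Im] .
  then show ?thesis by eventually_elim (simp add: complex_eq_iff)
qed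

section \<open>Orders of measurable eigenvalues\<close>

context limit_subshift
begin

text \<open>Invariance and the eigenvalue equation show that the integral of
  \<open>c ^ m * h ((shift ^^ m) x) * f x\<close> is the same nonzero number for all
  \<open>m\<close>. If the twisted sums of \<open>h\<close> were uniformly small along the orbit of
  \<open>u\<close>, they would be so on the whole subshift, and integrating them against
  \<open>f\<close> would give a contradiction.\<close>

lemma measurable_eigenvalue_root:
  assumes inv: "invariant_borel_prob X shift \<mu>" and ev: "measurable_eigenvalue \<mu> shift c"
  obtains q where "q \<in> moduli" "c ^ q = 1"
proof -
  have \<mu>: "prob_space \<mu>" "sets \<mu> = sets (borel_of X)" "shift \<in> measurable \<mu> \<mu>" "distr \<mu> \<mu> shift = \<mu>"
    using inv by (auto simp: invariant_borel_prob_def)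
  interpret prob_space \<mu> by (rule \<mu>(1))
  have sp: "space \<mu> = topspace X" using sets_eq_imp_space_eq[OF \<mu>(2)] by (simp add: space_borel_of)
  obtain f :: "(nat \<Rightarrow> nat \<Rightarrow> 's) \<Rightarrow> complex" where mf [measurable]: "f \<in> borel_measurable \<mu>"
    and f2: "integrable \<mu> (\<lambda>x. (cmod (f x))\<^sup>2)"
    and nz: "\<not> (AE x in \<mu>. f x = 0)" and ev: "AE x in \<mu>. f (shift x) = c * f x"
    using ev by (auto simp: measurable_eigenvalue_def)
  have mT [measurable]: "shift \<in> measurable \<mu> \<mu>" by (rule \<mu>(3))
  have int_f: "integrable \<mu> f"
  proof (rule Bochner_Integration.integrable_bound[of _ "\<lambda>x. 1 + (cmod (f x))\<^sup>2"])
    show "integrable \<mu> (\<lambda>x. 1 + (cmod (f x))\<^sup>2)" using f2 by simp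
    have "a \<le> \<bar>1 + a\<^sup>2\<bar>" for a :: real
      using sum_squares_bound[of a 1] zero_le_power2[of a] by (simp only: power_one mult_1_right)
    then show "AE x in \<mu>. norm (f x) \<le> norm (1 + (cmod (f x))\<^sup>2)" by simp
  qed simp
  have inv_int: "(\<integral>x. g (shift x) \<partial>\<mu>) = (\<integral>x. g x \<partial>\<mu>)" if "g \<in> borel_measurable \<mu>"
    for g :: "_ \<Rightarrow> 'b :: {banach, second_countable_topology}"
    using integral_distr[OF mT, of g] that \<mu>(4) by simp
  \<comment> \<open>The integral of the squared modulus of \<open>f\<close> is invariant under the
    shift, nonzero, and multiplied by the squared modulus of \<open>c\<close>.\<close>
  have c1: "norm c = 1"
  proof -
    define I where "I = (\<integral>x. (cmod (f x))\<^sup>2 \<partial>\<mu>)"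
    have "I \<noteq> 0"
      unfolding I_def using nz integral_nonneg_eq_0_iff_AE[OF f2] by simp
    have "I = (\<integral>x. (cmod (f (shift x)))\<^sup>2 \<partial>\<mu>)"
      unfolding I_def by (rule inv_int[symmetric]) simp
    also have "\<dots> = (\<integral>x. (cmod c)\<^sup>2 * (cmod (f x))\<^sup>2 \<partial>\<mu>)"
      using ev by (intro integral_cong_AE) (auto simp: norm_mult power_mult_distrib)
    also have "\<dots> = (cmod c)\<^sup>2 * I" by (simp add: I_def)
    finally have "(cmod c)\<^sup>2 = 1" using \<open>I \<noteq> 0\<close> by simp
    then show ?thesis using power2_eq_imp_eq[of "cmod c" 1] by simp
  qed
  \<comment> \<open>Cylinders around orbit points suffice, since every point agrees with one of them
    up to any \<open>W\<close>. They form a countable family that generates the Borel sets and,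
    being nested or disjoint, is intersection-stable once the empty set is added.\<close>
  define C where "C W n = {y \<in> topspace X. agree W ((shift ^^ n) u) y}" for W n
  define G where "G = insert {} (range (\<lambda>(W, n). C W n))"
  have C_open: "openin X (C W n)" for W n unfolding C_def by (rule openin_X_agree)
  have C_nested: "C V m \<subseteq> C W n \<or> C V m \<inter> C W n = {}" if "W \<le> V" for V W m n
  proof (cases "C V m \<inter> C W n = {}")
    case False
    then obtain z where z: "z \<in> topspace X" "agree V ((shift ^^ m) u) z" "agree W ((shift ^^ n) u) z"
      by (auto simp: C_def)
    have "y \<in> C W n" if "y \<in> C V m" for y
    proof -
      have y: "y \<in> topspace X" "agree V ((shift ^^ m) u) y" using that by (auto simp: C_def)
      then have "agree V z y" using z(2) agree_sym agree_trans by blast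
      then have "agree W z y" using X_agree_mono[OF z(1) y(1)] \<open>W \<le> V\<close> by blast
      then show ?thesis using z(3) y(1) agree_trans unfolding C_def by blast
    qed
    then show ?thesis by blast
  qed blast
  have "C V m \<inter> C W n \<in> G" for V W m n
  proof (cases "W \<le> V")
    case True
    then have "C V m \<inter> C W n = C V m \<or> C V m \<inter> C W n = {}" using C_nested by blast
    then show ?thesis by (auto simp: G_def)
  next
    case False
    then have "C V m \<inter> C W n = C W n \<or> C V m \<inter> C W n = {}"
      using C_nested[of V W n m] by auto
    then show ?thesis by (auto simp: G_def)
  qed
  then have G_Int: "Int_stable G" by (auto simp: Int_stable_def G_def)
  have G_Pow: "G \<subseteq> Pow (topspace X)" by (auto simp: G_def C_def)
  \<comment> \<open>A window of length 0 imposes no condition, so the whole space is a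
    cylinder.\<close>
  have G_top: "topspace X \<in> G"
    by (auto simp: G_def C_def agree_def image_iff intro: exI[of _ 0])
  have "sigma_sets (topspace X) {U. openin X U} = sigma_sets (topspace X) G"
  proof (rule sigma_sets_eqI)
    fix U assume "U \<in> {U. openin X U}"
    then have U: "openin X U" by simp
    define B where "B = {D \<in> G. D \<subseteq> U}"
    have "x \<in> \<Union>B" if x: "x \<in> U" for x
    proof -
      obtain W where W: "\<And>y. y \<in> topspace X \<Longrightarrow> agree W x y \<Longrightarrow> y \<in> U"
        using openin_X_window[OF U x] by blast
      have xt: "x \<in> topspace X" using openin_subset[OF U] x by blast
      then obtain n where n: "agree W x ((shift ^^ n) u)" using X_approx by blast
      have "C W n \<subseteq> U" using W n agree_trans unfolding C_def by blast
      moreover have "x \<in> C W n" using xt n agree_sym unfolding C_def by blast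
      ultimately show ?thesis unfolding B_def G_def by blast
    qed
    then have "U = \<Union>B" by (auto simp: B_def)
    moreover have "countable G" unfolding G_def by simp
    then have "countable B" unfolding B_def by (rule countable_subset[rotated]) blast
    then have "\<Union>B \<in> sigma_sets (topspace X) G"
      by (rule sigma_sets_UNION) (auto simp: B_def intro: sigma_sets.Basic)
    ultimately show "U \<in> sigma_sets (topspace X) G" by simp
  next
    fix D assume "D \<in> G"
    then show "D \<in> sigma_sets (topspace X) {U. openin X U}"
      using C_open by (auto simp: G_def intro: sigma_sets.Basic sigma_sets.Empty)
  qed
  then have gen: "sets \<mu> = sigma_sets (topspace X) G" using \<mu>(2) sets_borel_of by blast
  obtain D where D: "D \<in> G" "(LINT x:D|\<mu>. f x) \<noteq> 0"
    using AE_zero_if_integrals_zero[OF int_f gen G_Int G_Pow G_top] nz by blast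
  then have "D \<noteq> {}" by (auto simp: set_lebesgue_integral_def)
  then obtain W n0 where Dn: "D = C W n0" using D(1) by (auto simp: G_def)
  have D_sets [measurable]: "D \<in> sets \<mu>" using C_open[of W n0] Dn \<mu>(2) openin_sets_borel_of by blast
  define h :: "(nat \<Rightarrow> nat \<Rightarrow> 's) \<Rightarrow> complex" where "h x = indicator D x" for x
  have mh [measurable]: "h \<in> borel_measurable \<mu>" unfolding h_def by measurable
  have h_agree: "h x = h y" if "x \<in> topspace X" "y \<in> topspace X" "agree W x y" for x y
  proof -
    have "x \<in> D \<longleftrightarrow> y \<in> D"
      unfolding Dn C_def using that agree_sym[OF that(3)] agree_trans by blast
    then show ?thesis by (simp add: h_def indicator_def)
  qed
  have mTm [measurable]: "shift ^^ m \<in> measurable \<mu> \<mu>" for m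
    by (induction m) (auto intro: measurable_comp[OF _ mT] simp: id_def[symmetric])
  define \<nu> where "\<nu> = (\<integral>x. h x * f x \<partial>\<mu>)"
  have "\<nu> = (LINT x:D|\<mu>. f x)"
    unfolding \<nu>_def set_lebesgue_integral_def h_def
    by (intro Bochner_Integration.integral_cong) (auto simp: indicator_def)
  then have \<nu>: "\<nu> \<noteq> 0" using D by simp
  have int_hf: "integrable \<mu> (\<lambda>x. h ((shift ^^ m) x) * f x)" for m
  proof (rule Bochner_Integration.integrable_bound[OF int_f])
    show "AE x in \<mu>. norm (h ((shift ^^ m) x) * f x) \<le> norm (f x)"
      by (simp add: h_def indicator_def norm_mult)
  qed simp
  have twist: "(\<integral>x. c ^ m * h ((shift ^^ m) x) * f x \<partial>\<mu>) = \<nu>" for m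
  proof (induction m)
    case (Suc m)
    have "(\<integral>x. c ^ Suc m * h ((shift ^^ Suc m) x) * f x \<partial>\<mu>) =
        (\<integral>x. c ^ m * h ((shift ^^ m) (shift x)) * f (shift x) \<partial>\<mu>)"
    proof (rule integral_cong_AE)
      show "AE x in \<mu>. c ^ Suc m * h ((shift ^^ Suc m) x) * f x =
          c ^ m * h ((shift ^^ m) (shift x)) * f (shift x)"
        using ev by eventually_elim (simp add: funpow_swap1)
    qed measurable
    also have "\<dots> = (\<integral>x. c ^ m * h ((shift ^^ m) x) * f x \<partial>\<mu>)"
      by (rule inv_int[of "\<lambda>x. c ^ m * h ((shift ^^ m) x) * f x"]) measurable
    finally show ?case using Suc by simp
  qed (simp add: \<nu>_def)
  define J where "J = (\<integral>x. norm (f x) \<partial>\<mu>)"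
  have J: "J \<ge> 0" by (simp add: J_def)
  \<comment> \<open>Chosen so that \<open>\<kappa> * J < norm \<nu>\<close>; the summand 1 keeps the
    denominator positive.\<close>
  define \<kappa> where "\<kappa> = norm \<nu> / (2 * (J + 1))"
  have \<kappa>: "\<kappa> > 0" using \<nu> J by (simp add: \<kappa>_def)
  have freq: "\<exists>n. \<kappa> * real N \<le> norm (\<Sum>m<N. c ^ m * h ((shift ^^ (n + m)) u))" if N: "N > 0" for N
  proof (rule ccontr)
    assume "\<not> ?thesis"
    then have small: "\<And>n. norm (\<Sum>m<N. c ^ m * h ((shift ^^ (n + m)) u)) \<le> \<kappa> * real N"
      by (simp add: not_le less_imp_le)
    define b where "b x = (\<Sum>m<N. c ^ m * h ((shift ^^ m) x))" for x
    have bX: "norm (b x) \<le> \<kappa> * real N" if x: "x \<in> topspace X" for x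
    proof -
      \<comment> \<open>The extra length \<open>N\<close> lets one orbit point imitate
        \<open>x\<close> for all \<open>N\<close> shifts at once.\<close>
      obtain n where n: "agree (W + N) x ((shift ^^ n) u)" using X_approx[OF x] by blast
      have "h ((shift ^^ m) x) = h ((shift ^^ (n + m)) u)" if "m < N" for m
      proof -
        have "agree (W + m) x ((shift ^^ n) u)"
          using X_agree_mono[OF x orbit_in_X n] that by simp
        then have "agree W ((shift ^^ m) x) ((shift ^^ m) ((shift ^^ n) u))"
          by (rule agree_shift[OF x orbit_in_X])
        moreover have "(shift ^^ m) ((shift ^^ n) u) = (shift ^^ (n + m)) u"
          by (simp add: add.commute funpow_add)
        moreover have "(shift ^^ m) x \<in> topspace X" for m
          by (induction m) (simp_all add: x shift_in_X)
        ultimately show ?thesis using h_agree orbit_in_X by metis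
      qed
      then show ?thesis using small[of n] by (simp add: b_def)
    qed
    have "of_nat N * \<nu> = (\<Sum>m<N. \<integral>x. c ^ m * h ((shift ^^ m) x) * f x \<partial>\<mu>)"
      by (simp add: twist)
    also have "\<dots> = (\<integral>x. (\<Sum>m<N. c ^ m * h ((shift ^^ m) x) * f x) \<partial>\<mu>)"
      using int_hf by (intro Bochner_Integration.integral_sum[symmetric]) (simp add: mult.assoc)
    also have "\<dots> = (\<integral>x. b x * f x \<partial>\<mu>)" by (simp add: b_def sum_distrib_right)
    also have "norm \<dots> \<le> (\<integral>x. \<kappa> * real N * norm (f x) \<partial>\<mu>)"
    proof (rule order_trans[OF integral_norm_bound integral_mono])
      have "integrable \<mu> (\<lambda>x. \<Sum>m<N. c ^ m * h ((shift ^^ m) x) * f x)"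
        using int_hf by (intro Bochner_Integration.integrable_sum) (simp add: mult.assoc)
      then have "integrable \<mu> (\<lambda>x. b x * f x)" by (simp add: b_def sum_distrib_right)
      then show "integrable \<mu> (\<lambda>x. norm (b x * f x))" by (rule integrable_norm)
      show "integrable \<mu> (\<lambda>x. \<kappa> * real N * norm (f x))" using int_f by simp
      show "norm (b x * f x) \<le> \<kappa> * real N * norm (f x)" if "x \<in> space \<mu>" for x
        using bX that sp by (simp add: norm_mult mult_right_mono)
    qed
    also have "\<dots> = \<kappa> * real N * J" by (simp add: J_def)
    finally have "real N * norm \<nu> \<le> real N * (\<kappa> * J)" by (simp add: norm_mult mult_ac)
    then have "norm \<nu> \<le> \<kappa> * J" using N by simp
    also have "\<dots> < norm \<nu>"
      using \<nu> J add_nonneg_pos[of "J * norm \<nu>" "norm \<nu> * 2"] by (simp add: \<kappa>_def field_simps)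
    finally show False by simp
  qed
  have win: "h ((shift ^^ n) u) = h ((shift ^^ m) u)" if "same_window (level W u) W n m" for n m
    using that h_agree[OF orbit_in_X orbit_in_X] unfolding near_def[symmetric] agree_orbit by blast
  obtain q where "q > 0" "c ^ q = 1" "determines_mod (level W u) q"
    using subst_fixed_point.frequency_determined[where h = "\<lambda>n. h ((shift ^^ n) u)",
        OF levels win c1 \<kappa> freq] by blast
  then show thesis using that by (auto simp: moduli_def)
qed

end

section \<open>Fixed points given by automata\<close>

lemma profinite_fixed_point_level:
  assumes fixed: "subst_seq p (profinite_subst p (\<lambda>\<alpha>. automaton_subst p (\<delta> \<alpha>))) u = u" and "p > 0"
  shows "u n \<alpha> = \<delta> \<alpha> (u (n div p) \<alpha>) (n mod p)"
proof -
  have "u n = subst_seq p (profinite_subst p (\<lambda>\<alpha>. automaton_subst p (\<delta> \<alpha>))) u n" using fixed by simp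
  then show ?thesis using \<open>p > 0\<close> by (simp add: subst_seq_def profinite_subst_def automaton_subst_def)
qed

text \<open>Iterating the substitution on the letter \<open>w n\<close> spells out the aligned block
  of \<open>w\<close> with index \<open>n\<close>, so primitivity becomes a statement about
  positions in \<open>w\<close>.\<close>

lemma subst_fixed_point_if_primitive:
  assumes "prime p" and "finite A" and w: "range w \<subseteq> A"
    and rec: "\<And>n. w n = \<delta> (w (n div p)) (n mod p)"
    and prim: "primitive_subst A (automaton_subst p \<delta>)"
  shows "subst_fixed_point p w"
proof
  let ?\<theta> = "automaton_subst p \<delta>"
  show "prime p" by fact
  then have p: "p > 0" by (simp add: prime_gt_0_nat)
  show "finite (range w)" using assms(2) w finite_subset by blast
  have w_block: "w (p * n + i) = \<delta> (w n) i" if "i < p" for n i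
    using rec[of "p * n + i"] that by simp
  show "w (p * n + i) = w (p * m + i)" if "w n = w m" "i < p" for n m i
    using that by (simp add: w_block)
  obtain k where k: "\<And>a a'. a \<in> A \<Longrightarrow> a' \<in> A \<Longrightarrow> a' \<in> set ((subst_word ?\<theta> ^^ k) [a])"
    using prim unfolding primitive_subst_def by blast
  have set_word: "set (subst_word ?\<theta> v) = (\<Union>b\<in>set v. set (?\<theta> b))" for v
    by (simp add: subst_word_def)
  \<comment> \<open>Only the set of letters is followed: an inclusion is enough to locate each
    letter at some position of the block.\<close>
  have word: "set ((subst_word ?\<theta> ^^ k) [w n]) \<subseteq> (\<lambda>i. w (p ^ k * n + i)) ` {..<p ^ k}" for k n
  proof (induction k)
    case (Suc k)
    have "a \<in> (\<lambda>i. w (p ^ Suc k * n + i)) ` {..<p ^ Suc k}"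
      if b: "b \<in> set ((subst_word ?\<theta> ^^ k) [w n])" and a: "a \<in> set (?\<theta> b)" for a b
    proof -
      obtain i where i: "i < p ^ k" "b = w (p ^ k * n + i)" using Suc b by blast
      obtain j where j: "j < p" "a = \<delta> b j" using a by (auto simp: automaton_subst_def)
      have "a = w (p * (p ^ k * n + i) + j)" using i j w_block by simp
      moreover have "p * (p ^ k * n + i) + j = p ^ Suc k * n + (p * i + j)"
        by (simp add: algebra_simps)
      moreover have "p * i + j < p ^ Suc k"
      proof -
        have "p * Suc i \<le> p * p ^ k" using i(1) by (intro mult_le_mono2) simp
        then show ?thesis using j(1) by simp
      qed
      ultimately show ?thesis by auto
    qed
    then show ?case by (simp only: funpow.simps o_apply set_word) blast
  qed simp
  show "\<exists>k. \<forall>n m. \<exists>i<p ^ k. w (p ^ k * n + i) = w m"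
  proof (rule exI[of _ k], intro allI)
    fix n m
    have "w m \<in> set ((subst_word ?\<theta> ^^ k) [w n])" using k w by blast
    then have "w m \<in> (\<lambda>i. w (p ^ k * n + i)) ` {..<p ^ k}" using word by blast
    then show "\<exists>i<p ^ k. w (p ^ k * n + i) = w m" by auto
  qed
qed

theorem theorem4p7:
  fixes p :: nat
    and S :: "nat \<Rightarrow> 's set"
    and \<delta> :: "nat \<Rightarrow> 's \<Rightarrow> nat \<Rightarrow> 's"
    and init :: "nat \<Rightarrow> 's"
    and \<tau> :: "nat \<Rightarrow> 's \<Rightarrow> nat"
    and \<psi> :: "nat \<Rightarrow> nat \<Rightarrow> 's \<Rightarrow> 's"
    and \<theta> :: "nat \<Rightarrow> 's subst"
    and u :: "nat \<Rightarrow> nat \<Rightarrow> 's"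
    and Xu :: "(nat \<Rightarrow> nat \<Rightarrow> 's) topology"
    and X :: "nat \<Rightarrow> (nat \<Rightarrow> 's) topology"
    and \<mu> :: "(nat \<Rightarrow> nat \<Rightarrow> 's) measure"
  assumes "prime p"
    and "inverse_family p S \<delta> init \<tau> \<psi>"
    and "\<And>\<alpha>. \<delta> \<alpha> (init \<alpha>) 0 = init \<alpha>"
    and "\<And>\<alpha>. \<theta> \<alpha> = automaton_subst p (\<delta> \<alpha>)"
    and "\<And>\<alpha>. primitive_subst (S \<alpha>) (\<theta> \<alpha>)"
    and "u \<in> topspace (seq_space (state_limit S \<psi>))"
    and "subst_seq p (profinite_subst p \<theta>) u = u"
    and "Xu = subshift (state_limit S \<psi>) u"
    and "\<And>\<alpha>. X \<alpha> = subshift (discrete_topology (S \<alpha>)) (level \<alpha> u)"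
    and "invariant_borel_prob Xu shift \<mu>"
  shows
    \<comment> \<open>\<open>u\<^sub>\<alpha>\<close> is a fixed point of \<open>\<theta>\<^sub>\<alpha>\<close>\<close>
    "(\<forall>\<alpha>. subst_seq p (\<theta> \<alpha>) (level \<alpha> u) = level \<alpha> u)
    \<comment> \<open>\<open>(X\<^sub>u, \<mu>, \<sigma>)\<close> is the inverse limit of the systems \<open>(X\<^bsub>u\<^sub>\<alpha>\<^esub>, \<mu>\<^sub>\<alpha>, \<sigma>)\<close>\<close>
    \<and> homeomorphic_map Xu (inverse_limit X (\<lambda>\<alpha> \<beta> x n. \<psi> \<alpha> \<beta> (x n))) (\<lambda>x \<alpha>. level \<alpha> x)
    \<and> (\<forall>\<alpha>. factor_map Xu shift (X \<alpha>) shift (level \<alpha>)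
          \<and> invariant_borel_prob (X \<alpha>) shift (distr \<mu> (borel_of (X \<alpha>)) (level \<alpha>)))
    \<comment> \<open>the maximal equicontinuous factor (which exists) is an odometer\<close>
    \<and> (\<exists>(Y :: (nat \<Rightarrow> nat \<Rightarrow> 's) set topology) R \<pi>.
          maximal_equicontinuous_factor Xu shift Y R \<pi>)
    \<and> (\<forall>(Y :: 'y topology) R \<pi>.
          maximal_equicontinuous_factor Xu shift Y R \<pi> \<longrightarrow> is_odometer Y R)
    \<comment> \<open>measurable eigenvalues are continuous\<close>
    \<and> (\<forall>c. measurable_eigenvalue \<mu> shift c \<longrightarrow> continuous_eigenvalue Xu shift c)"
proof -
  have p: "p > 0" using assms(1) by (simp add: prime_gt_0_nat)
  have \<theta>: "\<theta> = (\<lambda>\<alpha>. automaton_subst p (\<delta> \<alpha>))" using assms(4) by auto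
  have u_state: "u n \<in> topspace (state_limit S \<psi>)" for n
    using assms(6) by (simp add: topspace_seq_space)
  have rec: "level \<alpha> u n = \<delta> \<alpha> (level \<alpha> u (n div p)) (n mod p)" for \<alpha> n
    unfolding level_def using assms(7) p unfolding \<theta> by (rule profinite_fixed_point_level)
  have "range (level \<alpha> u) \<subseteq> S \<alpha>" for \<alpha>
    using u_state by (auto simp: level_def topspace_state_limit)
  then have levels: "subst_fixed_point p (level \<alpha> u)" for \<alpha>
    using assms(5)[of \<alpha>] inverse_family.finite_states[OF assms(2)]
    unfolding \<theta>
    by (intro subst_fixed_point_if_primitive[where A = "S \<alpha>" and \<delta> = "\<delta> \<alpha>"] assms(1) rec)
  interpret limit_subshift p S \<psi> u
    using inverse_family.finite_states[OF assms(2)] u_state levels by (rule limit_subshift.intro)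
  have X: "X = (\<lambda>\<alpha>. subshift (discrete_topology (S \<alpha>)) (level \<alpha> u))" using assms(9) by auto
  have "subst_seq p (\<theta> \<alpha>) (level \<alpha> u) = level \<alpha> u" for \<alpha>
  proof
    show "subst_seq p (\<theta> \<alpha>) (level \<alpha> u) n = level \<alpha> u n" for n
      using rec[of \<alpha> n, symmetric] p by (simp add: subst_seq_def \<theta> automaton_subst_def)
  qed
  moreover have "invariant_borel_prob (X \<alpha>) shift (distr \<mu> (borel_of (X \<alpha>)) (level \<alpha>))" for \<alpha>
    using invariant_borel_prob_factor[OF assms(10)[unfolded assms(8)] level_factor_map
        continuous_map_shift_subshift] by (simp add: X)
  moreover have "continuous_eigenvalue Xu shift c" if "measurable_eigenvalue \<mu> shift c" for c
    using measurable_eigenvalue_root[OF assms(10)[unfolded assms(8)] that]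
      root_continuous_eigenvalue unfolding assms(8) by blast
  ultimately show ?thesis
    using homeomorphic_inverse_limit level_factor_map maximal_equicontinuous_factor_exists
      maximal_equicontinuous_factor_is_odometer
    unfolding assms(8) X by blast
qed

end
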